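(* Let $a>1$, $\sigma^2>0$, $Z_i$ i.i.d. $\mathcal{N}(0,\sigma^2)$, $U_0=0$, $U_i=aU_{i-1}+Z_i$. For $d\in(0,d_{\max})$, $d_{\max}=\frac{\sigma^2}{a^2-1}$, the operational dispersion $$V_U(d)=\lim_{\epsilon\to0}\limsup_{n\to\infty}n\left(\frac{R(n,d,\epsilon)-\mathbb{R}_U(d)}{Q^{-1}(\epsilon)}\right)^2$$ equals the informational dispersion $$\mathbb{V}_U(d)=\frac1{4\pi}\int_{-\pi}^{\pi}\min\left[1,\left(\frac{\sigma^2}{\theta g(w)}\right)^2\right]dw.$$
   Context: Distortion: $\mathsf{d}(x_1^n,y_1^n)=\frac1n\sum_{i=1}^n(x_i-y_i)^2$. An $(n,M,d,\epsilon)$ code consists of $f:\mathbb{R}^n\to\{1,\ldots,M\}$ and $g:\{1,\ldots,M\}\to\mathbb{R}^n$ with $\mathbb{P}[\mathsf{d}(U_1^n,g(f(U_1^n)))>d]\le\epsilon$; $R(n,d,\epsilon)=\frac1n\log\min\{M:\exists (n,M,d,\epsilon)\text{ code}\}$. $g(w)=1+a^2-2a\cos w$; $\theta>0$ solves $d=\frac1{2\pi}\int_{-\pi}^{\pi}\min(\theta,\sigma^2/g(w))dw$; $\mathbb{R}_U(d)=\frac1{2\pi}\int_{-\pi}^{\pi}\frac12\log\max(g(w),\sigma^2/\theta)\,dw$ is the rate-distortion function. $Q^{-1}$ is the inverse of the standard Gaussian tail function $Q$. *)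

theory Defs
  imports "HOL-Probability.Probability"
begin

text \<open>Vectors in R^n are represented as functions nat => real, only the
coordinates 0..n-1 being relevant (index i stands for coordinate i+1).\<close>

definition Zmeas :: "real \<Rightarrow> nat \<Rightarrow> (nat \<Rightarrow> real) measure" where
  "Zmeas \<sigma> n = PiM {..<n} (\<lambda>_. density lborel (normal_density 0 \<sigma>))"

text \<open>U_0 = 0, U_i = a U_{i-1} + Z_i, i.e. U_i = sum_{j=1}^i a^(i-j) Z_j
(coordinate k stands for U_{k+1}, Z k for Z_{k+1}).\<close>
definition Uvec :: "real \<Rightarrow> (nat \<Rightarrow> real) \<Rightarrow> (nat \<Rightarrow> real)" where
  "Uvec a z = (\<lambda>k. \<Sum>j\<le>k. a ^ (k - j) * z j)"

definition distortion :: "nat \<Rightarrow> (nat \<Rightarrow> real) \<Rightarrow> (nat \<Rightarrow> real) \<Rightarrow> real" where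
  "distortion n x y = (1 / real n) * (\<Sum>i<n. (x i - y i)^2)"

definition has_code :: "real \<Rightarrow> real \<Rightarrow> nat \<Rightarrow> nat \<Rightarrow> real \<Rightarrow> real \<Rightarrow> bool" where
  "has_code a \<sigma> n M d \<epsilon> \<longleftrightarrow>
     (\<exists>(f :: (nat \<Rightarrow> real) \<Rightarrow> nat) (g :: nat \<Rightarrow> (nat \<Rightarrow> real)).
        (\<forall>x. f x \<in> {1..M}) \<and>
        (let E = {z \<in> space (Zmeas \<sigma> n).
                    distortion n (Uvec a z) (g (f (Uvec a z))) > d}
         in E \<in> sets (Zmeas \<sigma> n) \<and> measure (Zmeas \<sigma> n) E \<le> \<epsilon>))"

definition Rn :: "real \<Rightarrow> real \<Rightarrow> nat \<Rightarrow> real \<Rightarrow> real \<Rightarrow> real" where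
  "Rn a \<sigma> n d \<epsilon> = (1 / real n) * ln (real (LEAST M. has_code a \<sigma> n M d \<epsilon>))"

definition gfun :: "real \<Rightarrow> real \<Rightarrow> real" where
  "gfun a w = 1 + a^2 - 2 * a * cos w"

definition Qfun :: "real \<Rightarrow> real" where
  "Qfun x = measure (density lborel std_normal_density) {x<..}"

definition Qinv :: "real \<Rightarrow> real" where
  "Qinv \<epsilon> = (THE x. Qfun x = \<epsilon>)"

text \<open>Rate-distortion function, given the water level theta.\<close>
definition RU :: "real \<Rightarrow> real \<Rightarrow> real \<Rightarrow> real" where
  "RU a \<sigma> \<theta> = (1 / (2 * pi)) *
     integral {-pi..pi} (\<lambda>w. (1/2) * ln (max (gfun a w) (\<sigma>^2 / \<theta>)))"

definition VU :: "real \<Rightarrow> real \<Rightarrow> real \<Rightarrow> real" where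
  "VU a \<sigma> \<theta> = (1 / (4 * pi)) *
     integral {-pi..pi} (\<lambda>w. min 1 ((\<sigma>^2 / (\<theta> * gfun a w))^2))"

end

theory Submission
  imports Defs "Jordan_Normal_Form.Determinant" "HOL-Real_Asymp.Real_Asymp"
begin

text \<open>An explicit orthogonal change of variables turns the source into independent Gaussian modes: the
  last sample \<open>U\<^sub>n\<close>, of exponentially growing variance, and \<open>n - 1\<close> modes of variances
  \<open>\<sigma>\<^sup>2 / g(k\<pi>/n)\<close>. The product of the \<open>g(k\<pi>/n)\<close> is the variance of \<open>U\<^sub>n\<close> divided by \<open>\<sigma>\<^sup>2\<close>, so the
  rate spent on \<open>U\<^sub>n\<close> turns the reverse water-filling terms \<open>1/2 ln max(1, \<sigma>\<^sup>2/(\<theta>g))\<close> into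
  \<open>1/2 ln max(g, \<sigma>\<^sup>2/\<theta>)\<close>. Riemann sums of monotone functions of \<open>g\<close> have error \<open>O(1)\<close>.

  Converse: the exponential of the \<open>d\<close>-tilted information, discounted by the distortion to any fixed
  codeword, has mean at most one, so Markov's inequality and a union bound over the codewords bound the
  probability that the tilted information exceeds the logarithm of the code size.

  Achievability: \<open>U\<^sub>n\<close> is quantized uniformly, and the other modes are covered greedily by Gaussian
  codewords whose probability of covering a typical source vector is at least
  \<open>exp (- tilted information - o(sqrt n))\<close>.

  The tilted information is a weighted sum of centered chi-square variables; by the central limit theorem
  \<open>sqrt n (R(n, d, \<epsilon>) - R\<^sub>U(d))\<close> converges to \<open>sqrt V Q\<^sup>-\<^sup>1(\<epsilon>)\<close> for every small \<open>\<epsilon>\<close>.\<close>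

section \<open>Products of Gaussian measures\<close>

text \<open>The condition on \<open>d\<close> makes the water level smaller than the largest mode
  variance. A positive fraction of the modes then has variance above \<theta> by a fixed margin, and
  only the distortion of such modes can be tuned upwards as well as downwards. That tuning is the
  delicate point: the covering exponent may be wrong by a small multiple of sqrt n only, while the
  distortion of the test channel fluctuates on the scale sqrt n itself. Splitting off the last
  sample removes the one exponentially large eigenvalue of the covariance. Given that sample, the
  fluctuations of the others form a bridge that vanishes at both ends, for which sine vectors are
  exact eigenvectors at every block length, so no Toeplitz approximation is left. Quantizing the
  last sample costs \<open>ln (last_scale a n)\<close> plus O(ln n), and the logarithmic part is
  below the second order. The factor 1/(4 pi) in front of the dispersion, instead of 1/(2 pi), is
  the variance 1/2 of half a centred chi-square variable.\<close>

lemma PiM_density: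
  fixes f :: "'i \<Rightarrow> 'a \<Rightarrow> ennreal"
  assumes "finite I" and "product_sigma_finite M"
    and D: "product_sigma_finite (\<lambda>i. density (M i) (f i))"
    and f: "\<And>i. i \<in> I \<Longrightarrow> f i \<in> borel_measurable (M i)"
  shows "PiM I (\<lambda>i. density (M i) (f i)) = density (PiM I M) (\<lambda>x. \<Prod>i\<in>I. f i (x i))"
proof -
  interpret M: product_sigma_finite M by fact
  interpret D: product_sigma_finite "\<lambda>i. density (M i) (f i)" by fact
  have S: "sets (PiM I (\<lambda>i. density (M i) (f i))) = sets (PiM I M)"
    by (intro sets_PiM_cong) auto
  have F: "(\<lambda>x. \<Prod>i\<in>I. f i (x i)) \<in> borel_measurable (PiM I M)"
    using f by (intro borel_measurable_prod_ennreal measurable_compose[OF measurable_component_singleton]) auto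
  show ?thesis
  proof (rule D.PiM_eqI[symmetric, OF \<open>finite I\<close>])
    show "sets (density (PiM I M) (\<lambda>x. \<Prod>i\<in>I. f i (x i))) = sets (PiM I (\<lambda>i. density (M i) (f i)))"
      using S by simp
    fix A assume "\<And>i. i \<in> I \<Longrightarrow> A i \<in> sets (density (M i) (f i))"
    then have A: "\<And>i. i \<in> I \<Longrightarrow> A i \<in> sets (M i)" by simp
    have "emeasure (density (PiM I M) (\<lambda>x. \<Prod>i\<in>I. f i (x i))) (Pi\<^sub>E I A)
      = (\<integral>\<^sup>+x. (\<Prod>i\<in>I. f i (x i)) * indicator (Pi\<^sub>E I A) x \<partial>PiM I M)"
      using F A \<open>finite I\<close> by (intro emeasure_density) (auto intro!: sets_PiM_I_finite)
    also have "\<dots> = (\<integral>\<^sup>+x. (\<Prod>i\<in>I. f i (x i) * indicator (A i) (x i)) \<partial>PiM I M)"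
    proof (rule nn_integral_cong)
      fix x assume "x \<in> space (PiM I M)"
      then have "x \<in> extensional I" by (auto simp: space_PiM PiE_def)
      then have "indicator (Pi\<^sub>E I A) x = (\<Prod>i\<in>I. indicator (A i) (x i) :: ennreal)"
        using \<open>finite I\<close> by (auto simp: indicator_def PiE_def Pi_def prod_eq_1_iff intro!: prod_zero[symmetric])
      then show "(\<Prod>i\<in>I. f i (x i)) * indicator (Pi\<^sub>E I A) x = (\<Prod>i\<in>I. f i (x i) * indicator (A i) (x i))"
        by (simp add: prod.distrib)
    qed
    also have "\<dots> = (\<Prod>i\<in>I. \<integral>\<^sup>+x. f i x * indicator (A i) x \<partial>M i)"
      using f A \<open>finite I\<close> by (intro M.product_nn_integral_prod) auto
    also have "\<dots> = (\<Prod>i\<in>I. emeasure (density (M i) (f i)) (A i))"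
      using f A by (intro prod.cong emeasure_density[symmetric]) auto
    finally show "emeasure (density (PiM I M) (\<lambda>x. \<Prod>i\<in>I. f i (x i))) (Pi\<^sub>E I A)
      = (\<Prod>i\<in>I. emeasure (density (M i) (f i)) (A i))" .
  qed
qed

lemma product_sigma_finite_lborel: "product_sigma_finite (\<lambda>_::'i. lborel :: real measure)"
  by (simp add: product_sigma_finite_def sigma_finite_lborel)

lemma product_prob_space_normal:
  assumes "\<And>i. 0 < s i"
  shows "product_prob_space (\<lambda>i. density lborel (normal_density (m i) (s i)))"
proof -
  interpret prob_space "density lborel (normal_density (m i) (s i))" for i
    using assms by (rule prob_space_normal_density)
  show ?thesis by standard
qed

lemma product_sigma_finite_normal:
  assumes "\<And>i. 0 < s i"
  shows "product_sigma_finite (\<lambda>i. density lborel (normal_density (m i) (s i)))"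
  using assms by (simp add: product_sigma_finite_def prob_space_imp_sigma_finite prob_space_normal_density)

lemma prob_space_PiM_normal:
  assumes "\<And>i. 0 < s i"
  shows "prob_space (PiM I (\<lambda>i. density lborel (normal_density (m i) (s i))))"
  using assms by (intro prob_space_PiM prob_space_normal_density)

text \<open>Product Lebesgue measure is determined by its values on boxes, where a translation acts
  on each side separately.\<close>

lemma nn_integral_PiM_lborel_shift:
  fixes I :: "'i set" and f :: "('i \<Rightarrow> real) \<Rightarrow> ennreal"
  assumes "finite I" and f: "f \<in> borel_measurable (PiM I (\<lambda>_. lborel))"
  shows "(\<integral>\<^sup>+x. f (\<lambda>i\<in>I. x i + v i) \<partial>PiM I (\<lambda>_. lborel)) = integral\<^sup>N (PiM I (\<lambda>_. lborel)) f"
proof -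
  let ?L = "PiM I (\<lambda>_. lborel :: real measure)"
  interpret product_sigma_finite "\<lambda>_::'i. lborel :: real measure" by (rule product_sigma_finite_lborel)
  have T: "(\<lambda>x. \<lambda>i\<in>I. x i + v i) \<in> measurable ?L ?L"
    by measurable
  have "distr ?L ?L (\<lambda>x. \<lambda>i\<in>I. x i + v i) = ?L"
  proof (rule PiM_eqI[OF \<open>finite I\<close>])
    fix A :: "'i \<Rightarrow> real set" assume A: "\<And>i. i \<in> I \<Longrightarrow> A i \<in> sets lborel"
    have "emeasure (distr ?L ?L (\<lambda>x. \<lambda>i\<in>I. x i + v i)) (Pi\<^sub>E I A)
      = emeasure ?L ((\<lambda>x. \<lambda>i\<in>I. x i + v i) -` Pi\<^sub>E I A \<inter> space ?L)"
      using A \<open>finite I\<close> by (intro emeasure_distr T sets_PiM_I_finite) auto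
    also have "(\<lambda>x. \<lambda>i\<in>I. x i + v i) -` Pi\<^sub>E I A \<inter> space ?L = Pi\<^sub>E I (\<lambda>i. (\<lambda>y. y + v i) -` A i)"
      by (auto simp: space_PiM PiE_def Pi_def extensional_def)
    also have "emeasure ?L (Pi\<^sub>E I (\<lambda>i. (\<lambda>y. y + v i) -` A i)) = (\<Prod>i\<in>I. emeasure lborel ((\<lambda>y. y + v i) -` A i))"
      using A \<open>finite I\<close> by (intro emeasure_PiM) (auto intro!: measurable_sets_borel[where M=borel])
    also have "\<dots> = (\<Prod>i\<in>I. emeasure lborel (A i))"
    proof (rule prod.cong[OF refl])
      fix i assume "i \<in> I"
      have "emeasure lborel (A i) = emeasure (distr lborel borel ((+) (v i))) (A i)"
        by (simp add: lborel_distr_plus)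
      also have "\<dots> = emeasure lborel ((\<lambda>y. y + v i) -` A i)"
        using A[OF \<open>i \<in> I\<close>] by (subst emeasure_distr) (auto simp: vimage_def add.commute)
      finally show "emeasure lborel ((\<lambda>y. y + v i) -` A i) = emeasure lborel (A i)" by simp
    qed
    finally show "emeasure (distr ?L ?L (\<lambda>x. \<lambda>i\<in>I. x i + v i)) (Pi\<^sub>E I A) = (\<Prod>i\<in>I. emeasure lborel (A i))" .
  qed simp
  then show ?thesis
    using nn_integral_distr[OF T, of f] f by simp
qed

section \<open>Orthogonal changes of variables\<close>

lemma orthonormal_sum_square:
  fixes e :: "'k \<Rightarrow> 'i \<Rightarrow> real"
  assumes fin: "finite K" and orth: "\<And>k l. k \<in> K \<Longrightarrow> l \<in> K \<Longrightarrow> (\<Sum>i\<in>I. e k i * e l i) = (if k = l then 1 else 0)"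
  shows "(\<Sum>i\<in>I. (\<Sum>k\<in>K. e k i * p k)^2) = (\<Sum>k\<in>K. (p k)^2)"
proof -
  have "(\<Sum>i\<in>I. (\<Sum>k\<in>K. e k i * p k)^2) = (\<Sum>i\<in>I. \<Sum>k\<in>K. \<Sum>l\<in>K. (e k i * e l i) * (p k * p l))"
    by (intro sum.cong refl) (simp add: power2_eq_square sum_product mult_ac)
  also have "\<dots> = (\<Sum>k\<in>K. \<Sum>l\<in>K. \<Sum>i\<in>I. (e k i * e l i) * (p k * p l))"
    by (subst sum.swap, rule sum.cong[OF refl], rule sum.swap)
  also have "\<dots> = (\<Sum>k\<in>K. \<Sum>l\<in>K. (if k = l then p k * p l else 0))"
    by (intro sum.cong refl) (auto simp: sum_distrib_right[symmetric] orth)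
  also have "\<dots> = (\<Sum>k\<in>K. (p k)^2)"
    using fin by (simp add: power2_eq_square)
  finally show ?thesis .
qed

text \<open>The squared norm of \<open>v\<close> minus its projection is nonnegative; by
  \<open>orthonormal_sum_square\<close> it equals the difference of the two sides.\<close>

lemma Bessel_inequality_finite:
  fixes e :: "'k \<Rightarrow> 'i \<Rightarrow> real"
  assumes fin: "finite K" and orth: "\<And>k l. k \<in> K \<Longrightarrow> l \<in> K \<Longrightarrow> (\<Sum>i\<in>I. e k i * e l i) = (if k = l then 1 else 0)"
  shows "(\<Sum>k\<in>K. (\<Sum>i\<in>I. e k i * v i)^2) \<le> (\<Sum>i\<in>I. (v i)^2)"
proof -
  define p where "p k = (\<Sum>i\<in>I. e k i * v i)" for k
  have "0 \<le> (\<Sum>i\<in>I. (v i - (\<Sum>k\<in>K. e k i * p k))^2)" by (intro sum_nonneg) auto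
  also have "\<dots> = (\<Sum>i\<in>I. (v i)^2) + (\<Sum>i\<in>I. (\<Sum>k\<in>K. e k i * p k)^2) - 2 * (\<Sum>i\<in>I. v i * (\<Sum>k\<in>K. e k i * p k))"
    by (simp add: power2_diff sum.distrib sum_subtractf sum_distrib_left mult.assoc)
  also have "(\<Sum>i\<in>I. v i * (\<Sum>k\<in>K. e k i * p k)) = (\<Sum>k\<in>K. p k * (\<Sum>i\<in>I. e k i * v i))"
    unfolding sum_distrib_left by (subst sum.swap) (simp add: mult_ac)
  also have "\<dots> = (\<Sum>k\<in>K. (p k)^2)" by (simp add: p_def power2_eq_square)
  also have "(\<Sum>i\<in>I. (\<Sum>k\<in>K. e k i * p k)^2) = (\<Sum>k\<in>K. (p k)^2)"
    by (rule orthonormal_sum_square[OF fin orth])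
  finally show ?thesis by (simp add: p_def)
qed

text \<open>The restriction makes the image extensional, so that \<open>lin I A\<close> maps the
  product space over \<open>I\<close> into itself.\<close>

definition lin :: "'i set \<Rightarrow> ('i \<Rightarrow> 'i \<Rightarrow> real) \<Rightarrow> ('i \<Rightarrow> real) \<Rightarrow> ('i \<Rightarrow> real)" where
  "lin I A x = (\<lambda>i\<in>I. \<Sum>k\<in>I. A i k * x k)"

lemma measurable_lin[measurable]:
  "lin I A \<in> measurable (PiM I (\<lambda>_. borel)) (PiM I (\<lambda>_. borel))"
  unfolding lin_def by measurable

lemma measurable_lin_component[measurable]:
  assumes "i \<in> I" "f \<in> measurable N (PiM I (\<lambda>_. borel))"
  shows "(\<lambda>x. lin I A (f x) i) \<in> borel_measurable N"
  using measurable_compose[OF measurable_compose[OF assms(2) measurable_lin] measurable_component_singleton[OF assms(1)]] .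

lemma lin_norm:
  assumes "finite I"
    and orth: "\<And>k l. k \<in> I \<Longrightarrow> l \<in> I \<Longrightarrow> (\<Sum>i\<in>I. A i k * A i l) = (if k = l then 1 else 0)"
  shows "(\<Sum>i\<in>I. (lin I A x i)^2) = (\<Sum>k\<in>I. (x k)^2)"
proof -
  have "(\<Sum>i\<in>I. (lin I A x i)^2) = (\<Sum>i\<in>I. (\<Sum>k\<in>I. A i k * x k)^2)"
    by (simp add: lin_def)
  also have "\<dots> = (\<Sum>k\<in>I. (x k)^2)"
    by (rule orthonormal_sum_square[OF assms])
  finally show ?thesis .
qed

lemma lin_lin_transpose:
  assumes "finite I"
    and orth: "\<And>i j. i \<in> I \<Longrightarrow> j \<in> I \<Longrightarrow> (\<Sum>k\<in>I. A i k * A j k) = (if i = j then 1 else 0)"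
    and "i \<in> I"
  shows "lin I A (lin I (\<lambda>i k. A k i) x) i = x i"
proof -
  have "lin I A (lin I (\<lambda>i k. A k i) x) i = (\<Sum>k\<in>I. \<Sum>j\<in>I. (A i k * A j k) * x j)"
    using \<open>i \<in> I\<close> by (simp add: lin_def sum_distrib_left mult_ac)
  also have "\<dots> = (\<Sum>j\<in>I. (\<Sum>k\<in>I. A i k * A j k) * x j)"
    by (subst sum.swap) (simp add: sum_distrib_right)
  also have "\<dots> = (\<Sum>j\<in>I. if i = j then x j else 0)"
    using \<open>i \<in> I\<close> by (intro sum.cong refl) (auto simp: orth)
  also have "\<dots> = x i" using assms by simp
  finally show ?thesis .
qed

lemma prod_normal_density:
  assumes "finite I"
  shows "(\<Prod>i\<in>I. normal_density 0 s (x i)) = (1 / sqrt (2 * pi * s\<^sup>2)) ^ card I * exp (- (\<Sum>i\<in>I. (x i)^2) / (2 * s^2))"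
  unfolding normal_density_def prod.distrib prod_constant exp_sum[OF assms, symmetric]
  by (simp add: sum_negf sum_divide_distrib)

text \<open>Uniqueness of Haar measure: inserting a Gaussian density \<open>p\<close> of mass one and using
  Fubini, \<open>\<integral>f(Tx) dx = \<integral>\<integral>f(Tx) p(Tx + y) dy dx = \<integral>\<integral>f(Tx - y) p(Tx) dx dy\<close>; since \<open>p\<close> is
  invariant under the isometry \<open>T\<close>, the last expression is \<open>\<integral>f(-y) dy\<close>. Using this for \<open>T\<close> and for
  the identity shows that \<open>T\<close> preserves Lebesgue measure.\<close>

lemma nn_integral_lin_eq_reflect:
  fixes I :: "'i set" and f :: "('i \<Rightarrow> real) \<Rightarrow> ennreal"
  assumes fin: "finite I"
    and orth: "\<And>k l. k \<in> I \<Longrightarrow> l \<in> I \<Longrightarrow> (\<Sum>i\<in>I. A i k * A i l) = (if k = l then 1 else 0)"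
    and orth': "\<And>i j. i \<in> I \<Longrightarrow> j \<in> I \<Longrightarrow> (\<Sum>k\<in>I. A i k * A j k) = (if i = j then 1 else 0)"
    and f[measurable]: "f \<in> borel_measurable (PiM I (\<lambda>_. lborel))"
  shows "(\<integral>\<^sup>+x. f (lin I A x) \<partial>PiM I (\<lambda>_. lborel)) = (\<integral>\<^sup>+x. f (\<lambda>i\<in>I. - x i) \<partial>PiM I (\<lambda>_. lborel))"
proof -
  let ?L = "PiM I (\<lambda>_. lborel :: real measure)"
  let ?T = "lin I A" and ?T' = "lin I (\<lambda>i k. A k i)"
  interpret product_sigma_finite "\<lambda>_::'i. lborel :: real measure" by (rule product_sigma_finite_lborel)
  interpret finite_product_sigma_finite "\<lambda>_::'i. lborel :: real measure" I by standard (rule fin)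
  interpret L: sigma_finite_measure ?L by (rule product_sigma_finite.sigma_finite[OF product_sigma_finite_lborel fin])
  interpret pair_sigma_finite ?L ?L ..
  define p :: "('i \<Rightarrow> real) \<Rightarrow> ennreal" where "p x = ennreal (\<Prod>i\<in>I. normal_density 0 1 (x i))" for x
  have [measurable]: "p \<in> borel_measurable ?L" unfolding p_def by measurable
  have pT: "p (?T x) = p x" for x
    unfolding p_def prod_normal_density[OF fin] using lin_norm[OF fin orth, of x] by (simp del: lin_def)
  have p1: "integral\<^sup>N ?L p = 1"
  proof -
    have "integral\<^sup>N ?L p = (\<integral>\<^sup>+x. (\<Prod>i\<in>I. ennreal (normal_density 0 1 (x i))) \<partial>?L)"
      unfolding p_def by (simp add: prod_ennreal)
    also have "\<dots> = (\<Prod>i\<in>I. \<integral>\<^sup>+x. ennreal (normal_density 0 1 x) \<partial>lborel)"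
      using fin by (intro product_nn_integral_prod) auto
    also have "\<dots> = 1" by (simp add: nn_integral_eq_integral)
    finally show ?thesis .
  qed
  have shift: "(\<integral>\<^sup>+x. h (\<lambda>i\<in>I. x i + v i) \<partial>?L) = integral\<^sup>N ?L h" if "h \<in> borel_measurable ?L" for h v
    by (rule nn_integral_PiM_lborel_shift[OF fin that])
  have lin_shift: "?T (\<lambda>i\<in>I. x i + ?T' v i) = (\<lambda>i\<in>I. ?T x i + v i)" for x v
  proof
    fix i
    show "?T (\<lambda>i\<in>I. x i + ?T' v i) i = (\<lambda>i\<in>I. ?T x i + v i) i"
    proof (cases "i \<in> I")
      case True
      have "?T (\<lambda>i\<in>I. x i + ?T' v i) i = ?T x i + ?T (?T' v) i"
        using True by (simp add: lin_def distrib_left sum.distrib)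
      then show ?thesis using lin_lin_transpose[OF fin orth' True] True by simp
    qed (simp add: lin_def)
  qed
  have T_ext: "?T x \<in> extensional I" for x by (simp add: lin_def)
  have "(\<integral>\<^sup>+x. f (?T x) \<partial>?L) = (\<integral>\<^sup>+x. (\<integral>\<^sup>+y. f (?T x) * p (\<lambda>i\<in>I. y i + ?T x i) \<partial>?L) \<partial>?L)"
  proof (rule nn_integral_cong)
    fix x
    have "(\<integral>\<^sup>+y. f (?T x) * p (\<lambda>i\<in>I. y i + ?T x i) \<partial>?L) = f (?T x) * (\<integral>\<^sup>+y. p (\<lambda>i\<in>I. y i + ?T x i) \<partial>?L)"
      by (intro nn_integral_cmult) measurable
    also have "(\<integral>\<^sup>+y. p (\<lambda>i\<in>I. y i + ?T x i) \<partial>?L) = 1"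
      using shift[of p "?T x"] p1 by simp
    finally show "f (?T x) = (\<integral>\<^sup>+y. f (?T x) * p (\<lambda>i\<in>I. y i + ?T x i) \<partial>?L)" by (simp only: mult_1_right)
  qed
  also have "\<dots> = (\<integral>\<^sup>+y. (\<integral>\<^sup>+x. f (?T x) * p (\<lambda>i\<in>I. y i + ?T x i) \<partial>?L) \<partial>?L)"
    by (rule Fubini'[symmetric]) measurable
  \<comment> \<open>In the inner integral, translate \<open>x\<close> by the transpose applied to
    \<open>- y\<close>. By \<open>lin_shift\<close> this subtracts \<open>y\<close> from the image
    of \<open>x\<close>, and the Gaussian weight no longer depends on \<open>y\<close>.\<close>
  also have "\<dots> = (\<integral>\<^sup>+y. (\<integral>\<^sup>+x. f (\<lambda>i\<in>I. - y i + ?T x i) * p (?T x) \<partial>?L) \<partial>?L)"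
  proof (rule nn_integral_cong)
    fix y
    define h where "h = (\<lambda>x. f (?T x) * p (\<lambda>i\<in>I. y i + ?T x i))"
    have hm: "h \<in> borel_measurable ?L" unfolding h_def by measurable
    have "(\<integral>\<^sup>+x. h x \<partial>?L) = (\<integral>\<^sup>+x. h (\<lambda>i\<in>I. x i + ?T' (\<lambda>i. - y i) i) \<partial>?L)"
      using shift[OF hm] by simp
    also have "\<dots> = (\<integral>\<^sup>+x. f (\<lambda>i\<in>I. - y i + ?T x i) * p (?T x) \<partial>?L)"
    proof (rule nn_integral_cong)
      fix x
      have e: "(\<lambda>i\<in>I. y i + (\<lambda>i\<in>I. ?T x i - y i) i) = ?T x"
        using T_ext by (auto simp: extensional_def fun_eq_iff)
      show "h (\<lambda>i\<in>I. x i + ?T' (\<lambda>i. - y i) i) = f (\<lambda>i\<in>I. - y i + ?T x i) * p (?T x)"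
        unfolding h_def lin_shift using e by (simp add: algebra_simps)
    qed
    finally show "(\<integral>\<^sup>+x. f (?T x) * p (\<lambda>i\<in>I. y i + ?T x i) \<partial>?L) = (\<integral>\<^sup>+x. f (\<lambda>i\<in>I. - y i + ?T x i) * p (?T x) \<partial>?L)"
      unfolding h_def .
  qed
  also have "\<dots> = (\<integral>\<^sup>+x. (\<integral>\<^sup>+y. f (\<lambda>i\<in>I. - y i + ?T x i) * p (?T x) \<partial>?L) \<partial>?L)"
    by (rule Fubini') measurable
  also have "\<dots> = (\<integral>\<^sup>+x. (\<integral>\<^sup>+y. f (\<lambda>i\<in>I. - y i) \<partial>?L) * p x \<partial>?L)"
  proof (rule nn_integral_cong)
    fix x
    have "(\<integral>\<^sup>+y. f (\<lambda>i\<in>I. - y i + ?T x i) * p (?T x) \<partial>?L) = (\<integral>\<^sup>+y. f (\<lambda>i\<in>I. - y i + ?T x i) \<partial>?L) * p x"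
      unfolding pT by (intro nn_integral_multc) measurable
    also have "(\<integral>\<^sup>+y. f (\<lambda>i\<in>I. - y i + ?T x i) \<partial>?L) = (\<integral>\<^sup>+y. f (\<lambda>i\<in>I. - (\<lambda>i\<in>I. y i + - ?T x i) i) \<partial>?L)"
      by (intro nn_integral_cong arg_cong[where f=f]) auto
    also have "\<dots> = (\<integral>\<^sup>+y. f (\<lambda>i\<in>I. - y i) \<partial>?L)"
      using shift[of "\<lambda>y. f (\<lambda>i\<in>I. - y i)" "\<lambda>i. - ?T x i"] by simp
    finally show "(\<integral>\<^sup>+y. f (\<lambda>i\<in>I. - y i + ?T x i) * p (?T x) \<partial>?L) = (\<integral>\<^sup>+y. f (\<lambda>i\<in>I. - y i) \<partial>?L) * p x" .
  qed
  also have "\<dots> = (\<integral>\<^sup>+y. f (\<lambda>i\<in>I. - y i) \<partial>?L)"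
    using p1 by (simp add: nn_integral_cmult)
  finally show ?thesis .
qed

lemma nn_integral_lin_lborel:
  fixes I :: "'i set" and f :: "('i \<Rightarrow> real) \<Rightarrow> ennreal"
  assumes fin: "finite I"
    and orth: "\<And>k l. k \<in> I \<Longrightarrow> l \<in> I \<Longrightarrow> (\<Sum>i\<in>I. A i k * A i l) = (if k = l then 1 else 0)"
    and orth': "\<And>i j. i \<in> I \<Longrightarrow> j \<in> I \<Longrightarrow> (\<Sum>k\<in>I. A i k * A j k) = (if i = j then 1 else 0)"
    and f: "f \<in> borel_measurable (PiM I (\<lambda>_. lborel))"
  shows "(\<integral>\<^sup>+x. f (lin I A x) \<partial>PiM I (\<lambda>_. lborel)) = integral\<^sup>N (PiM I (\<lambda>_. lborel)) f"
proof -
  let ?E = "\<lambda>i k. if i = k then 1 else 0 :: real"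
  have "(\<integral>\<^sup>+x. f (lin I ?E x) \<partial>PiM I (\<lambda>_. lborel)) = (\<integral>\<^sup>+x. f (\<lambda>i\<in>I. - x i) \<partial>PiM I (\<lambda>_. lborel))"
    using fin f by (intro nn_integral_lin_eq_reflect) (auto simp: if_distrib[where f="\<lambda>x. x * _"] cong: if_cong)
  moreover have "(\<integral>\<^sup>+x. f (lin I ?E x) \<partial>PiM I (\<lambda>_. lborel)) = integral\<^sup>N (PiM I (\<lambda>_. lborel)) f"
  proof (rule nn_integral_cong)
    fix x :: "'i \<Rightarrow> real" assume "x \<in> space (PiM I (\<lambda>_. lborel))"
    then have "x \<in> extensional I" by (auto simp: space_PiM PiE_def)
    then have "lin I ?E x = x"
      using fin by (auto simp: lin_def extensional_def fun_eq_iff if_distrib[where f="\<lambda>x. x * _"] cong: if_cong)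
    then show "f (lin I ?E x) = f x" by simp
  qed
  ultimately show ?thesis
    using nn_integral_lin_eq_reflect[OF assms] by simp
qed

lemma PiM_normal_eq_density:
  assumes "finite I" "s > 0"
  shows "PiM I (\<lambda>_. density lborel (normal_density 0 s)) = density (PiM I (\<lambda>_. lborel)) (\<lambda>x. ennreal (\<Prod>i\<in>I. normal_density 0 s (x i)))"
  using assms product_sigma_finite_normal[of "\<lambda>_. s" "\<lambda>_. 0"]
  by (subst PiM_density) (auto simp: product_sigma_finite_lborel prod_ennreal)

text \<open>The density of i.i.d. centred normal variables depends on the norm alone, which the
  isometry keeps, and Lebesgue measure is invariant by
  \<open>nn_integral_lin_lborel\<close>.\<close>

lemma distr_lin_normal:
  fixes I :: "'i set"
  assumes fin: "finite I" and s: "s > 0"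
    and orth: "\<And>k l. k \<in> I \<Longrightarrow> l \<in> I \<Longrightarrow> (\<Sum>i\<in>I. A i k * A i l) = (if k = l then 1 else 0)"
    and orth': "\<And>i j. i \<in> I \<Longrightarrow> j \<in> I \<Longrightarrow> (\<Sum>k\<in>I. A i k * A j k) = (if i = j then 1 else 0)"
  defines "Z \<equiv> PiM I (\<lambda>_. density lborel (normal_density 0 s))"
  shows "lin I A \<in> measurable Z Z" and "distr Z Z (lin I A) = Z"
proof -
  let ?L = "PiM I (\<lambda>_. lborel :: real measure)"
  let ?p = "\<lambda>x. ennreal (\<Prod>i\<in>I. normal_density 0 s (x i))"
  have ZL: "sets Z = sets ?L" unfolding Z_def by (intro sets_PiM_cong) auto
  show m: "lin I A \<in> measurable Z Z"
    using measurable_lin by (auto simp: measurable_cong_sets[OF ZL ZL])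
  show "distr Z Z (lin I A) = Z"
  proof (rule measure_eqI)
    fix B assume "B \<in> sets (distr Z Z (lin I A))"
    then have B: "B \<in> sets Z" by simp
    then have [measurable]: "B \<in> sets ?L" using ZL by simp
    have pT: "?p (lin I A x) = ?p x" for x
      unfolding prod_normal_density[OF fin] using lin_norm[OF fin orth, of x] by simp
    have "emeasure (distr Z Z (lin I A)) B = emeasure Z (lin I A -` B \<inter> space Z)"
      using m B by (rule emeasure_distr)
    also have "\<dots> = (\<integral>\<^sup>+x. ?p x * indicator (lin I A -` B \<inter> space Z) x \<partial>?L)"
    proof -
      have "Z = density ?L ?p" unfolding Z_def by (rule PiM_normal_eq_density[OF fin s])
      moreover have "lin I A -` B \<inter> space Z \<in> sets ?L" using measurable_sets[OF m B] ZL by simp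
      moreover have "?p \<in> borel_measurable ?L" by measurable
      ultimately show ?thesis by (simp add: emeasure_density)
    qed
    also have "\<dots> = (\<integral>\<^sup>+x. ?p (lin I A x) * indicator B (lin I A x) \<partial>?L)"
      unfolding pT using sets_eq_imp_space_eq[OF ZL] by (intro nn_integral_cong) (auto simp: indicator_def)
    also have "\<dots> = (\<integral>\<^sup>+x. ?p x * indicator B x \<partial>?L)"
      by (rule nn_integral_lin_lborel[OF fin orth orth', where f="\<lambda>x. ?p x * indicator B x"]) measurable
    also have "\<dots> = emeasure (density ?L ?p) B"
      by (intro emeasure_density[symmetric]) measurable
    also have "\<dots> = emeasure Z B"
      using PiM_normal_eq_density[OF fin s] unfolding Z_def by simp
    finally show "emeasure (distr Z Z (lin I A)) B = emeasure Z B" .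
  qed simp
qed

section \<open>Moments and Chebyshev bounds for Gaussian quadratic forms\<close>

lemma has_bochner_integral_normal_moments:
  fixes m s :: real
  assumes s: "s > 0"
  defines "N \<equiv> density lborel (normal_density m s)"
  shows "has_bochner_integral N (\<lambda>x. x - m) 0"
    and "has_bochner_integral N (\<lambda>x. (x - m)^2) (s^2)"
    and "has_bochner_integral N (\<lambda>x. (x - m)^3) 0"
    and "has_bochner_integral N (\<lambda>x. (x - m)^4) (3 * s^4)"
proof -
  have *: "has_bochner_integral N f c" if "has_bochner_integral lborel (\<lambda>x. normal_density m s x * f x) c" "f \<in> borel_measurable borel" for f :: "real \<Rightarrow> real" and c
    using that unfolding N_def by (intro has_bochner_integral_density) auto
  have [measurable]: "(\<lambda>x. (x - m)^k) \<in> borel_measurable borel" for k :: nat by measurable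
  show "has_bochner_integral N (\<lambda>x. x - m) 0"
    using normal_moment_odd[OF s, of m 0] by (intro *) auto
  show "has_bochner_integral N (\<lambda>x. (x - m)^2) (s^2)"
    using normal_moment_even[OF s, of m 1] s by (intro *) (auto simp: fact_numeral)
  show "has_bochner_integral N (\<lambda>x. (x - m)^3) 0"
    using normal_moment_odd[OF s, of m 1] by (intro *) (auto simp: numeral_eq_Suc)
  show "has_bochner_integral N (\<lambda>x. (x - m)^4) (3 * s^4)"
    using normal_moment_even[OF s, of m 2] s by (intro *) (auto simp: fact_numeral field_simps)
qed

text \<open>With \<open>y = x - m\<close> one has \<open>u - r * x = A - r * y\<close>, so the
  centred square is the polynomial \<open>- 2 * A * r * y + r^2 * y^2 - B^2\<close>. Its mean and
  its second moment involve the moments of \<open>y\<close> up to order four.\<close>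

lemma normal_square_moments:
  fixes m s u r :: real
  assumes s: "s > 0"
  defines "N \<equiv> density lborel (normal_density m s)"
    and "A \<equiv> u - r * m" and "B \<equiv> r * s"
  shows "has_bochner_integral N (\<lambda>x. (u - r * x)^2 - (A^2 + B^2)) 0"
    and "has_bochner_integral N (\<lambda>x. ((u - r * x)^2 - (A^2 + B^2))^2) (4 * A^2 * B^2 + 2 * B^4)"
proof -
  interpret prob_space N unfolding N_def using s by (rule prob_space_normal_density)
  note M = has_bochner_integral_normal_moments[OF s, of m, folded N_def]
  have c: "has_bochner_integral N (\<lambda>x. k) k" for k :: real
    by (simp add: has_bochner_integral_iff prob_space)
  have "has_bochner_integral N (\<lambda>x. (-2*A*r) * (x - m) + r^2 * (x - m)^2 + (- (r^2 * s^2))) ((-2*A*r) * 0 + r^2 * s^2 + (- (r^2 * s^2)))"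
    by (intro has_bochner_integral_add has_bochner_integral_mult_right M c)
  then show "has_bochner_integral N (\<lambda>x. (u - r * x)^2 - (A^2 + B^2)) 0"
    by (rule has_bochner_integral_cong[OF refl _ _, THEN iffD1, rotated 2]) (auto simp: A_def B_def power2_eq_square algebra_simps)
  have "has_bochner_integral N (\<lambda>x. (4*A^2*r^2 - 2*r^4 * s^2) * (x - m)^2 + r^4 * (x - m)^4 + (-4*A*r^3) * (x - m)^3 + (4*A*r^3 * s^2) * (x - m) + r^4 * s^4)
     ((4*A^2*r^2 - 2*r^4 * s^2) * s^2 + r^4 * (3 * s^4) + (-4*A*r^3) * 0 + (4*A*r^3 * s^2) * 0 + r^4 * s^4)"
    by (intro has_bochner_integral_add has_bochner_integral_mult_right M c)
  then show "has_bochner_integral N (\<lambda>x. ((u - r * x)^2 - (A^2 + B^2))^2) (4 * A^2 * B^2 + 2 * B^4)"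
    by (rule has_bochner_integral_cong[OF refl _ _, THEN iffD1, rotated 2]) (simp_all add: A_def B_def algebra_simps power2_eq_square power3_eq_cube power4_eq_xxxx)
qed

context product_prob_space begin

lemma has_bochner_integral_PiM_component:
  fixes f :: "'a \<Rightarrow> real"
  assumes I: "finite I" "k \<in> I" and f: "has_bochner_integral (M k) f c"
  shows "has_bochner_integral (PiM I M) (\<lambda>x. f (x k)) c"
proof -
  have d: "distr (PiM I M) (M k) (\<lambda>x. x k) = M k"
    using I by (intro PiM_component) auto
  have [measurable]: "f \<in> borel_measurable (M k)" using f by (auto simp: has_bochner_integral_iff)
  have c: "(\<lambda>x. x k) \<in> measurable (PiM I M) (M k)" using I by measurable
  show ?thesis
    using f integrable_distr_eq[OF c, of f] integral_distr[OF c, of f] unfolding has_bochner_integral_iff d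
    by simp
qed

lemma has_bochner_integral_PiM_component2:
  fixes f g :: "'a \<Rightarrow> real"
  assumes I: "finite I" "k \<in> I" "l \<in> I" "k \<noteq> l" and f: "has_bochner_integral (M k) f c"
    and g: "has_bochner_integral (M l) g d"
  shows "has_bochner_integral (PiM I M) (\<lambda>x. f (x k) * g (x l)) (c * d)"
proof -
  \<comment> \<open>The product formula for integrals wants one factor per coordinate; all
    coordinates except \<open>k\<close> and \<open>l\<close> get the constant 1.\<close>
  let ?h = "\<lambda>i. if i = k then f else if i = l then g else (\<lambda>_. 1)"
  have p: "(\<Prod>i\<in>I. (if i = k then a else if i = l then b else 1)) = a * b" for a b :: real
  proof -
    have "(\<Prod>i\<in>I. (if i = k then a else if i = l then b else 1)) = (\<Prod>i\<in>I. (if i = k then a else 1) * (if i = l then b else 1))"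
      using I by (intro prod.cong) auto
    then show ?thesis using I by (simp add: prod.distrib)
  qed
  have pp: "(\<Prod>i\<in>I. ?h i (x i)) = f (x k) * g (x l)" for x
  proof -
    have "(\<Prod>i\<in>I. ?h i (x i)) = (\<Prod>i\<in>I. (if i = k then f (x k) else if i = l then g (x l) else 1))"
      by (intro prod.cong) auto
    then show ?thesis unfolding p .
  qed
  have int: "integrable (M i) (?h i)" for i
    using f g by (auto simp: has_bochner_integral_iff)
  have "integral\<^sup>L (PiM I M) (\<lambda>x. \<Prod>i\<in>I. ?h i (x i)) = (\<Prod>i\<in>I. integral\<^sup>L (M i) (?h i))"
    using I int by (intro product_integral_prod) auto
  also have "\<dots> = (\<Prod>i\<in>I. (if i = k then c else if i = l then d else 1))"
    using f g by (intro prod.cong) (auto simp: has_bochner_integral_iff M.prob_space)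
  finally have 1: "integral\<^sup>L (PiM I M) (\<lambda>x. f (x k) * g (x l)) = c * d" unfolding p pp .
  have "integrable (PiM I M) (\<lambda>x. \<Prod>i\<in>I. ?h i (x i))"
    using I int by (intro product_integrable_prod) auto
  then show ?thesis using 1 unfolding pp has_bochner_integral_iff by simp
qed

text \<open>The terms are independent and centred: mixed products integrate to zero and the diagonal
  leaves the variances.\<close>

lemma has_bochner_integral_PiM_sum_square:
  fixes f :: "'i \<Rightarrow> 'a \<Rightarrow> real"
  assumes I: "finite I" "S \<subseteq> I"
    and f: "\<And>k. k \<in> S \<Longrightarrow> has_bochner_integral (M k) (f k) 0"
    and f2: "\<And>k. k \<in> S \<Longrightarrow> has_bochner_integral (M k) (\<lambda>x. (f k x)^2) (v k)"
  shows "has_bochner_integral (PiM I M) (\<lambda>x. (\<Sum>k\<in>S. f k (x k))^2) (\<Sum>k\<in>S. v k)"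
proof -
  have fS: "finite S" using I finite_subset by auto
  have "has_bochner_integral (PiM I M) (\<lambda>x. \<Sum>k\<in>S. \<Sum>l\<in>S. f k (x k) * f l (x l)) (\<Sum>k\<in>S. \<Sum>l\<in>S. if k = l then v k else 0)"
  proof (intro has_bochner_integral_sum)
    fix k l assume kl: "k \<in> S" "l \<in> S"
    show "has_bochner_integral (PiM I M) (\<lambda>x. f k (x k) * f l (x l)) (if k = l then v k else 0)"
    proof (cases "k = l")
      case True
      then show ?thesis
        using has_bochner_integral_PiM_component[OF I(1) _ f2[OF kl(1)]] kl I by (auto simp: power2_eq_square)
    next
      case False
      then show ?thesis
        using has_bochner_integral_PiM_component2[OF I(1) _ _ False f[OF kl(1)] f[OF kl(2)]] kl I by auto
    qed
  qed
  then show ?thesis using fS by (simp add: power2_eq_square sum_product)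
qed

end

lemma (in prob_space) Markov_square:
  fixes X :: "'a \<Rightarrow> real"
  assumes X: "X \<in> borel_measurable M" "has_bochner_integral M (\<lambda>x. (X x)^2) v" and t: "t > 0"
  shows "prob {x \<in> space M. \<bar>X x\<bar> \<ge> t} \<le> v / t^2"
proof -
  have "prob {x \<in> space M. \<bar>X x\<bar> \<ge> t} = prob {x \<in> space M. (X x)^2 \<ge> t^2}"
    using t by (intro arg_cong[where f=prob]) (auto simp: abs_le_square_iff[symmetric])
  also have "\<dots> \<le> expectation (\<lambda>x. (X x)^2) / t^2"
    using X t by (intro integral_Markov_inequality_measure[where A="{}"]) (auto simp: has_bochner_integral_iff)
  finally show ?thesis using X by (simp add: has_bochner_integral_iff)
qed

text \<open>Arbitrary means and affine forms are allowed because the bound serves twice: for the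
  test channel, whose means depend on the source vector, and, with zero means, for the source
  itself.\<close>

lemma normal_quadratic_Chebyshev:
  fixes m s u r :: "'i \<Rightarrow> real"
  assumes I: "finite I" "S \<subseteq> I" and s: "\<And>i. 0 < s i" and t: "t > 0"
  defines "N \<equiv> PiM I (\<lambda>i. density lborel (normal_density (m i) (s i)))"
    and "A \<equiv> \<lambda>k. u k - r k * m k" and "B \<equiv> \<lambda>k. r k * s k"
  shows "measure N {x \<in> space N. \<bar>(\<Sum>k\<in>S. (u k - r k * x k)^2) - (\<Sum>k\<in>S. (A k)^2 + (B k)^2)\<bar> \<ge> t}
    \<le> (\<Sum>k\<in>S. 4 * (A k)^2 * (B k)^2 + 2 * (B k)^4) / t^2"
proof -
  interpret product_prob_space "\<lambda>i. density lborel (normal_density (m i) (s i))"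
    using s by (rule product_prob_space_normal)
  interpret N: prob_space N unfolding N_def using s by (intro prob_space_PiM prob_space_normal_density)
  let ?X = "\<lambda>x. \<Sum>k\<in>S. ((u k - r k * x k)^2 - ((A k)^2 + (B k)^2))"
  have "has_bochner_integral N (\<lambda>x. (?X x)^2) (\<Sum>k\<in>S. 4 * (A k)^2 * (B k)^2 + 2 * (B k)^4)"
    unfolding N_def A_def B_def using I
    by (intro has_bochner_integral_PiM_sum_square normal_square_moments s) auto
  moreover have "?X \<in> borel_measurable N"
    unfolding N_def using I by (intro borel_measurable_sum) (auto intro!: measurable_compose[OF measurable_component_singleton])
  ultimately have "N.prob {x \<in> space N. \<bar>?X x\<bar> \<ge> t} \<le> (\<Sum>k\<in>S. 4 * (A k)^2 * (B k)^2 + 2 * (B k)^4) / t^2"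
    by (intro N.Markov_square t)
  then show ?thesis by (simp add: sum_subtractf)
qed

section \<open>Diagonalization of the source\<close>

text \<open>A left inverse of a square matrix is also a right inverse.\<close>

lemma orthonormal_columns_imp_rows:
  fixes A :: "nat \<Rightarrow> nat \<Rightarrow> real"
  assumes orth: "\<And>k l. k < n \<Longrightarrow> l < n \<Longrightarrow> (\<Sum>i<n. A i k * A i l) = (if k = l then 1 else 0)"
    and ij: "i < n" "j < n"
  shows "(\<Sum>k<n. A i k * A j k) = (if i = j then 1 else 0)"
proof -
  define M where "M = mat n n (\<lambda>(i, k). A i k)"
  define N where "N = mat n n (\<lambda>(k, i). A i k)"
  have c: "M \<in> carrier_mat n n" "N \<in> carrier_mat n n" by (auto simp: M_def N_def)
  have "N * M = 1\<^sub>m n"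
    using orth by (intro eq_matI) (auto simp: M_def N_def scalar_prod_def lessThan_atLeast0)
  then have "M * N = 1\<^sub>m n" using mat_mult_left_right_inverse c by blast
  then have "(M * N) $$ (i, j) = 1\<^sub>m n $$ (i, j)" by simp
  then show ?thesis using ij by (auto simp: M_def N_def scalar_prod_def lessThan_atLeast0)
qed

section \<open>Sine vectors and the mode basis\<close>

lemma sum_cos_equidistant:
  assumes "0 < j" "j < 2 * n"
  shows "(\<Sum>i<n. cos (real i * (real j * pi / real n))) = (1 - (-1) ^ j) / 2"
proof -
  define \<phi> where "\<phi> = real j * pi / real n"
  have n: "n > 0" using assms by auto
  \<comment> \<open>Multiplication by \<open>2 * sin (\<phi>/2)\<close> makes the cosine sum
    telescope; the bounds on \<open>j\<close> keep this factor positive.\<close>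
  have tel: "(\<Sum>i<m. 2 * sin (\<phi>/2) * cos (real i * \<phi>)) = sin ((real m - 1/2) * \<phi>) + sin (\<phi>/2)" for m
  proof (induction m)
    case (Suc m)
    have "2 * sin (\<phi>/2) * cos (real m * \<phi>) = sin ((real m + 1/2) * \<phi>) - sin ((real m - 1/2) * \<phi>)"
    proof -
      have "sin (real m * \<phi> + \<phi>/2) - sin (real m * \<phi> - \<phi>/2) = 2 * sin (\<phi>/2) * cos (real m * \<phi>)"
        by (simp add: sin_add sin_diff)
      then show ?thesis by (simp add: algebra_simps)
    qed
    then show ?case using Suc by (simp add: algebra_simps)
  qed simp
  have "\<phi>/2 < pi" "0 < \<phi>/2" using assms n by (auto simp: \<phi>_def field_simps)
  then have s: "sin (\<phi>/2) > 0" by (intro sin_gt_zero)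
  have "(real n - 1/2) * \<phi> = real j * pi - \<phi>/2" using n by (simp add: \<phi>_def field_simps)
  then have "sin ((real n - 1/2) * \<phi>) = - ((-1)^j * sin (\<phi>/2))"
    by (simp add: sin_diff sin_npi cos_npi)
  then have "2 * sin (\<phi>/2) * (\<Sum>i<n. cos (real i * \<phi>)) = sin (\<phi>/2) * (1 - (-1)^j)"
    using tel[of n] unfolding sum_distrib_left[symmetric] by (simp add: left_diff_distrib right_diff_distrib mult.commute)
  then have "sin (\<phi>/2) * (2 * (\<Sum>i<n. cos (real i * \<phi>))) = sin (\<phi>/2) * (1 - (-1)^j)"
    by (simp only: mult.assoc mult.left_commute)
  then have "2 * (\<Sum>i<n. cos (real i * \<phi>)) = 1 - (-1)^j"
    using s by (simp only: mult_left_cancel)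
  then show ?thesis unfolding \<phi>_def[symmetric] by simp
qed

text \<open>Given \<open>U\<^sub>n\<close>, the vector \<open>(U\<^sub>1,\<dots>,U\<^sub>n\<^sub>-\<^sub>1)\<close> has the tridiagonal Toeplitz precision matrix with
  symbol \<open>g\<close>, which the discrete sine transform diagonalizes. Mode \<open>0\<close> below is the direction of
  \<open>U\<^sub>n\<close> (variance \<open>\<sigma>\<^sup>2\<close> times the square of \<open>last_scale\<close>, growing like \<open>a\<^sup>2\<^sup>n\<close>); mode \<open>k\<close> with \<open>1 \<le> k < n\<close>
  is the \<open>k\<close>-th sine vector, of variance \<open>\<sigma>\<^sup>2 / g(k\<pi>/n)\<close>.\<close>

definition sine_mode :: "nat \<Rightarrow> nat \<Rightarrow> nat \<Rightarrow> real" where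
  "sine_mode n k i = sqrt (2 / real n) * sin (real i * (real k * pi / real n))"

lemma sine_mode_0 [simp]: "sine_mode n k 0 = 0" by (simp add: sine_mode_def)

lemma sine_mode_n [simp]: "n > 0 \<Longrightarrow> sine_mode n k n = 0"
  by (simp add: sine_mode_def mult.commute sin_npi)

text \<open>Product-to-sum: since \<open>k - l\<close> and \<open>k + l\<close> have the same
  parity, their cosine sums agree and cancel, except for \<open>k = l\<close>, where the first sum
  is \<open>n\<close> and the second vanishes.\<close>

lemma sum_sin_sin:
  assumes "k \<in> {1..<n}" "l \<in> {1..<n}" "l \<le> k"
  shows "(\<Sum>i<n. sin (real i * (real k * pi / real n)) * sin (real i * (real l * pi / real n)))
    = (if k = l then real n / 2 else 0)"
proof -
  let ?x = "\<lambda>j i. real i * (real j * pi / real n)"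
  have "(\<Sum>i<n. sin (?x k i) * sin (?x l i)) = (\<Sum>i<n. (cos (?x (k - l) i) - cos (?x (k + l) i)) / 2)"
  proof (rule sum.cong[OF refl])
    fix i
    have "?x k i - ?x l i = ?x (k - l) i" "?x k i + ?x l i = ?x (k + l) i"
      using assms by (auto simp: algebra_simps add_divide_distrib diff_divide_distrib of_nat_diff)
    then show "sin (?x k i) * sin (?x l i) = (cos (?x (k - l) i) - cos (?x (k + l) i)) / 2"
      by (metis sin_times_sin)
  qed
  also have "\<dots> = ((\<Sum>i<n. cos (?x (k - l) i)) - (\<Sum>i<n. cos (?x (k + l) i))) / 2"
    by (simp add: sum_subtractf sum_divide_distrib diff_divide_distrib)
  also have "(\<Sum>i<n. cos (?x (k + l) i)) = (1 - (-1) ^ (k + l)) / 2"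
    using assms by (intro sum_cos_equidistant) auto
  also have "(\<Sum>i<n. cos (?x (k - l) i)) = (if k = l then real n else (1 - (-1) ^ (k - l)) / 2)"
    using assms sum_cos_equidistant[of "k - l" n] by auto
  also have "(-1) ^ (k + l) = ((-1) ^ (k - l) :: real)"
    using assms by (simp add: power_add minus_one_power_iff)
  finally show ?thesis by auto
qed

lemma sine_mode_orthonormal:
  assumes "k \<in> {1..<n}" "l \<in> {1..<n}"
  shows "(\<Sum>i<n. sine_mode n k i * sine_mode n l i) = (if k = l then 1 else 0)"
proof -
  have n: "n > 0" using assms by auto
  let ?s = "\<lambda>k i. sin (real i * (real k * pi / real n))"
  have "(\<Sum>i<n. sine_mode n k i * sine_mode n l i) = (2 / real n) * (\<Sum>i<n. ?s k i * ?s l i)"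
    unfolding sum_distrib_left
  proof (rule sum.cong[OF refl])
    fix i
    have "sine_mode n k i * sine_mode n l i = (sqrt (2 / real n) * sqrt (2 / real n)) * (?s k i * ?s l i)"
      unfolding sine_mode_def by (simp only: mult_ac)
    then show "sine_mode n k i * sine_mode n l i = (2 / real n) * (?s k i * ?s l i)" by simp
  qed
  also have "(\<Sum>i<n. ?s k i * ?s l i) = (if k = l then real n / 2 else 0)"
    using sum_sin_sin[OF assms] sum_sin_sin[OF assms(2,1)] by (cases "l \<le> k") (auto simp: mult.commute)
  finally show ?thesis using n by auto
qed

lemma sum_shift_zero_ends:
  fixes f :: "nat \<Rightarrow> real"
  assumes "f 0 = 0" "f n = 0"
  shows "(\<Sum>i<n. f (Suc i)) = (\<Sum>i<n. f i)"
  using sum.lessThan_Suc_shift[of f n] assms by simp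

lemma sine_mode_orthonormal_Suc:
  assumes "k \<in> {1..<n}" "l \<in> {1..<n}"
  shows "(\<Sum>i<n. sine_mode n k (Suc i) * sine_mode n l (Suc i)) = (if k = l then 1 else 0)"
  using sine_mode_orthonormal[OF assms] sum_shift_zero_ends[of "\<lambda>i. sine_mode n k i * sine_mode n l i" n] assms by auto

text \<open>This is the eigenvector equation of the tridiagonal matrix with ones beside the
  diagonal; its eigenvalue is the source of the cosine in \<open>gfun\<close>.\<close>

lemma sine_mode_three_term: "sine_mode n l i + sine_mode n l (Suc (Suc i)) = 2 * cos (real l * pi / real n) * sine_mode n l (Suc i)"
proof -
  let ?p = "real l * pi / real n"
  have "sin (real i * ?p) + sin (real (Suc (Suc i)) * ?p) = 2 * cos ?p * sin (real (Suc i) * ?p)"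
  proof -
    have "real i * ?p = real (Suc i) * ?p - ?p" "real (Suc (Suc i)) * ?p = real (Suc i) * ?p + ?p"
      by (simp_all add: algebra_simps add_divide_distrib)
    then show ?thesis by (simp only: sin_add sin_diff) simp
  qed
  then have "sqrt (2 / real n) * (sin (real i * ?p) + sin (real (Suc (Suc i)) * ?p))
    = sqrt (2 / real n) * (2 * cos ?p * sin (real (Suc i) * ?p))" by (rule arg_cong)
  then show ?thesis unfolding sine_mode_def by (simp only: distrib_left mult.left_commute)
qed

definition gfun_grid :: "real \<Rightarrow> nat \<Rightarrow> nat \<Rightarrow> real" where
  "gfun_grid a n k = gfun a (real k * pi / real n)"

lemma gfun_ge: "(a - 1)^2 \<le> gfun a w" if "a > 1"
proof -
  have "2 * a * cos w \<le> 2 * a * 1" using that by (intro mult_left_mono) auto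
  then show ?thesis unfolding gfun_def by (simp add: power2_eq_square algebra_simps)
qed

lemma gfun_le: "gfun a w \<le> (a + 1)^2" if "a > 1"
proof -
  have "2 * a * (-1) \<le> 2 * a * cos w" using that by (intro mult_left_mono) auto
  then show ?thesis unfolding gfun_def by (simp add: power2_eq_square algebra_simps)
qed

lemma gfun_pos: "0 < gfun a w" if "a > 1"
  using gfun_ge[OF that, of w] that by (meson less_le_trans zero_less_power diff_gt_0_iff_gt)

lemma gfun_grid_pos: "a > 1 \<Longrightarrow> 0 < gfun_grid a n k" by (simp add: gfun_grid_def gfun_pos)

text \<open>The sequence \<open>sine_mode n k (Suc i) - a * sine_mode n k i\<close> is the noise
  that drives the recursion along the k-th sine vector. On expanding the product, the squares
  contribute \<open>1 + a^2\<close> and the cross terms, by \<open>sine_mode_three_term\<close>, the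
  remaining \<open>- 2 * a * cos\<close>.\<close>

lemma sum_sine_mode_difference:
  assumes "k \<in> {1..<n}" "l \<in> {1..<n}"
  shows "(\<Sum>i<n. (sine_mode n k (Suc i) - a * sine_mode n k i) * (sine_mode n l (Suc i) - a * sine_mode n l i)) = (if k = l then gfun_grid a n k else 0)"
proof -
  have n: "n > 0" using assms by auto
  let ?c = "cos (real l * pi / real n)"
  have "(\<Sum>i<n. sine_mode n k i * sine_mode n l (Suc i)) = (\<Sum>i<n. sine_mode n k (Suc i) * sine_mode n l (Suc (Suc i)))"
    using sum_shift_zero_ends[of "\<lambda>i. sine_mode n k i * sine_mode n l (Suc i)" n] n by simp
  then have "(\<Sum>i<n. sine_mode n k (Suc i) * sine_mode n l i) + (\<Sum>i<n. sine_mode n k i * sine_mode n l (Suc i))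
    = (\<Sum>i<n. sine_mode n k (Suc i) * (sine_mode n l i + sine_mode n l (Suc (Suc i))))"
    by (simp only: sum.distrib distrib_left)
  also have "\<dots> = (\<Sum>i<n. 2 * ?c * (sine_mode n k (Suc i) * sine_mode n l (Suc i)))"
    unfolding sine_mode_three_term by (intro sum.cong refl) simp
  also have "\<dots> = 2 * ?c * (if k = l then 1 else 0)"
    unfolding sum_distrib_left[symmetric] sine_mode_orthonormal_Suc[OF assms] ..
  finally have cr: "(\<Sum>i<n. sine_mode n k (Suc i) * sine_mode n l i) + (\<Sum>i<n. sine_mode n k i * sine_mode n l (Suc i)) = 2 * ?c * (if k = l then 1 else 0)" .
  have "(\<Sum>i<n. (sine_mode n k (Suc i) - a * sine_mode n k i) * (sine_mode n l (Suc i) - a * sine_mode n l i))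
    = (\<Sum>i<n. sine_mode n k (Suc i) * sine_mode n l (Suc i)) + a^2 * (\<Sum>i<n. sine_mode n k i * sine_mode n l i)
      - a * ((\<Sum>i<n. sine_mode n k (Suc i) * sine_mode n l i) + (\<Sum>i<n. sine_mode n k i * sine_mode n l (Suc i)))"
    by (simp add: sum_distrib_left sum.distrib sum_subtractf algebra_simps power2_eq_square)
  then show ?thesis
    unfolding cr sine_mode_orthonormal[OF assms] sine_mode_orthonormal_Suc[OF assms]
    by (auto simp: gfun_grid_def gfun_def)
qed

definition last_scale :: "real \<Rightarrow> nat \<Rightarrow> real" where
  "last_scale a n = sqrt ((a^(2*n) - 1) / (a^2 - 1))"

lemma last_scale_sq:
  assumes "a > 1" shows "last_scale a n ^ 2 = (a^(2*n) - 1) / (a^2 - 1)"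
  using assms one_le_power[of a "2*n"] one_less_power[of a 2] by (simp add: last_scale_def)

lemma last_scale_ge_1:
  assumes "a > 1" "n > 0" shows "1 \<le> last_scale a n"
proof -
  have "a^2 \<le> a^(2*n)" using assms by (intro power_increasing) auto
  moreover have "a^2 > 1" using assms by (intro one_less_power) auto
  ultimately show ?thesis by (simp add: last_scale_def)
qed

text \<open>The columns live in the space of the noise. Column 0 is the normalized coefficient
  vector of the last sample as a linear form in the noise. Column \<open>k\<close> is the normalized
  noise whose path is a multiple of the k-th sine vector; this path returns to zero at the last
  sample.\<close>

definition mode_basis :: "real \<Rightarrow> nat \<Rightarrow> nat \<Rightarrow> nat \<Rightarrow> real" where
  "mode_basis a n i k = (if k = 0 then a^(n - 1 - i) / last_scale a n
    else (sine_mode n k (Suc i) - a * sine_mode n k i) / sqrt (gfun_grid a n k))"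

lemma mode_basis_orthonormal:
  assumes a: "a > 1" and kl: "k < n" "l < n"
  shows "(\<Sum>i<n. mode_basis a n i k * mode_basis a n i l) = (if k = l then 1 else 0)"
proof -
  have n: "n > 0" using kl by auto
  have s: "last_scale a n > 0" using last_scale_ge_1[OF a n] by simp
  have 00: "(\<Sum>i<n. mode_basis a n i 0 * mode_basis a n i 0) = 1"
  proof -
    have "(\<Sum>i<n. a^(n - 1 - i) * a^(n - 1 - i)) = (\<Sum>i<n. a^(n - Suc i) * a^(n - Suc i))" by simp
    also have "\<dots> = (\<Sum>i<n. a^i * a^i)" by (rule sum.nat_diff_reindex)
    also have "\<dots> = (\<Sum>i<n. (a^2)^i)" by (metis power2_eq_square power_mult_distrib)
    also have "\<dots> = ((a^2)^n - 1) / (a^2 - 1)" using one_less_power[OF a, of 2] by (intro geometric_sum) auto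
    finally have e: "(\<Sum>i<n. a^(n - 1 - i) * a^(n - 1 - i)) = last_scale a n ^ 2"
      using last_scale_sq[OF a, of n] by (simp add: power_mult)
    have "(\<Sum>i<n. mode_basis a n i 0 * mode_basis a n i 0) = (\<Sum>i<n. a^(n - 1 - i) * a^(n - 1 - i)) / last_scale a n ^ 2"
      by (simp add: mode_basis_def sum_divide_distrib power2_eq_square)
    then show ?thesis unfolding e using s by simp
  qed
  have 0: "(\<Sum>i<n. mode_basis a n i 0 * mode_basis a n i k) = 0" if k: "k \<in> {1..<n}" for k
  proof -
    \<comment> \<open>Up to normalization, the inner product with column 0 evaluates the last sample
      of the path driven by column \<open>k\<close>. The partial sums telescope to the current value
      of that path times a power of \<open>a\<close>, and the path ends at
      \<open>sine_mode n k n = 0\<close>.\<close>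
    have "(\<Sum>i<m. a^(n - 1 - i) * (sine_mode n k (Suc i) - a * sine_mode n k i)) = a^(n - m) * sine_mode n k m" if "m \<le> n" for m
      using that
    proof (induction m)
      case (Suc m)
      define j where "j = n - 1 - m"
      have j: "n - m = Suc j" "n - Suc m = j" using Suc by (auto simp: j_def)
      have "(\<Sum>i<m. a^(n - 1 - i) * (sine_mode n k (Suc i) - a * sine_mode n k i)) = a * a^j * sine_mode n k m"
        using Suc by (simp add: j)
      then show ?case unfolding j sum.lessThan_Suc j_def[symmetric] by (simp add: right_diff_distrib)
    qed simp
    from this[of n] have "(\<Sum>i<n. a^(n - 1 - i) * (sine_mode n k (Suc i) - a * sine_mode n k i)) = 0" using n by simp
    moreover have "(\<Sum>i<n. mode_basis a n i 0 * mode_basis a n i k) = (\<Sum>i<n. a^(n - 1 - i) * (sine_mode n k (Suc i) - a * sine_mode n k i)) / (last_scale a n * sqrt (gfun_grid a n k))"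
      using k by (simp add: mode_basis_def sum_divide_distrib)
    ultimately show ?thesis by simp
  qed
  have kk: "(\<Sum>i<n. mode_basis a n i k * mode_basis a n i l) = (if k = l then 1 else 0)" if "k \<in> {1..<n}" "l \<in> {1..<n}" for k l
  proof -
    have "(\<Sum>i<n. mode_basis a n i k * mode_basis a n i l) = (if k = l then gfun_grid a n k else 0) / (sqrt (gfun_grid a n k) * sqrt (gfun_grid a n l))"
      using that unfolding sum_sine_mode_difference[OF that, of a, symmetric] by (simp add: mode_basis_def sum_divide_distrib)
    then show ?thesis using gfun_grid_pos[OF a, of n k] gfun_grid_pos[OF a, of n l] by auto
  qed
  have z0: "(\<Sum>i<n. mode_basis a n i k * mode_basis a n i 0) = 0" if k: "k \<in> {1..<n}" for k
  proof -
    have "(\<Sum>i<n. mode_basis a n i k * mode_basis a n i 0) = (\<Sum>i<n. mode_basis a n i 0 * mode_basis a n i k)"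
      by (intro sum.cong refl mult.commute)
    then show ?thesis using 0[OF k] by simp
  qed
  consider "k = 0" "l = 0" | "k = 0" "l \<in> {1..<n}" | "l = 0" "k \<in> {1..<n}" | "k \<in> {1..<n}" "l \<in> {1..<n}"
    using kl by (cases "k = 0"; cases "l = 0") auto
  then show ?thesis
  proof cases
    case 1 then show ?thesis using 00 by simp
  next
    case 2 then show ?thesis using 0[of l] by simp
  next
    case 3 then show ?thesis using z0[of k] by simp
  next
    case 4 then show ?thesis using kk[of k l] by simp
  qed
qed

text \<open>Regression coefficient of \<open>U\<^sub>i\<close> on \<open>U\<^sub>n\<close> (coordinate \<open>i\<close> stands for \<open>U\<^sub>i\<^sub>+\<^sub>1\<close>).\<close>

definition last_coeff :: "real \<Rightarrow> nat \<Rightarrow> nat \<Rightarrow> real" where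
  "last_coeff a n i = a^(n - 1 - i) * (a^(2 * Suc i) - 1) / (a^(2*n) - 1)"

text \<open>The upper bound ensures that an error in the last sample is not amplified when
  regression carries it to the other coordinates.\<close>

lemma last_coeff_bounds:
  assumes a: "a > 1" and i: "i < n"
  shows "0 \<le> last_coeff a n i" "last_coeff a n i \<le> 1"
proof -
  have p: "a^(2*n) > 1" using a i by (intro one_less_power) auto
  have q: "a^(2 * Suc i) \<ge> 1" using a by (intro one_le_power) auto
  show "0 \<le> last_coeff a n i" unfolding last_coeff_def using a p q by (intro divide_nonneg_pos mult_nonneg_nonneg) auto
  have "a^(n - 1 - i) * a^(2 * Suc i) \<le> a^(2*n)"
    unfolding power_add[symmetric] using a i by (intro power_increasing) auto
  moreover have "1 \<le> a^(n - 1 - i)" using a by (intro one_le_power) auto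
  ultimately have "a^(n - 1 - i) * (a^(2 * Suc i) - 1) \<le> a^(2*n) - 1" by (simp add: algebra_simps)
  then show "last_coeff a n i \<le> 1" unfolding last_coeff_def using p by (simp add: divide_le_eq)
qed

lemma last_coeff_last: "a > 1 \<Longrightarrow> n > 0 \<Longrightarrow> last_coeff a n (n - 1) = 1"
  using one_less_power[of a "2*n"] by (simp add: last_coeff_def del: one_less_power)

lemma Uvec_0: "Uvec a z 0 = z 0" by (simp add: Uvec_def)

lemma Uvec_Suc: "Uvec a z (Suc i) = a * Uvec a z i + z (Suc i)"
proof -
  have "(\<Sum>j\<le>i. a ^ (Suc i - j) * z j) = a * (\<Sum>j\<le>i. a ^ (i - j) * z j)"
    unfolding sum_distrib_left by (intro sum.cong) (auto simp: Suc_diff_le)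
  then show ?thesis by (simp add: Uvec_def)
qed

text \<open>Both sides satisfy the recursion of the source with the same start. For the sine part
  this holds by construction of the noise columns; for the coefficient of \<open>\<zeta> 0\<close>
  it is an identity between geometric sums in closed form.\<close>

lemma Uvec_mode_basis:
  assumes a: "a > 1" and i: "i < n"
    and z: "\<And>i. i < n \<Longrightarrow> z i = (\<Sum>k<n. mode_basis a n i k * \<zeta> k)"
  shows "Uvec a z i = (\<Sum>k=1..<n. sine_mode n k (Suc i) * (\<zeta> k / sqrt (gfun_grid a n k))) + last_coeff a n i * (last_scale a n * \<zeta> 0)"
  using i
proof (induction i)
  have n: "n > 0" using i by auto
  have s: "last_scale a n > 0" using last_scale_ge_1[OF a n] by simp
  have p: "a^(2*n) - 1 = last_scale a n ^ 2 * (a^2 - 1)" using last_scale_sq[OF a, of n] one_less_power[OF a, of 2] by simp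
  have zz: "z i = a^(n - 1 - i) / last_scale a n * \<zeta> 0 + (\<Sum>k=1..<n. (sine_mode n k (Suc i) - a * sine_mode n k i) * (\<zeta> k / sqrt (gfun_grid a n k)))" if "i < n" for i
  proof -
    have "{..<n} = insert 0 {1..<n}" using n by auto
    then have "z i = mode_basis a n i 0 * \<zeta> 0 + (\<Sum>k=1..<n. mode_basis a n i k * \<zeta> k)" using z[OF that] by simp
    then show ?thesis by (simp add: mode_basis_def cong: sum.cong_simp)
  qed
  {
    case 0
    have "last_coeff a n 0 * last_scale a n = a^(n - 1) / last_scale a n"
      using one_less_power[OF a, of 2] s by (simp add: last_coeff_def p power2_eq_square)
    then have "last_coeff a n 0 * (last_scale a n * \<zeta> 0) = a^(n - 1) / last_scale a n * \<zeta> 0" by (simp only: mult.assoc[symmetric])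
    then show ?case using zz[OF 0] unfolding Uvec_0 by simp
  next
    case (Suc i)
    have e: "n - 1 - i = Suc (n - 1 - Suc i)" using Suc by auto
    have "last_coeff a n (Suc i) * last_scale a n = a * (last_coeff a n i * last_scale a n) + a^(n - 1 - Suc i) / last_scale a n"
    proof -
      define b where "b = a^(n - 1 - Suc i)"
      define q where "q = a^(2 * Suc i)"
      define D where "D = a^2 - 1"
      have D: "D > 0" using one_less_power[OF a, of 2] by (simp add: D_def)
      have q': "a^(2 * Suc (Suc i)) = a^2 * q" by (simp add: q_def power2_eq_square)
      have "b * (a^2 * q - 1) = a * (a * b * (q - 1)) + b * D"
        by (simp add: D_def algebra_simps power2_eq_square)
      then have "b * (a^2 * q - 1) / (last_scale a n * D) = (a * (a * b * (q - 1)) + b * D) / (last_scale a n * D)" by simp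
      also have "\<dots> = a * (a * b * (q - 1) / (last_scale a n * D)) + b / last_scale a n"
        using s D by (simp add: add_divide_distrib)
      finally show ?thesis
        using s D unfolding last_coeff_def p e q' b_def[symmetric] q_def[symmetric] D_def[symmetric] power_Suc[of a "n - 1 - Suc i"]
        by (simp add: power2_eq_square)
    qed
    then have "last_coeff a n (Suc i) * last_scale a n * \<zeta> 0 = (a * (last_coeff a n i * last_scale a n) + a^(n - 1 - Suc i) / last_scale a n) * \<zeta> 0" by simp
    then have 1: "last_coeff a n (Suc i) * (last_scale a n * \<zeta> 0) = a * (last_coeff a n i * (last_scale a n * \<zeta> 0)) + a^(n - 1 - Suc i) / last_scale a n * \<zeta> 0"
      by (simp only: distrib_right mult.assoc)
    let ?c = "\<lambda>k. \<zeta> k / sqrt (gfun_grid a n k)"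
    have 2: "(\<Sum>k=1..<n. (sine_mode n k (Suc (Suc i)) - a * sine_mode n k (Suc i)) * ?c k)
      = (\<Sum>k=1..<n. sine_mode n k (Suc (Suc i)) * ?c k) - a * (\<Sum>k=1..<n. sine_mode n k (Suc i) * ?c k)"
      by (simp only: left_diff_distrib sum_subtractf sum_distrib_left mult.assoc)
    have 3: "Uvec a z i = (\<Sum>k=1..<n. sine_mode n k (Suc i) * ?c k) + last_coeff a n i * (last_scale a n * \<zeta> 0)" using Suc by simp
    show ?case unfolding Uvec_Suc zz[OF Suc.prems] 1 2 3 by (simp add: distrib_left)
  }
qed

section \<open>The product of \<open>gfun\<close> over the grid\<close>

lemma prod_roots_of_unity:
  fixes z :: complex
  assumes "n > 0"
  shows "(\<Prod>k<n. z - cis (2 * pi * real k / real n)) = z ^ n - 1"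
proof -
  let ?r = "\<lambda>k. cis (2 * pi * real k / real n)"
  define p where "p = (\<Prod>k<n. [:- ?r k, 1:])"
  define q where "q = (monom 1 n - 1 :: complex poly)"
  have b: "bij_betw ?r {..<n} {z. z ^ n = 1}" using assms by (rule Complex.bij_betw_roots_unity)
  have dp: "degree p = n" unfolding p_def by (subst degree_prod_eq_sum_degree) auto
  have lp: "Polynomial.coeff p n = 1"
    using dp lead_coeff_prod[of "\<lambda>k. [:- ?r k, 1:]" "{..<n}"] by (simp add: p_def)
  \<comment> \<open>Both polynomials are monic of degree \<open>n\<close> and vanish at the
    \<open>n\<close> roots of unity.\<close>
  have "p = q"
  proof (rule poly_eqI_degree_lead_coeff)
    show "Polynomial.coeff p n = Polynomial.coeff q n" using lp assms by (simp add: q_def)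
    show "n \<le> card {z::complex. z ^ n = 1}" using bij_betw_same_card[OF b] by simp
    show "degree p \<le> n" using dp by simp
    show "degree q \<le> n" unfolding q_def by (intro degree_diff_le) (auto simp: degree_monom_le)
    fix w :: complex assume w: "w \<in> {z. z ^ n = 1}"
    then obtain k where k: "k < n" "w = ?r k" using b by (auto simp: bij_betw_def)
    have "poly p w = 0" unfolding p_def poly_prod using k by (intro prod_zero bexI[of _ k]) auto
    moreover have "poly q w = 0" using w by (simp add: q_def poly_monom)
    ultimately show "poly p w = poly q w" by simp
  qed
  then have "poly p z = poly q z" by simp
  then show ?thesis by (simp add: p_def q_def poly_prod poly_monom)
qed

text \<open>On the unit circle \<open>gfun a w\<close> is the squared distance from \<open>a\<close>
  to \<open>cis w\<close>. Among the 2n-th roots of unity, 1 and -1 contribute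
  \<open>a^2 - 1\<close>, and the others come in conjugate pairs, one pair for each
  \<open>k\<close>.\<close>

lemma prod_gfun_grid:
  assumes a: "a > 1" and n: "n > 0"
  shows "(\<Prod>k=1..<n. gfun_grid a n k) = (a^(2*n) - 1) / (a^2 - 1)"
proof -
  let ?f = "\<lambda>k. complex_of_real a - cis (pi * real k / real n)"
  have set: "{..<2*n} = {0} \<union> {1..<n} \<union> {n} \<union> {n+1..<2*n}" using n by auto
  have "(\<Prod>k<2*n. ?f k) = complex_of_real a ^ (2*n) - 1"
    using prod_roots_of_unity[of "2*n" "complex_of_real a"] n by simp
  also have "(\<Prod>k<2*n. ?f k) = ?f 0 * (\<Prod>k=1..<n. ?f k) * ?f n * (\<Prod>k=n+1..<2*n. ?f k)"
    unfolding set using n by (subst prod.union_disjoint; (simp | subst prod.union_disjoint)+)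
  also have "(\<Prod>k=n+1..<2*n. ?f k) = (\<Prod>k=1..<n. cnj (?f k))"
  proof (rule prod.reindex_bij_witness[of _ "\<lambda>k. 2*n - k" "\<lambda>k. 2*n - k"])
    fix k assume k: "k \<in> {n+1..<2*n}"
    have "pi * real (2 * n - k) / real n = 2 * pi - pi * real k / real n"
      using k n by (simp add: of_nat_diff field_simps)
    then show "cnj (?f (2*n - k)) = ?f k"
      by (simp add: complex_eq_iff)
  qed auto
  also have "?f 0 * (\<Prod>k=1..<n. ?f k) * ?f n * (\<Prod>k=1..<n. cnj (?f k))
    = ?f 0 * ?f n * (\<Prod>k=1..<n. ?f k * cnj (?f k))"
    by (simp add: prod.distrib)
  also have "(\<Prod>k=1..<n. ?f k * cnj (?f k)) = (\<Prod>k=1..<n. complex_of_real (gfun_grid a n k))"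
  proof (rule prod.cong[OF refl])
    fix k
    have "(a - cos (pi * real k / real n))^2 + sin (pi * real k / real n) ^2 = gfun_grid a n k"
      by (simp add: gfun_grid_def gfun_def power2_diff algebra_simps)
    then show "?f k * cnj (?f k) = complex_of_real (gfun_grid a n k)"
      unfolding complex_mult_cnj by simp
  qed
  also have "?f 0 * ?f n = complex_of_real (a^2 - 1)"
    using n by (simp add: complex_eq_iff power2_eq_square algebra_simps)
  finally have "complex_of_real ((a^2 - 1) * (\<Prod>k=1..<n. gfun_grid a n k)) = complex_of_real (a^(2*n) - 1)"
    by simp
  then have "(a^2 - 1) * (\<Prod>k=1..<n. gfun_grid a n k) = a^(2*n) - 1" by (simp only: of_real_eq_iff)
  moreover have "a^2 - 1 > 0" using one_less_power[OF a, of 2] by simp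
  ultimately show ?thesis by (simp add: field_simps)
qed

section \<open>Riemann sums and integrals over the spectrum\<close>

lemma mono_Riemann_sum:
  fixes f :: "real \<Rightarrow> real"
  assumes cont: "continuous_on {0..b} f" and mono: "\<And>x y. 0 \<le> x \<Longrightarrow> x \<le> y \<Longrightarrow> y \<le> b \<Longrightarrow> f x \<le> f y"
    and b: "b > 0" and n: "n > 0" and C: "\<bar>f 0\<bar> \<le> C" "\<bar>f b\<bar> \<le> C"
  shows "\<bar>(\<Sum>k=1..<n. f (real k * b / real n)) - real n / b * integral {0..b} f\<bar> \<le> C"
proof -
  define h where "h = b / real n"
  have h: "h > 0" using b n by (simp add: h_def)
  have nh: "real n * h = b" using n by (simp add: h_def)
  have le: "real k * h \<le> b" if "k \<le> n" for k
    using that h nh by (metis mult_right_mono less_imp_le of_nat_le_iff)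
  have int: "f integrable_on {x..y}" if "0 \<le> x" "y \<le> b" for x y
    using that by (intro integrable_continuous_interval continuous_on_subset[OF cont]) auto
  have sum_int: "(\<Sum>k<m. integral {real k * h..real (Suc k) * h} f) = integral {0..real m * h} f" if "m \<le> n" for m
    using that
  proof (induction m)
    case (Suc m)
    have "integral {0..real m * h} f + integral {real m * h..real (Suc m) * h} f = integral {0..real (Suc m) * h} f"
      using h Suc.prems le[of "Suc m"] by (intro Henstock_Kurzweil_Integration.integral_combine int) auto
    then show ?case using Suc by simp
  qed simp
  have bd: "h * f (real k * h) \<le> integral {real k * h..real (Suc k) * h} f \<and>
      integral {real k * h..real (Suc k) * h} f \<le> h * f (real (Suc k) * h)" if k: "k < n" for k
  proof -
    have kl: "real k * h \<le> real (Suc k) * h" "0 \<le> real k * h" using h by auto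
    have i: "f integrable_on {real k * h..real (Suc k) * h}" using kl le[of "Suc k"] k by (intro int) auto
    have "integral {real k * h..real (Suc k) * h} (\<lambda>_. f (real k * h)) \<le> integral {real k * h..real (Suc k) * h} f"
      using i kl le[of "Suc k"] k by (intro integral_le mono) auto
    moreover have "integral {real k * h..real (Suc k) * h} f \<le> integral {real k * h..real (Suc k) * h} (\<lambda>_. f (real (Suc k) * h))"
      using i kl le[of "Suc k"] k by (intro integral_le mono) auto
    moreover have "measure lborel {real k * h..real (Suc k) * h} = h" using kl by (simp add: algebra_simps)
    ultimately show ?thesis by simp
  qed
  have I: "integral {0..b} f = (\<Sum>k<n. integral {real k * h..real (Suc k) * h} f)"
    using sum_int[of n] nh by simp
  have lo: "h * (\<Sum>k<n. f (real k * h)) \<le> integral {0..b} f"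
    unfolding I sum_distrib_left using bd by (intro sum_mono) auto
  have hi: "integral {0..b} f \<le> h * (\<Sum>k<n. f (real (Suc k) * h))"
    unfolding I sum_distrib_left using bd by (intro sum_mono) auto
  \<comment> \<open>The left Riemann sum adds \<open>f 0\<close> to the interior sum
    \<open>S\<close>, the right one adds \<open>f b\<close>. Monotonicity puts the integral between
    them, so after scaling the error is at most one end value, whatever \<open>n\<close> is.\<close>
  define S where "S = (\<Sum>k=1..<n. f (real k * h))"
  have s1: "(\<Sum>k<n. f (real k * h)) = f 0 + S"
  proof -
    have "{..<n} = insert 0 {1..<n}" using n by auto
    then show ?thesis by (simp add: S_def)
  qed
  have s2: "(\<Sum>k<n. f (real (Suc k) * h)) = S + f b"
  proof -
    have "(\<Sum>k<n. f (real (Suc k) * h)) = (\<Sum>k=1..<Suc n. f (real k * h))"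
      using sum.shift_bounds_Suc_ivl[of "\<lambda>k. f (real k * h)" 0 n] by (simp add: lessThan_atLeast0)
    also have "\<dots> = S + f (real n * h)" using n by (simp add: S_def)
    finally show ?thesis unfolding nh .
  qed
  define J where "J = real n / b * integral {0..b} f"
  have J: "integral {0..b} f = h * J" using b n by (simp add: J_def h_def)
  have "f 0 + S \<le> J" "J \<le> S + f b" using lo hi h unfolding s1 s2 J by simp_all
  moreover have "(\<Sum>k=1..<n. f (real k * b / real n)) = S" unfolding S_def h_def by simp
  ultimately show ?thesis using C unfolding J_def[symmetric] by linarith
qed

lemma antimono_Riemann_sum:
  fixes f :: "real \<Rightarrow> real"
  assumes cont: "continuous_on {0..b} f" and mono: "\<And>x y. 0 \<le> x \<Longrightarrow> x \<le> y \<Longrightarrow> y \<le> b \<Longrightarrow> f y \<le> f x"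
    and b: "b > 0" and n: "n > 0" and C: "\<bar>f 0\<bar> \<le> C" "\<bar>f b\<bar> \<le> C"
  shows "\<bar>(\<Sum>k=1..<n. f (real k * b / real n)) - real n / b * integral {0..b} f\<bar> \<le> C"
proof -
  have "\<bar>(\<Sum>k=1..<n. - f (real k * b / real n)) - real n / b * integral {0..b} (\<lambda>x. - f x)\<bar> \<le> C"
    using assms by (intro mono_Riemann_sum continuous_on_minus) auto
  then show ?thesis by (simp add: sum_negf)
qed

lemma integral_even:
  fixes f :: "real \<Rightarrow> real"
  assumes "continuous_on {-b..b} f" "\<And>x. f (- x) = f x" "b \<ge> 0"
  shows "integral {-b..b} f = 2 * integral {0..b} f"
proof -
  have "integral {-b..0} f + integral {0..b} f = integral {-b..b} f"
    using assms by (intro Henstock_Kurzweil_Integration.integral_combine integrable_continuous_interval) auto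
  moreover have "integral {-b..-0} (\<lambda>x. f (- x)) = integral {0..b} f"
    by (rule Henstock_Kurzweil_Integration.integral_reflect_real)
  ultimately show ?thesis using assms(2) by simp
qed

lemma gfun_even: "gfun a (- w) = gfun a w"
  by (simp add: gfun_def)

lemma continuous_on_gfun: "continuous_on S (gfun a)"
  unfolding gfun_def by (intro continuous_intros)

lemma gfun_mono:
  assumes "a > 1" "0 \<le> x" "x \<le> y" "y \<le> pi"
  shows "gfun a x \<le> gfun a y"
proof -
  have "cos y \<le> cos x" using assms by (intro cos_monotone_0_pi_le) auto
  then have "2 * a * cos y \<le> 2 * a * cos x" using assms by (intro mult_left_mono) auto
  then show ?thesis by (simp add: gfun_def)
qed

text \<open>Up to the factor \<open>a^2 - 1\<close>, the integrand is a Poisson kernel. The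
  arctangent in the antiderivative is minus the argument of \<open>a - cis w\<close>; as this number
  has positive real part, there is no jump on the whole period.\<close>

lemma integral_inverse_gfun:
  assumes a: "a > 1"
  shows "integral {-pi..pi} (\<lambda>w. 1 / gfun a w) = 2 * pi / (a^2 - 1)"
proof -
  let ?F = "\<lambda>w. (w + 2 * arctan (sin w / (a - cos w))) / (a^2 - 1)"
  have a2: "a^2 - 1 > 0" using one_less_power[OF a, of 2] by simp
  have "((\<lambda>w. 1 / gfun a w) has_integral (?F pi - ?F (-pi))) {-pi..pi}"
  proof (rule fundamental_theorem_of_calculus)
    fix w :: real
    have d: "a - cos w > 0" using a cos_le_one[of w] by linarith
    have g: "gfun a w = (a - cos w)^2 + (sin w)^2" by (simp add: gfun_def power2_diff algebra_simps)
    have D: "((\<lambda>w. sin w / (a - cos w)) has_real_derivative (cos w * (a - cos w) - sin w * sin w) / (a - cos w)^2) (at w)"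
      using d by (auto intro!: derivative_eq_intros simp: power2_eq_square)
    have e1: "inverse (1 + (sin w / (a - cos w))^2) * ((cos w * (a - cos w) - sin w * sin w) / (a - cos w)^2)
      = (cos w * (a - cos w) - sin w * sin w) / gfun a w"
    proof -
      have "1 + (sin w / (a - cos w))^2 = gfun a w / (a - cos w)^2"
        using d unfolding g by (simp add: field_simps power_divide)
      then show ?thesis using d by simp
    qed
    have e2: "cos w * (a - cos w) - sin w * sin w = a * cos w - 1"
      using sin_cos_squared_add[of w] by (simp add: algebra_simps power2_eq_square)
    have "(?F has_real_derivative (1 + 2 * (inverse (1 + (sin w / (a - cos w))^2) * ((cos w * (a - cos w) - sin w * sin w) / (a - cos w)^2))) / (a^2 - 1)) (at w)"
      by (rule DERIV_cdivide[OF DERIV_add[OF DERIV_ident DERIV_cmult[OF DERIV_chain2[OF DERIV_arctan D]]]])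
    also have "(1 + 2 * (inverse (1 + (sin w / (a - cos w))^2) * ((cos w * (a - cos w) - sin w * sin w) / (a - cos w)^2))) / (a^2 - 1) = 1 / gfun a w"
    proof -
      have "1 + 2 * ((a * cos w - 1) / gfun a w) = (a^2 - 1) / gfun a w"
        using gfun_pos[OF a, of w] by (simp add: field_simps) (simp add: gfun_def)
      then show ?thesis unfolding e1 unfolding e2 using a2 by simp
    qed
    finally show "(?F has_vector_derivative 1 / gfun a w) (at w within {-pi..pi})"
      by (simp add: has_real_derivative_iff_has_vector_derivative[symmetric] has_field_derivative_at_within)
  qed simp
  then have "integral {-pi..pi} (\<lambda>w. 1 / gfun a w) = ?F pi - ?F (-pi)" by (rule integral_unique)
  also have "\<dots> = 2 * pi / (a^2 - 1)" by (simp add: add_divide_distrib[symmetric] diff_divide_distrib[symmetric])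
  finally show ?thesis .
qed

text \<open>If \<theta> reached the maximum \<open>\<sigma>^2 / (a - 1)^2\<close> of the spectrum,
  the minimum would be the spectrum itself, and its mean is
  \<open>\<sigma>^2 / (a^2 - 1)\<close>.\<close>

lemma water_level_less:
  assumes a: "a > 1" and s: "\<sigma> > 0" and d: "d < \<sigma>^2 / (a^2 - 1)"
    and D: "d = (1 / (2 * pi)) * integral {-pi..pi} (\<lambda>w. min \<theta> (\<sigma>^2 / gfun a w))"
  shows "\<theta> < \<sigma>^2 / (a - 1)^2"
proof (rule ccontr)
  assume c: "\<not> \<theta> < \<sigma>^2 / (a - 1)^2"
  have "min \<theta> (\<sigma>^2 / gfun a w) = \<sigma>^2 * (1 / gfun a w)" for w
  proof -
    have "\<sigma>^2 / gfun a w \<le> \<sigma>^2 / (a - 1)^2"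
      using gfun_ge[OF a, of w] gfun_pos[OF a, of w] a by (intro divide_left_mono) auto
    then show ?thesis using c by simp
  qed
  then have "d = (1 / (2 * pi)) * (\<sigma>^2 * (2 * pi / (a^2 - 1)))"
    using D integral_inverse_gfun[OF a] by (simp only: integral_mult_right)
  then show False using d by simp
qed

lemma Riemann_RU:
  assumes a: "a > 1" and s: "\<sigma> > 0" and t: "\<theta> > 0"
  shows "\<exists>C. \<forall>n>0. \<bar>(\<Sum>k=1..<n. (1/2) * ln (max (gfun_grid a n k) (\<sigma>^2 / \<theta>))) - real n * RU a \<sigma> \<theta>\<bar> \<le> C"
proof -
  let ?f = "\<lambda>w. (1/2) * ln (max (gfun a w) (\<sigma>^2 / \<theta>))"
  have p: "max (gfun a w) (\<sigma>^2 / \<theta>) > 0" for w using gfun_pos[OF a, of w] by simp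
  have c: "continuous_on S ?f" for S
    using p by (intro continuous_intros continuous_on_gfun) (simp add: less_imp_neq[THEN not_sym])
  have I: "integral {-pi..pi} ?f = 2 * integral {0..pi} ?f"
    by (intro integral_even c) (auto simp: gfun_even)
  have R: "\<bar>(\<Sum>k=1..<n. ?f (real k * pi / real n)) - real n / pi * integral {0..pi} ?f\<bar> \<le> max \<bar>?f 0\<bar> \<bar>?f pi\<bar>" if "n > 0" for n
  proof (rule mono_Riemann_sum[OF c _ _ that])
    fix x y :: real assume xy: "0 \<le> x" "x \<le> y" "y \<le> pi"
    show "?f x \<le> ?f y" using gfun_mono[OF a xy] p[of x] p[of y] by (simp add: ln_le_cancel_iff del: max_less_iff_conj less_max_iff_disj) 
  qed auto
  have "real n * RU a \<sigma> \<theta> = real n / pi * integral {0..pi} ?f" for n :: nat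
    unfolding RU_def I by simp
  then show ?thesis using R unfolding gfun_grid_def by (intro exI[of _ "max \<bar>?f 0\<bar> \<bar>?f pi\<bar>"]) simp
qed

lemma Riemann_distortion:
  assumes a: "a > 1" and s: "\<sigma> > 0" and t: "\<theta> > 0"
    and D: "d = (1 / (2 * pi)) * integral {-pi..pi} (\<lambda>w. min \<theta> (\<sigma>^2 / gfun a w))"
  shows "\<exists>C. \<forall>n>0. \<bar>(\<Sum>k=1..<n. min \<theta> (\<sigma>^2 / gfun_grid a n k)) - real n * d\<bar> \<le> C"
proof -
  let ?f = "\<lambda>w. min \<theta> (\<sigma>^2 / gfun a w)"
  have c: "continuous_on S ?f" for S
    using gfun_pos[OF a] by (intro continuous_intros continuous_on_gfun) (simp add: less_imp_neq[THEN not_sym])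
  have I: "integral {-pi..pi} ?f = 2 * integral {0..pi} ?f"
    by (intro integral_even c) (auto simp: gfun_even)
  have R: "\<bar>(\<Sum>k=1..<n. ?f (real k * pi / real n)) - real n / pi * integral {0..pi} ?f\<bar> \<le> max \<bar>?f 0\<bar> \<bar>?f pi\<bar>" if "n > 0" for n
  proof (rule antimono_Riemann_sum[OF c _ _ that])
    fix x y :: real assume xy: "0 \<le> x" "x \<le> y" "y \<le> pi"
    have "\<sigma>^2 / gfun a y \<le> \<sigma>^2 / gfun a x"
      using gfun_mono[OF a xy] gfun_pos[OF a] by (intro divide_left_mono) auto
    then show "?f y \<le> ?f x" by (auto simp: min_def)
  qed auto
  have "real n * d = real n / pi * integral {0..pi} ?f" for n :: nat
    unfolding D I by simp
  then show ?thesis using R unfolding gfun_grid_def by (intro exI[of _ "max \<bar>?f 0\<bar> \<bar>?f pi\<bar>"]) simp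
qed

text \<open>The sum is the variance of the weighted chi-square sum in the tilted information; the
  factor 1/2 is the variance of \<open>((\<zeta> k)^2 / \<sigma>^2 - 1) / 2\<close>.\<close>

lemma Riemann_VU:
  assumes a: "a > 1" and s: "\<sigma> > 0" and t: "\<theta> > 0"
  shows "(\<lambda>n. (\<Sum>k=1..<n. (min 1 (\<sigma>^2 / (\<theta> * gfun_grid a n k)))^2 / 2) / real n) \<longlonglongrightarrow> VU a \<sigma> \<theta>"
proof -
  let ?f = "\<lambda>w. min 1 ((\<sigma>^2 / (\<theta> * gfun a w))^2)"
  have c: "continuous_on S ?f" for S
    using gfun_pos[OF a] t by (intro continuous_intros continuous_on_gfun) (simp add: less_imp_neq[THEN not_sym])
  have I: "integral {-pi..pi} ?f = 2 * integral {0..pi} ?f"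
    by (intro integral_even c) (auto simp: gfun_even)
  have R: "\<bar>(\<Sum>k=1..<n. ?f (real k * pi / real n)) - real n / pi * integral {0..pi} ?f\<bar> \<le> 1" if "n > 0" for n
  proof (rule antimono_Riemann_sum[OF c _ _ that])
    fix x y :: real assume xy: "0 \<le> x" "x \<le> y" "y \<le> pi"
    have "\<sigma>^2 / (\<theta> * gfun a y) \<le> \<sigma>^2 / (\<theta> * gfun a x)"
      using gfun_mono[OF a xy] gfun_pos[OF a] t by (intro divide_left_mono mult_left_mono) auto
    then have "(\<sigma>^2 / (\<theta> * gfun a y))^2 \<le> (\<sigma>^2 / (\<theta> * gfun a x))^2"
      using gfun_pos[OF a, of y] t by (intro power_mono) auto
    then show "?f y \<le> ?f x" by (auto simp: min_def)
  qed (auto simp: min_def)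
  have m: "(min 1 x)^2 = min 1 (x^2)" if "x \<ge> 0" for x :: real
  proof (cases "x \<le> 1")
    case True
    then have "x^2 \<le> 1" using that by (simp add: power_le_one)
    then show ?thesis using True by (simp add: min_absorb2)
  next
    case False
    then have "1 \<le> x^2" by (intro one_le_power) auto
    then show ?thesis using False by (simp add: min_absorb1)
  qed
  have e: "(min 1 (\<sigma>^2 / (\<theta> * gfun_grid a n k)))^2 = ?f (real k * pi / real n)" for n k
    unfolding gfun_grid_def using gfun_pos[OF a] t by (intro m) (simp add: less_imp_le)
  define S where "S n = (\<Sum>k=1..<n. ?f (real k * pi / real n))" for n
  have V: "VU a \<sigma> \<theta> = 1 / (2 * pi) * integral {0..pi} ?f" unfolding VU_def I by simp
  have "\<bar>S n / 2 / real n - VU a \<sigma> \<theta>\<bar> \<le> 1 / real n" if "n > 0" for n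
  proof -
    have "S n / 2 / real n - VU a \<sigma> \<theta> = (S n - real n / pi * integral {0..pi} ?f) / (2 * real n)"
      using that unfolding V by (simp add: field_simps)
    then have "\<bar>S n / 2 / real n - VU a \<sigma> \<theta>\<bar> = \<bar>S n - real n / pi * integral {0..pi} ?f\<bar> / (2 * real n)" by simp
    also have "\<dots> \<le> 1 / (2 * real n)" using R[OF that] that unfolding S_def by (intro divide_right_mono) auto
    also have "\<dots> \<le> 1 / real n" using that by (simp add: field_simps)
    finally show ?thesis .
  qed
  then have "eventually (\<lambda>n. norm (S n / 2 / real n - VU a \<sigma> \<theta>) \<le> 1 / real n) sequentially"
    by (intro eventually_sequentiallyI[of 1]) (metis One_nat_def Suc_le_lessD real_norm_def)
  then have "(\<lambda>n. S n / 2 / real n - VU a \<sigma> \<theta>) \<longlonglongrightarrow> 0"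
    by (rule Lim_null_comparison) (rule lim_1_over_n)
  then have "(\<lambda>n. S n / 2 / real n) \<longlonglongrightarrow> VU a \<sigma> \<theta>" by (rule LIM_zero_cancel)
  moreover have "(\<Sum>k=1..<n. (min 1 (\<sigma>^2 / (\<theta> * gfun_grid a n k)))^2 / 2) / real n = S n / 2 / real n" for n
    unfolding e S_def sum_divide_distrib ..
  ultimately show ?thesis by simp
qed

lemma VU_pos:
  assumes a: "a > 1" and s: "\<sigma> > 0" and t: "\<theta> > 0"
  shows "VU a \<sigma> \<theta> > 0"
proof -
  let ?f = "\<lambda>w. min 1 ((\<sigma>^2 / (\<theta> * gfun a w))^2)"
  define c where "c = min 1 ((\<sigma>^2 / (\<theta> * (a + 1)^2))^2)"
  have c: "c > 0" using a s t by (simp add: c_def)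
  have cf: "continuous_on S ?f" for S
    using gfun_pos[OF a] t by (intro continuous_intros continuous_on_gfun) (simp add: less_imp_neq[THEN not_sym])
  have "integral {-pi..pi} (\<lambda>_. c) \<le> integral {-pi..pi} ?f"
  proof (intro integral_le integrable_continuous_interval cf)
    fix w
    have "\<sigma>^2 / (\<theta> * (a + 1)^2) \<le> \<sigma>^2 / (\<theta> * gfun a w)"
      using gfun_le[OF a, of w] gfun_pos[OF a, of w] t a by (intro divide_left_mono mult_left_mono mult_pos_pos) auto
    then have "(\<sigma>^2 / (\<theta> * (a + 1)^2))^2 \<le> (\<sigma>^2 / (\<theta> * gfun a w))^2"
      using t a by (intro power_mono) auto
    then show "c \<le> ?f w" unfolding c_def by (auto simp: min_def)
  qed auto
  moreover have "0 < integral {-pi..pi} (\<lambda>_. c)" using c by simp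
  ultimately show ?thesis unfolding VU_def by simp
qed

section \<open>Central limit theorem for weighted chi-square sums\<close>

lemma exp_minus_approx:
  fixes x :: real
  assumes "x \<ge> 0"
  shows "\<bar>(1 - x) - exp (- x)\<bar> \<le> x^2"
proof -
  have 1: "1 - x \<le> exp (- x)" using exp_ge_add_one_self[of "- x"] by simp
  have "exp (- x) \<le> 1 / (1 + x)"
    using exp_ge_add_one_self[of x] assms by (simp add: exp_minus inverse_eq_divide frac_le)
  also have "\<dots> \<le> 1 - x + x^2"
  proof -
    have "1 \<le> (1 - x + x^2) * (1 + x)" using assms by (simp add: algebra_simps power2_eq_square)
    then show ?thesis using assms by (simp add: divide_le_eq)
  qed
  finally show ?thesis using 1 by (simp add: abs_if)
qed

lemma Zmeas_prob_space: "\<sigma> > 0 \<Longrightarrow> prob_space (Zmeas \<sigma> n)"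
  unfolding Zmeas_def by (intro prob_space_PiM prob_space_normal_density)

lemma sets_Zmeas: "sets (Zmeas \<sigma> n) = sets (PiM {..<n} (\<lambda>_. borel))"
  unfolding Zmeas_def by (intro sets_PiM_cong) auto

lemma measurable_Zmeas_component: "k < n \<Longrightarrow> (\<lambda>z. z k) \<in> borel_measurable (Zmeas \<sigma> n)"
  by (subst measurable_cong_sets[OF sets_Zmeas refl]) measurable

text \<open>The variance 1/2 gives the quadratic term \<open>t^2 / 4\<close>. In the remainder the
  cubic term is capped by the square, so dominated convergence sends it to zero with only second
  moments. Its monotonicity lets one bound serve all modes at once.\<close>

lemma char_approx_chi:
  fixes \<sigma> :: real
  assumes s: "\<sigma> > 0"
  defines "N \<equiv> density lborel (normal_density 0 \<sigma>)" and "X \<equiv> \<lambda>\<zeta>. (\<zeta>^2 / \<sigma>^2 - 1) / 2"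
  shows "cmod (char (distr N borel X) t - complex_of_real (1 - t^2 / 4)) \<le> (t^2 / 6) * (\<integral>x. min (6 * (X x)^2) (\<bar>t\<bar> * \<bar>X x\<bar>^3) \<partial>N)"
    and "(\<And>n. 0 \<le> U n) \<Longrightarrow> U \<longlonglongrightarrow> 0 \<Longrightarrow> (\<lambda>n. \<integral>x. min (6 * (X x)^2) (U n * \<bar>X x\<bar>^3) \<partial>N) \<longlonglongrightarrow> 0"
    and "0 \<le> u \<Longrightarrow> u \<le> v \<Longrightarrow> (\<integral>x. min (6 * (X x)^2) (u * \<bar>X x\<bar>^3) \<partial>N) \<le> (\<integral>x. min (6 * (X x)^2) (v * \<bar>X x\<bar>^3) \<partial>N)"
proof -
  interpret prob_space N unfolding N_def using s by (rule prob_space_normal_density)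
  have X[measurable]: "X \<in> borel_measurable N" unfolding X_def N_def by measurable
  have "X = (\<lambda>x. (1/2) * ((0 - (1/\<sigma>) * x)^2 - ((0 - (1/\<sigma>) * 0)^2 + (1/\<sigma> * \<sigma>)^2)))"
    using s by (auto simp: X_def power_divide fun_eq_iff)
  then have X1: "has_bochner_integral N X ((1/2) * 0)"
    using has_bochner_integral_mult_right[OF normal_square_moments(1)[OF s, of 0 0 "1/\<sigma>"], of "1/2"] unfolding N_def by simp
  have "(\<lambda>x. (X x)^2) = (\<lambda>x. (1/4) * ((0 - (1/\<sigma>) * x)^2 - ((0 - (1/\<sigma>) * 0)^2 + (1/\<sigma> * \<sigma>)^2))^2)"
    using s by (auto simp: X_def power_divide fun_eq_iff)
  then have X2: "has_bochner_integral N (\<lambda>x. (X x)^2) ((1/4) * (4 * 0^2 * (1/\<sigma> * \<sigma>)^2 + 2 * (1/\<sigma> * \<sigma>)^4))"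
    using has_bochner_integral_mult_right[OF normal_square_moments(2)[OF s, of 0 0 "1/\<sigma>"], of "1/4"] unfolding N_def by simp
  have i: "integrable N X" "integrable N (\<lambda>x. (X x)^2)" "expectation X = 0" "expectation (\<lambda>x. (X x)^2) = 1/2"
    using X1 X2 s by (auto simp: has_bochner_integral_iff)
  have v: "variance X = 1/2" using i by simp
  show "cmod (char (distr N borel X) t - complex_of_real (1 - t^2 / 4)) \<le> (t^2 / 6) * (\<integral>x. min (6 * (X x)^2) (\<bar>t\<bar> * \<bar>X x\<bar>^3) \<partial>N)"
    using char_approx3'[OF X i(1-3) v refl, of t] by simp
  have int: "integrable N (\<lambda>x. min (6 * (X x)^2) (u * \<bar>X x\<bar>^3))" if "u \<ge> 0" for u
    by (rule Bochner_Integration.integrable_bound[OF integrable_mult_right[OF i(2), of 6]]) (use that in \<open>auto simp: min_def\<close>)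
  show "0 \<le> u \<Longrightarrow> u \<le> v \<Longrightarrow> (\<integral>x. min (6 * (X x)^2) (u * \<bar>X x\<bar>^3) \<partial>N) \<le> (\<integral>x. min (6 * (X x)^2) (v * \<bar>X x\<bar>^3) \<partial>N)"
    by (intro integral_mono int min.mono mult_right_mono) auto
  show "(\<lambda>n. \<integral>x. min (6 * (X x)^2) (U n * \<bar>X x\<bar>^3) \<partial>N) \<longlonglongrightarrow> 0" if U: "\<And>n. 0 \<le> U n" "U \<longlonglongrightarrow> 0"
  proof -
    have "(\<lambda>n. \<integral>x. min (6 * (X x)^2) (U n * \<bar>X x\<bar>^3) \<partial>N) \<longlonglongrightarrow> (\<integral>x. 0 \<partial>N)"
    proof (rule integral_dominated_convergence[where w="\<lambda>x. 6 * (X x)^2"])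
      show "AE x in N. (\<lambda>n. min (6 * (X x)^2) (U n * \<bar>X x\<bar>^3)) \<longlonglongrightarrow> 0"
      proof (rule AE_I2)
        fix x
        have "(\<lambda>n. min (6 * (X x)^2) (U n * \<bar>X x\<bar>^3)) \<longlonglongrightarrow> min (6 * (X x)^2) (0 * \<bar>X x\<bar>^3)"
          by (intro tendsto_min tendsto_const tendsto_mult U)
        then show "(\<lambda>n. min (6 * (X x)^2) (U n * \<bar>X x\<bar>^3)) \<longlonglongrightarrow> 0" by (simp add: min_absorb2)
      qed
    qed (use i U in \<open>auto simp: min_def\<close>)
    then show ?thesis by simp
  qed
qed

text \<open>A triangular array with bounded weights. Each characteristic factor differs from its
  Gaussian counterpart by at most \<open>(U n)^2 / 6 * R (U n) + (U n)^4 / 16\<close>. As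
  \<open>n * (U n)^2\<close> equals the constant \<open>t^2 / V\<close>, the sum of these
  \<open>n\<close> errors still vanishes, and it bounds the difference of the products.\<close>

lemma Zmeas_CLT:
  fixes \<sigma> V :: real and w :: "nat \<Rightarrow> nat \<Rightarrow> real"
  assumes s: "\<sigma> > 0" and V: "V > 0"
    and w: "\<And>n k. 0 \<le> w n k" "\<And>n k. w n k \<le> 1"
    and lim: "(\<lambda>n. (\<Sum>k=1..<n. (w n k)^2 / 2) / real n) \<longlonglongrightarrow> V"
  shows "weak_conv_m (\<lambda>n. distr (Zmeas \<sigma> n) borel (\<lambda>z. (\<Sum>k=1..<n. w n k * ((z k)^2 / \<sigma>^2 - 1) / 2) / sqrt (V * real n))) std_normal_distribution"
proof (rule levy_continuity)
  let ?N = "density lborel (normal_density 0 \<sigma>)"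
  let ?X = "\<lambda>\<zeta>::real. (\<zeta>^2 / \<sigma>^2 - 1) / 2"
  let ?S = "\<lambda>n z. (\<Sum>k=1..<n. w n k * ((z k)^2 / \<sigma>^2 - 1) / 2) / sqrt (V * real n)"
  interpret N: prob_space ?N using s by (rule prob_space_normal_density)
  interpret P: product_prob_space "\<lambda>_::nat. ?N" using s by (rule product_prob_space_normal)
  interpret Z: prob_space "Zmeas \<sigma> n" for n using s by (rule Zmeas_prob_space)
  have Xm: "?X \<in> borel_measurable ?N" by measurable
  interpret D: real_distribution "distr ?N borel ?X"
    by (intro N.real_distribution_distr Xm)
  have Sm: "?S n \<in> borel_measurable (Zmeas \<sigma> n)" for n
    by (intro borel_measurable_divide borel_measurable_sum borel_measurable_times borel_measurable_diff borel_measurable_power borel_measurable_const measurable_Zmeas_component) auto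
  show "real_distribution (distr (Zmeas \<sigma> n) borel (?S n))" for n
    by (intro Z.real_distribution_distr Sm)
  show "real_distribution std_normal_distribution" by (rule real_dist_normal_dist)
  fix t :: real
  define \<phi> where "\<phi> = char (distr ?N borel ?X)"
  define u where "u n k = t * w n k / sqrt (V * real n)" for n k
  define U where "U n = \<bar>t\<bar> / sqrt (V * real n)" for n
  define R where "R v = (\<integral>x. min (6 * (?X x)^2) (v * \<bar>?X x\<bar>^3) \<partial>?N)" for v
  have uU: "\<bar>u n k\<bar> \<le> U n" for n k
    using w[of n k] V unfolding u_def U_def by (auto simp: abs_mult intro!: divide_right_mono mult_left_le)
  have U0: "U n \<ge> 0" for n unfolding U_def using V by simp
  have Ulim: "U \<longlonglongrightarrow> 0"
    unfolding U_def using V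
    by (intro tendsto_divide_0[OF tendsto_const] filterlim_at_top_imp_at_infinity filterlim_compose[OF sqrt_at_top]
         filterlim_tendsto_pos_mult_at_top[OF tendsto_const] filterlim_real_sequentially)
  have char_eq: "char (distr (Zmeas \<sigma> n) borel (?S n)) t = (\<Prod>k=1..<n. \<phi> (u n k))" for n
  proof -
    \<comment> \<open>Coordinate 0 belongs to the product space but not to the sum, so its factor is
      the constant 1.\<close>
    define h where "h k x = (if k = 0 then 1 else iexp (u n k * ?X x))" for k :: nat and x
    have hm: "h k \<in> borel_measurable ?N" for k
    proof (cases "k = 0")
      case False
      have "(\<lambda>x. iexp (u n k * ?X x)) \<in> borel_measurable ?N" by measurable
      then show ?thesis using False by (simp add: h_def[abs_def])
    qed (simp add: h_def[abs_def])
    have int: "integrable ?N (h k)" for k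
      by (rule N.integrable_const_bound[of _ 1, OF _ hm]) (auto simp: h_def)
    have "char (distr (Zmeas \<sigma> n) borel (?S n)) t = (\<integral>z. iexp (t * ?S n z) \<partial>Zmeas \<sigma> n)"
      unfolding char_def by (subst integral_distr[OF Sm]) auto
    also have "\<dots> = (\<integral>z. (\<Prod>k<n. h k (z k)) \<partial>Zmeas \<sigma> n)"
    proof (rule Bochner_Integration.integral_cong[OF refl])
      fix z
      have "t * ?S n z = (\<Sum>k=1..<n. u n k * ?X (z k))"
        unfolding sum_divide_distrib sum_distrib_left u_def by (intro sum.cong refl) (simp add: field_simps)
      then have "iexp (t * ?S n z) = (\<Prod>k=1..<n. iexp (u n k * ?X (z k)))"
        by (simp add: sum_distrib_left exp_sum[symmetric] of_real_sum del: of_real_mult)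
      also have "\<dots> = (\<Prod>k=1..<n. h k (z k))" by (intro prod.cong) (auto simp: h_def)
      also have "\<dots> = (\<Prod>k<n. h k (z k))"
        by (rule prod.mono_neutral_left) (auto simp: h_def)
      finally show "iexp (t * ?S n z) = (\<Prod>k<n. h k (z k))" .
    qed
    also have "\<dots> = (\<Prod>k<n. \<integral>x. h k x \<partial>?N)"
      unfolding Zmeas_def by (intro P.product_integral_prod int) auto
    also have "\<dots> = (\<Prod>k=1..<n. \<integral>x. h k x \<partial>?N)"
      by (rule prod.mono_neutral_right) (use N.prob_space in \<open>auto simp: h_def\<close>)
    also have "\<dots> = (\<Prod>k=1..<n. \<phi> (u n k))"
    proof (rule prod.cong[OF refl])
      fix k assume "k \<in> {1..<n}"
      then have "h k = (\<lambda>x. iexp (u n k * ?X x))" by (auto simp: h_def fun_eq_iff)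
      then show "(\<integral>x. h k x \<partial>?N) = \<phi> (u n k)"
        unfolding \<phi>_def char_def by (subst integral_distr[OF Xm]) auto
    qed
    finally show ?thesis .
  qed
  have step: "cmod (\<phi> (u n k) - complex_of_real (exp (- ((u n k)^2 / 4)))) \<le> (U n)^2 / 6 * R (U n) + (U n)^4 / 16" for n k
  proof -
    have u2: "(u n k)^2 \<le> (U n)^2" using uU[of n k] U0[of n] by (metis abs_le_square_iff abs_of_nonneg)
    have "cmod (\<phi> (u n k) - complex_of_real (1 - (u n k)^2 / 4)) \<le> (u n k)^2 / 6 * R \<bar>u n k\<bar>"
      unfolding \<phi>_def R_def by (rule char_approx_chi(1)[OF s])
    also have "\<dots> \<le> (U n)^2 / 6 * R (U n)"
    proof (intro mult_mono)
      show "R \<bar>u n k\<bar> \<le> R (U n)" unfolding R_def by (rule char_approx_chi(3)[OF s _ uU]) simp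
      show "0 \<le> R \<bar>u n k\<bar>" unfolding R_def by (intro Bochner_Integration.integral_nonneg) auto
    qed (use u2 in auto)
    finally have 1: "cmod (\<phi> (u n k) - complex_of_real (1 - (u n k)^2 / 4)) \<le> (U n)^2 / 6 * R (U n)" .
    have "cmod (complex_of_real (1 - (u n k)^2 / 4) - complex_of_real (exp (- ((u n k)^2 / 4)))) = \<bar>(1 - (u n k)^2 / 4) - exp (- ((u n k)^2 / 4))\<bar>"
      by (metis of_real_diff norm_of_real)
    also have "\<dots> \<le> ((u n k)^2 / 4)^2" by (intro exp_minus_approx) simp
    also have "\<dots> \<le> ((U n)^2 / 4)^2" using u2 by (intro power_mono) auto
    also have "\<dots> = (U n)^4 / 16" by (simp add: power_divide)
    finally show ?thesis using 1 norm_triangle_sub[of "\<phi> (u n k) - complex_of_real (exp (- ((u n k)^2 / 4)))"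
        "\<phi> (u n k) - complex_of_real (1 - (u n k)^2 / 4)"] by simp
  qed
  have diff_le: "cmod ((\<Prod>k=1..<n. \<phi> (u n k)) - (\<Prod>k=1..<n. complex_of_real (exp (- ((u n k)^2 / 4)))))
     \<le> real n * ((U n)^2 / 6 * R (U n) + (U n)^4 / 16)" for n
  proof -
    have "cmod ((\<Prod>k=1..<n. \<phi> (u n k)) - (\<Prod>k=1..<n. complex_of_real (exp (- ((u n k)^2 / 4)))))
      \<le> (\<Sum>k=1..<n. cmod (\<phi> (u n k) - complex_of_real (exp (- ((u n k)^2 / 4)))))"
      unfolding \<phi>_def by (intro norm_prod_diff D.cmod_char_le_1) (simp del: of_real_exp)
    also have "\<dots> \<le> (\<Sum>k=1..<n. (U n)^2 / 6 * R (U n) + (U n)^4 / 16)" by (intro sum_mono step)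
    also have "\<dots> = real (n - 1) * ((U n)^2 / 6 * R (U n) + (U n)^4 / 16)" by simp
    also have "\<dots> \<le> real n * ((U n)^2 / 6 * R (U n) + (U n)^4 / 16)"
      by (intro mult_right_mono add_nonneg_nonneg mult_nonneg_nonneg) (auto simp: R_def intro!: Bochner_Integration.integral_nonneg mult_nonneg_nonneg U0)
    finally show ?thesis .
  qed
  have diff_lim: "(\<lambda>n. real n * ((U n)^2 / 6 * R (U n) + (U n)^4 / 16)) \<longlonglongrightarrow> 0"
  proof -
    have e: "real n * (U n)^2 = t^2 / V" if "n > 0" for n
      using V that unfolding U_def by (simp add: power_divide field_simps)
    have "(\<lambda>n. (t^2 / V) / 6 * R (U n) + (t^2 / V) / 16 * (U n)^2) \<longlonglongrightarrow> (t^2 / V) / 6 * 0 + (t^2 / V) / 16 * 0^2"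
      unfolding R_def by (intro tendsto_intros char_approx_chi(2)[OF s U0 Ulim] Ulim)
    moreover have "eventually (\<lambda>n. (t^2 / V) / 6 * R (U n) + (t^2 / V) / 16 * (U n)^2 = real n * ((U n)^2 / 6 * R (U n) + (U n)^4 / 16)) sequentially"
    proof (rule eventually_sequentiallyI[of 1])
      fix n :: nat assume "1 \<le> n"
      then have "t^2 / V = real n * (U n)^2" using e[of n] by simp
      then show "(t^2 / V) / 6 * R (U n) + (t^2 / V) / 16 * (U n)^2 = real n * ((U n)^2 / 6 * R (U n) + (U n)^4 / 16)"
        by (simp only:) (simp add: algebra_simps power4_eq_xxxx power2_eq_square)
    qed
    ultimately show ?thesis by (simp add: tendsto_cong)
  qed
  have diff: "(\<lambda>n. (\<Prod>k=1..<n. \<phi> (u n k)) - (\<Prod>k=1..<n. complex_of_real (exp (- ((u n k)^2 / 4))))) \<longlonglongrightarrow> 0"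
    by (rule Lim_null_comparison[OF always_eventually[OF allI[OF diff_le]] diff_lim])
  have "(\<lambda>n. complex_of_real (exp (- (t^2 / (2 * V) * ((\<Sum>k=1..<n. (w n k)^2 / 2) / real n))))) \<longlonglongrightarrow> complex_of_real (exp (- (t^2 / (2 * V) * V)))"
    by (intro tendsto_intros lim)
  moreover have "(\<Prod>k=1..<n. complex_of_real (exp (- ((u n k)^2 / 4)))) = complex_of_real (exp (- (t^2 / (2 * V) * ((\<Sum>k=1..<n. (w n k)^2 / 2) / real n))))" for n
  proof -
    have "(\<Prod>k=1..<n. complex_of_real (exp (- ((u n k)^2 / 4)))) = complex_of_real (exp (\<Sum>k=1..<n. - ((u n k)^2 / 4)))"
      by (simp only: of_real_prod exp_sum finite_atLeastLessThan)
    also have "(\<Sum>k=1..<n. - ((u n k)^2 / 4)) = - (t^2 / (2 * V) * ((\<Sum>k=1..<n. (w n k)^2 / 2) / real n))"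
      unfolding sum_negf sum_divide_distrib sum_distrib_left u_def using V
      by (intro arg_cong[where f=uminus] sum.cong refl) (simp add: power_divide power_mult_distrib)
    finally show ?thesis .
  qed
  ultimately have "(\<lambda>n. \<Prod>k=1..<n. complex_of_real (exp (- ((u n k)^2 / 4)))) \<longlonglongrightarrow> complex_of_real (exp (- (t^2 / 2)))"
    using V by simp
  from tendsto_add[OF diff this] have "(\<lambda>n. \<Prod>k=1..<n. \<phi> (u n k)) \<longlonglongrightarrow> complex_of_real (exp (- (t^2 / 2)))"
    by simp
  then show "(\<lambda>n. char (distr (Zmeas \<sigma> n) borel (?S n)) t) \<longlonglongrightarrow> char std_normal_distribution t"
    unfolding char_eq by (simp add: char_std_normal_distribution)
qed

lemma measure_std_normal_singleton: "measure std_normal_distribution {x} = 0"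
proof -
  have "emeasure std_normal_distribution {x} = 0"
    by (subst emeasure_density) (auto intro!: nn_integral_null_set)
  then show ?thesis by (simp add: measure_def)
qed

lemma Qfun_eq_cdf: "Qfun x = 1 - cdf std_normal_distribution x"
proof -
  interpret real_distribution std_normal_distribution by (rule real_dist_normal_dist)
  have "{x<..} = space std_normal_distribution - {..x}" by auto
  then show ?thesis unfolding Qfun_def cdf_def using prob_compl[of "{..x}"] by simp
qed

lemma Zmeas_tail_limit:
  fixes \<sigma> V x :: real and w :: "nat \<Rightarrow> nat \<Rightarrow> real"
  assumes s: "\<sigma> > 0" and V: "V > 0"
    and w: "\<And>n k. 0 \<le> w n k" "\<And>n k. w n k \<le> 1"
    and lim: "(\<lambda>n. (\<Sum>k=1..<n. (w n k)^2 / 2) / real n) \<longlonglongrightarrow> V"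
  shows "(\<lambda>n. measure (Zmeas \<sigma> n) {z \<in> space (Zmeas \<sigma> n). (\<Sum>k=1..<n. w n k * ((z k)^2 / \<sigma>^2 - 1) / 2) > x * sqrt (real n)}) \<longlonglongrightarrow> Qfun (x / sqrt V)"
proof -
  let ?S = "\<lambda>n z. (\<Sum>k=1..<n. w n k * ((z k)^2 / \<sigma>^2 - 1) / 2)"
  interpret Z: prob_space "Zmeas \<sigma> n" for n using s by (rule Zmeas_prob_space)
  interpret G: real_distribution std_normal_distribution by (rule real_dist_normal_dist)
  have Sm: "?S n \<in> borel_measurable (Zmeas \<sigma> n)" for n
    by (intro borel_measurable_divide borel_measurable_sum borel_measurable_times borel_measurable_diff borel_measurable_power borel_measurable_const measurable_Zmeas_component) auto
  have Sm': "(\<lambda>z. ?S n z / sqrt (V * real n)) \<in> borel_measurable (Zmeas \<sigma> n)" for n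
    using Sm[of n] by measurable
  have "isCont (cdf std_normal_distribution) (x / sqrt V)"
    by (simp only: G.isCont_cdf measure_std_normal_singleton)
  then have "(\<lambda>n. cdf (distr (Zmeas \<sigma> n) borel (\<lambda>z. ?S n z / sqrt (V * real n))) (x / sqrt V)) \<longlonglongrightarrow> cdf std_normal_distribution (x / sqrt V)"
    using Zmeas_CLT[OF assms] unfolding weak_conv_m_def weak_conv_def by blast
  then have "(\<lambda>n. 1 - cdf (distr (Zmeas \<sigma> n) borel (\<lambda>z. ?S n z / sqrt (V * real n))) (x / sqrt V)) \<longlonglongrightarrow> Qfun (x / sqrt V)"
    unfolding Qfun_eq_cdf by (intro tendsto_intros)
  moreover have "eventually (\<lambda>n. 1 - cdf (distr (Zmeas \<sigma> n) borel (\<lambda>z. ?S n z / sqrt (V * real n))) (x / sqrt V)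
    = measure (Zmeas \<sigma> n) {z \<in> space (Zmeas \<sigma> n). ?S n z > x * sqrt (real n)}) sequentially"
  proof (rule eventually_sequentiallyI[of 1])
    fix n :: nat assume n: "1 \<le> n"
    have iff: "?S n z / sqrt (V * real n) \<le> x / sqrt V \<longleftrightarrow> \<not> ?S n z > x * sqrt (real n)" for z
      using n V by (simp add: real_sqrt_mult field_simps not_less)
    have "cdf (distr (Zmeas \<sigma> n) borel (\<lambda>z. ?S n z / sqrt (V * real n))) (x / sqrt V)
      = measure (Zmeas \<sigma> n) ((\<lambda>z. ?S n z / sqrt (V * real n)) -` {..x / sqrt V} \<inter> space (Zmeas \<sigma> n))"
      unfolding cdf_def by (intro measure_distr Sm') auto
    also have "(\<lambda>z. ?S n z / sqrt (V * real n)) -` {..x / sqrt V} \<inter> space (Zmeas \<sigma> n)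
      = space (Zmeas \<sigma> n) - {z \<in> space (Zmeas \<sigma> n). ?S n z > x * sqrt (real n)}"
      using iff by auto
    also have "measure (Zmeas \<sigma> n) (space (Zmeas \<sigma> n) - {z \<in> space (Zmeas \<sigma> n). ?S n z > x * sqrt (real n)})
      = 1 - measure (Zmeas \<sigma> n) {z \<in> space (Zmeas \<sigma> n). ?S n z > x * sqrt (real n)}"
      using measurable_sets[OF Sm[of n], of "{x * sqrt (real n)<..}"]
      by (intro Z.prob_compl) (simp add: vimage_def Int_def conj_commute)
    finally show "1 - cdf (distr (Zmeas \<sigma> n) borel (\<lambda>z. ?S n z / sqrt (V * real n))) (x / sqrt V)
    = measure (Zmeas \<sigma> n) {z \<in> space (Zmeas \<sigma> n). ?S n z > x * sqrt (real n)}" by simp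
  qed
  ultimately show ?thesis by (rule Lim_transform_eventually)
qed

section \<open>Converse for a fixed block length\<close>

lemma sine_mode_orthonormal_pred:
  assumes "k \<in> {1..<n}" "l \<in> {1..<n}"
  shows "(\<Sum>i<n-1. sine_mode n k (Suc i) * sine_mode n l (Suc i)) = (if k = l then 1 else 0)"
proof -
  have "(\<Sum>i<n. sine_mode n k (Suc i) * sine_mode n l (Suc i)) = (\<Sum>i<n-1. sine_mode n k (Suc i) * sine_mode n l (Suc i)) + sine_mode n k n * sine_mode n l n"
    using assms by (cases n) auto
  then show ?thesis using sine_mode_orthonormal_Suc[OF assms] assms by simp
qed

text \<open>All sine vectors vanish at the last coordinate, so its error involves
  \<open>\<zeta> 0\<close> alone. The other coordinates are projected onto the sine vectors by
  Bessel's inequality. Once \<open>\<zeta> 0\<close> is fixed, the codeword enters each mode as a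
  constant.\<close>

lemma square_error_lower_bound:
  assumes a: "a > 1" and n: "n > 0"
    and z: "\<And>i. i < n \<Longrightarrow> z i = (\<Sum>k<n. mode_basis a n i k * \<zeta> k)"
  shows "(last_scale a n * \<zeta> 0 - c (n - 1))^2
     + (\<Sum>k=1..<n. (\<zeta> k / sqrt (gfun_grid a n k) - (\<Sum>i<n-1. sine_mode n k (Suc i) * (c i - last_coeff a n i * (last_scale a n * \<zeta> 0))))^2)
    \<le> (\<Sum>i<n. (Uvec a z i - c i)^2)"
proof -
  let ?y = "\<lambda>k. \<zeta> k / sqrt (gfun_grid a n k)"
  let ?b = "\<lambda>i. c i - last_coeff a n i * (last_scale a n * \<zeta> 0)"
  have U: "Uvec a z i = (\<Sum>k=1..<n. sine_mode n k (Suc i) * ?y k) + last_coeff a n i * (last_scale a n * \<zeta> 0)" if "i < n" for i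
    by (rule Uvec_mode_basis[OF a that z])
  have last: "Uvec a z (n - 1) = last_scale a n * \<zeta> 0"
    using U[of "n - 1"] n last_coeff_last[OF a n] by simp
  have split: "(\<Sum>i<n. (Uvec a z i - c i)^2) = (\<Sum>i<n-1. (Uvec a z i - c i)^2) + (Uvec a z (n - 1) - c (n - 1))^2"
    using n sum.lessThan_Suc[of "\<lambda>i. (Uvec a z i - c i)^2" "n - 1"] by simp
  have "(\<Sum>k=1..<n. (\<Sum>i<n-1. sine_mode n k (Suc i) * (Uvec a z i - c i))^2) \<le> (\<Sum>i<n-1. (Uvec a z i - c i)^2)"
    by (rule Bessel_inequality_finite[OF _ sine_mode_orthonormal_pred]) simp
  moreover have "(\<Sum>i<n-1. sine_mode n k (Suc i) * (Uvec a z i - c i)) = ?y k - (\<Sum>i<n-1. sine_mode n k (Suc i) * ?b i)" if k: "k \<in> {1..<n}" for k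
  proof -
    have "(\<Sum>i<n-1. sine_mode n k (Suc i) * (Uvec a z i - c i)) = (\<Sum>i<n-1. sine_mode n k (Suc i) * (\<Sum>l=1..<n. sine_mode n l (Suc i) * ?y l) - sine_mode n k (Suc i) * ?b i)"
      by (intro sum.cong refl) (simp add: U algebra_simps)
    also have "\<dots> = (\<Sum>i<n-1. sine_mode n k (Suc i) * (\<Sum>l=1..<n. sine_mode n l (Suc i) * ?y l)) - (\<Sum>i<n-1. sine_mode n k (Suc i) * ?b i)"
      by (rule sum_subtractf)
    also have "(\<Sum>i<n-1. sine_mode n k (Suc i) * (\<Sum>l=1..<n. sine_mode n l (Suc i) * ?y l)) = (\<Sum>l=1..<n. (\<Sum>i<n-1. sine_mode n k (Suc i) * sine_mode n l (Suc i)) * ?y l)"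
      unfolding sum_distrib_left sum_distrib_right by (subst sum.swap) (simp add: mult.assoc)
    also have "\<dots> = (\<Sum>l=1..<n. if k = l then ?y l else 0)"
      using k by (intro sum.cong refl, subst sine_mode_orthonormal_pred) auto
    also have "\<dots> = ?y k" using k by simp
    finally show ?thesis .
  qed
  ultimately show ?thesis unfolding split last by simp
qed

section \<open>Exponential moments of the tilted information\<close>

lemma nn_integral_normal_tilt_large:
  fixes r b \<sigma> \<theta> :: real
  assumes r: "r > 0" and s: "\<sigma> > 0" and t: "\<theta> > 0"
  shows "(\<integral>\<^sup>+x. ennreal (sqrt (\<sigma>^2 * r^2 / \<theta>) * exp (x^2 / (2*\<sigma>^2) - (r * x - b)^2 / (2*\<theta>))) \<partial>density lborel (normal_density 0 \<sigma>)) = 1"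
proof -
  let ?G = "\<lambda>x. sqrt (\<sigma>^2 * r^2 / \<theta>) * exp (x^2 / (2*\<sigma>^2) - (r * x - b)^2 / (2*\<theta>))"
  \<comment> \<open>Source density times tilt is the normal law for which \<open>r * x\<close> has
    mean \<open>b\<close> and variance \<theta>: the backward test channel at codeword
    \<open>b\<close>.\<close>
  have e: "normal_density 0 \<sigma> x * ?G x = normal_density (b / r) (sqrt \<theta> / r) x" for x
  proof -
    have 1: "(x - b / r)^2 / (2 * (sqrt \<theta> / r)^2) = (r * x - b)^2 / (2 * \<theta>)"
      using r t by (simp add: power_divide field_simps power2_eq_square)
    have 2: "sqrt (\<sigma>^2 * r^2 / \<theta>) / sqrt (2 * pi * \<sigma>^2) = 1 / sqrt (2 * pi * (sqrt \<theta> / r)^2)"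
      using r s t by (simp add: real_sqrt_divide real_sqrt_mult power_divide field_simps)
    have "normal_density 0 \<sigma> x * ?G x = (sqrt (\<sigma>^2 * r^2 / \<theta>) / sqrt (2 * pi * \<sigma>^2)) * (exp (- (x^2 / (2*\<sigma>^2))) * exp (x^2 / (2*\<sigma>^2) - (r * x - b)^2 / (2*\<theta>)))"
      unfolding normal_density_def by simp
    also have "exp (- (x^2 / (2*\<sigma>^2))) * exp (x^2 / (2*\<sigma>^2) - (r * x - b)^2 / (2*\<theta>)) = exp (- ((r * x - b)^2 / (2*\<theta>)))"
      by (simp add: exp_add[symmetric])
    finally show ?thesis unfolding normal_density_def 2 1[symmetric] by simp
  qed
  have "(\<integral>\<^sup>+x. ennreal (?G x) \<partial>density lborel (normal_density 0 \<sigma>)) = (\<integral>\<^sup>+x. ennreal (normal_density 0 \<sigma> x) * ennreal (?G x) \<partial>lborel)"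
    by (rule nn_integral_density) measurable
  also have "\<dots> = (\<integral>\<^sup>+x. ennreal (normal_density (b / r) (sqrt \<theta> / r) x) \<partial>lborel)"
    by (intro nn_integral_cong) (simp only: ennreal_mult'[symmetric] normal_density_nonneg e)
  also have "\<dots> = 1"
    using r t by (simp add: nn_integral_eq_integral)
  finally show ?thesis .
qed

text \<open>Completing the square leaves a normal density of unchanged variance times a factor whose
  exponent \<open>b^2 / (2*\<theta>) * (\<sigma>^2 * r^2 / \<theta> - 1)\<close> is at most zero
  exactly because the mode lies below the water level. Equality holds at \<open>b = 0\<close>, the
  codeword used for such modes.\<close>

lemma nn_integral_normal_tilt_small:
  fixes r b \<sigma> \<theta> :: real
  assumes r: "r > 0" and s: "\<sigma> > 0" and t: "\<theta> > 0" and small: "\<sigma>^2 * r^2 \<le> \<theta>"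
  shows "(\<integral>\<^sup>+x. ennreal (exp (r^2 * x^2 / (2*\<theta>) - (r * x - b)^2 / (2*\<theta>))) \<partial>density lborel (normal_density 0 \<sigma>)) \<le> 1"
proof -
  let ?G = "\<lambda>x. exp (r^2 * x^2 / (2*\<theta>) - (r * x - b)^2 / (2*\<theta>))"
  have e: "normal_density 0 \<sigma> x * ?G x \<le> normal_density (\<sigma>^2 * r * b / \<theta>) \<sigma> x" for x
  proof -
    have 1: "- (x^2 / (2*\<sigma>^2)) + (r^2 * x^2 / (2*\<theta>) - (r * x - b)^2 / (2*\<theta>))
      = - ((x - \<sigma>^2 * r * b / \<theta>)^2 / (2*\<sigma>^2)) + b^2 / (2*\<theta>) * (\<sigma>^2 * r^2 / \<theta> - 1)"
      using s t by (simp add: field_simps power2_eq_square)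
    have "b^2 / (2*\<theta>) * (\<sigma>^2 * r^2 / \<theta> - 1) \<le> 0"
      using small t by (intro mult_nonneg_nonpos) auto
    then have "- (x^2 / (2*\<sigma>^2)) + (r^2 * x^2 / (2*\<theta>) - (r * x - b)^2 / (2*\<theta>)) \<le> - ((x - \<sigma>^2 * r * b / \<theta>)^2 / (2*\<sigma>^2))"
      unfolding 1 by simp
    then have "exp (- (x^2 / (2*\<sigma>^2))) * ?G x \<le> exp (- ((x - \<sigma>^2 * r * b / \<theta>)^2 / (2*\<sigma>^2)))"
      unfolding exp_add[symmetric] by simp
    then have "(1 / sqrt (2 * pi * \<sigma>^2)) * (exp (- (x^2 / (2*\<sigma>^2))) * ?G x) \<le> (1 / sqrt (2 * pi * \<sigma>^2)) * exp (- ((x - \<sigma>^2 * r * b / \<theta>)^2 / (2*\<sigma>^2)))"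
      by (rule mult_left_mono) simp
    then show ?thesis unfolding normal_density_def by simp
  qed
  have "(\<integral>\<^sup>+x. ennreal (?G x) \<partial>density lborel (normal_density 0 \<sigma>)) = (\<integral>\<^sup>+x. ennreal (normal_density 0 \<sigma> x) * ennreal (?G x) \<partial>lborel)"
    by (rule nn_integral_density) measurable
  also have "\<dots> \<le> (\<integral>\<^sup>+x. ennreal (normal_density (\<sigma>^2 * r * b / \<theta>) \<sigma> x) \<partial>lborel)"
    using e by (intro nn_integral_mono) (simp add: ennreal_mult'[symmetric] ennreal_leI)
  also have "\<dots> = 1"
    using s by (simp add: nn_integral_eq_integral)
  finally show ?thesis .
qed

text \<open>The water-filling distortion of the mode divided by \<theta>: 1 for an active mode, and
  the ratio of its variance to \<theta> for an inactive one.\<close>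

definition mode_weight :: "real \<Rightarrow> real \<Rightarrow> real \<Rightarrow> nat \<Rightarrow> nat \<Rightarrow> real" where
  "mode_weight a \<sigma> \<theta> n k = min 1 (\<sigma>^2 / (\<theta> * gfun_grid a n k))"

definition mode_rate :: "real \<Rightarrow> real \<Rightarrow> real \<Rightarrow> nat \<Rightarrow> nat \<Rightarrow> real" where
  "mode_rate a \<sigma> \<theta> n k = (1/2) * ln (max (\<sigma>^2 / gfun_grid a n k) \<theta> / \<theta>)"

lemma nn_integral_mode_tilt:
  fixes b \<sigma> \<theta> :: real
  assumes a: "a > 1" and s: "\<sigma> > 0" and t: "\<theta> > 0"
  shows "(\<integral>\<^sup>+x. ennreal (exp (mode_rate a \<sigma> \<theta> n k + mode_weight a \<sigma> \<theta> n k * x^2 / (2*\<sigma>^2) - (x / sqrt (gfun_grid a n k) - b)^2 / (2*\<theta>))) \<partial>density lborel (normal_density 0 \<sigma>)) \<le> 1"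
proof -
  define r where "r = 1 / sqrt (gfun_grid a n k)"
  have g: "gfun_grid a n k > 0" by (rule gfun_grid_pos[OF a])
  then have r: "r > 0" "r^2 = 1 / gfun_grid a n k" by (auto simp: r_def power_divide)
  show ?thesis
  proof (cases "\<theta> \<le> \<sigma>^2 / gfun_grid a n k")
    case True
    have "\<sigma>^2 / (\<theta> * gfun_grid a n k) \<ge> 1" using True t g by (simp add: field_simps)
    then have w: "mode_weight a \<sigma> \<theta> n k = 1" by (simp add: mode_weight_def min_absorb1)
    have p: "\<sigma>^2 * r^2 / \<theta> > 0" using r(1) s t by (intro divide_pos_pos mult_pos_pos zero_less_power)
    have "mode_rate a \<sigma> \<theta> n k = ln (sqrt (\<sigma>^2 * r^2 / \<theta>))"
      using True p r by (simp add: mode_rate_def ln_sqrt max_absorb1)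
    then have "exp (mode_rate a \<sigma> \<theta> n k) = sqrt (\<sigma>^2 * r^2 / \<theta>)" using p by simp
    then have "exp (mode_rate a \<sigma> \<theta> n k + mode_weight a \<sigma> \<theta> n k * x^2 / (2*\<sigma>^2) - (x / sqrt (gfun_grid a n k) - b)^2 / (2*\<theta>))
      = sqrt (\<sigma>^2 * r^2 / \<theta>) * exp (x^2 / (2*\<sigma>^2) - (r * x - b)^2 / (2*\<theta>))" for x
      unfolding w by (simp add: exp_add[symmetric] exp_diff r_def exp_add)
    then show ?thesis using nn_integral_normal_tilt_large[OF r(1) s t, of b] by simp
  next
    case False
    then have w: "mode_weight a \<sigma> \<theta> n k = \<sigma>^2 * r^2 / \<theta>" using t g r by (simp add: mode_weight_def min_def field_simps)
    have l: "mode_rate a \<sigma> \<theta> n k = 0" using False t by (simp add: mode_rate_def max_absorb2)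
    have sm: "\<sigma>^2 * r^2 \<le> \<theta>" using False r by simp
    have "mode_rate a \<sigma> \<theta> n k + mode_weight a \<sigma> \<theta> n k * x^2 / (2*\<sigma>^2) - (x / sqrt (gfun_grid a n k) - b)^2 / (2*\<theta>)
      = r^2 * x^2 / (2*\<theta>) - (r * x - b)^2 / (2*\<theta>)" for x
      unfolding w l using s by (simp add: r_def)
    then show ?thesis using nn_integral_normal_tilt_small[OF r(1) s t sm, of b] by simp
  qed
qed

text \<open>The \<open>d\<close>-tilted information of the source vector with mode coordinates \<open>\<zeta>\<close>, minus a lower bound
  for its squared distance to the codeword \<open>c\<close> divided by \<open>2\<theta>\<close>, both up to additive constants.\<close>

definition tilted_info :: "real \<Rightarrow> real \<Rightarrow> real \<Rightarrow> nat \<Rightarrow> (nat \<Rightarrow> real) \<Rightarrow> (nat \<Rightarrow> real) \<Rightarrow> real" where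
  "tilted_info a \<sigma> \<theta> n c \<zeta> = ln (sqrt (\<sigma>^2 * (last_scale a n)^2 / \<theta>)) + (\<zeta> 0)^2 / (2*\<sigma>^2) - (last_scale a n * \<zeta> 0 - c (n - 1))^2 / (2*\<theta>)
    + (\<Sum>k=1..<n. mode_rate a \<sigma> \<theta> n k + mode_weight a \<sigma> \<theta> n k * (\<zeta> k)^2 / (2*\<sigma>^2)
        - (\<zeta> k / sqrt (gfun_grid a n k) - (\<Sum>i<n-1. sine_mode n k (Suc i) * (c i - last_coeff a n i * (last_scale a n * \<zeta> 0))))^2 / (2*\<theta>))"

lemma measurable_tilted_info:
  assumes "n > 0"
  shows "tilted_info a \<sigma> \<theta> n c \<in> borel_measurable (Zmeas \<sigma> n)"
proof -
  note [measurable] = measurable_Zmeas_component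
  have [measurable]: "(\<lambda>z. z 0) \<in> borel_measurable (Zmeas \<sigma> n)" using assms by measurable
  have [measurable]: "k \<in> {1..<n} \<Longrightarrow> (\<lambda>z. z k) \<in> borel_measurable (Zmeas \<sigma> n)" for k
    by (rule measurable_Zmeas_component) auto
  show ?thesis unfolding tilted_info_def by measurable
qed

lemma ennreal_prod_le_1:
  fixes f :: "'i \<Rightarrow> ennreal"
  assumes "\<And>k. k \<in> A \<Longrightarrow> f k \<le> 1"
  shows "prod f A \<le> 1"
  using assms by (induction A rule: infinite_finite_induct) (use mult_mono[of _ 1 _ "1::ennreal"] in auto)

text \<open>Mode 0 is integrated last: for fixed \<open>\<zeta> 0\<close> the shifts
  \<open>b k y\<close> are constants, so the integrand factors over the other modes and each factor
  has integral at most one. What remains is the tilt of mode 0, always in the large-variance form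
  and of mass one.\<close>

lemma nn_integral_exp_tilted_info:
  assumes a: "a > 1" and s: "\<sigma> > 0" and t: "\<theta> > 0" and n: "n > 0"
  shows "(\<integral>\<^sup>+\<zeta>. ennreal (exp (tilted_info a \<sigma> \<theta> n c \<zeta>)) \<partial>Zmeas \<sigma> n) \<le> 1"
proof -
  let ?N = "density lborel (normal_density 0 \<sigma>)"
  interpret product_sigma_finite "\<lambda>_::nat. ?N" by (rule product_sigma_finite_normal[OF s])
  have set: "{..<n} = insert 0 {1..<n}" using n by auto
  have last_scale: "last_scale a n > 0" using last_scale_ge_1[OF a n] by simp
  define b where "b k y = (\<Sum>i<n-1. sine_mode n k (Suc i) * (c i - last_coeff a n i * (last_scale a n * y)))" for k y
  define G where "G k y x = exp (mode_rate a \<sigma> \<theta> n k + mode_weight a \<sigma> \<theta> n k * x^2 / (2*\<sigma>^2) - (x / sqrt (gfun_grid a n k) - b k y)^2 / (2*\<theta>))" for k x y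
  define G0 where "G0 y = sqrt (\<sigma>^2 * (last_scale a n)^2 / \<theta>) * exp (y^2 / (2*\<sigma>^2) - (last_scale a n * y - c (n - 1))^2 / (2*\<theta>))" for y
  have F: "ennreal (exp (tilted_info a \<sigma> \<theta> n c (x(0 := y)))) = ennreal (G0 y) * (\<Prod>k\<in>{1..<n}. ennreal (G k y (x k)))" for x y
  proof -
    have p: "sqrt (\<sigma>^2 * (last_scale a n)^2 / \<theta>) > 0" using s last_scale t by simp
    have "tilted_info a \<sigma> \<theta> n c (x(0 := y)) = ln (sqrt (\<sigma>^2 * (last_scale a n)^2 / \<theta>)) + (y^2 / (2*\<sigma>^2) - (last_scale a n * y - c (n - 1))^2 / (2*\<theta>))
      + (\<Sum>k=1..<n. mode_rate a \<sigma> \<theta> n k + mode_weight a \<sigma> \<theta> n k * (x k)^2 / (2*\<sigma>^2) - (x k / sqrt (gfun_grid a n k) - b k y)^2 / (2*\<theta>))"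
      unfolding tilted_info_def b_def by simp
    then have "exp (tilted_info a \<sigma> \<theta> n c (x(0 := y))) = G0 y * (\<Prod>k\<in>{1..<n}. G k y (x k))"
      using p unfolding G_def G0_def by (simp only: exp_add exp_sum finite_atLeastLessThan exp_ln)
    then show ?thesis
      using p by (simp add: ennreal_mult' prod_ennreal G_def G0_def prod_nonneg)
  qed
  have Fm: "(\<lambda>\<zeta>. ennreal (exp (tilted_info a \<sigma> \<theta> n c \<zeta>))) \<in> borel_measurable (PiM (insert 0 {1..<n}) (\<lambda>_. ?N))"
    using measurable_tilted_info[OF n, of a \<sigma> \<theta> c] unfolding Zmeas_def set by measurable
  have "(\<integral>\<^sup>+\<zeta>. ennreal (exp (tilted_info a \<sigma> \<theta> n c \<zeta>)) \<partial>Zmeas \<sigma> n)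
    = (\<integral>\<^sup>+y. (\<integral>\<^sup>+x. ennreal (exp (tilted_info a \<sigma> \<theta> n c (x(0 := y)))) \<partial>PiM {1..<n} (\<lambda>_. ?N)) \<partial>?N)"
    unfolding Zmeas_def set by (rule product_nn_integral_insert_rev[OF _ _ Fm]) auto
  also have "\<dots> \<le> (\<integral>\<^sup>+y. ennreal (G0 y) \<partial>?N)"
  proof (rule nn_integral_mono)
    fix y
    have 1: "(\<integral>\<^sup>+x. ennreal (exp (tilted_info a \<sigma> \<theta> n c (x(0 := y)))) \<partial>PiM {1..<n} (\<lambda>_. ?N))
      = ennreal (G0 y) * (\<integral>\<^sup>+x. (\<Prod>k\<in>{1..<n}. ennreal (G k y (x k))) \<partial>PiM {1..<n} (\<lambda>_. ?N))"
      unfolding F by (intro nn_integral_cmult borel_measurable_prod_ennreal) (auto simp: G_def intro!: measurable_compose[OF measurable_component_singleton])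
    have 2: "(\<integral>\<^sup>+x. (\<Prod>k\<in>{1..<n}. ennreal (G k y (x k))) \<partial>PiM {1..<n} (\<lambda>_. ?N)) = (\<Prod>k\<in>{1..<n}. \<integral>\<^sup>+x. ennreal (G k y x) \<partial>?N)"
      by (intro product_nn_integral_prod) (auto simp: G_def)
    have 3: "(\<Prod>k\<in>{1..<n}. \<integral>\<^sup>+x. ennreal (G k y x) \<partial>?N) \<le> 1"
      unfolding G_def by (intro ennreal_prod_le_1 nn_integral_mode_tilt[OF a s t])
    show "(\<integral>\<^sup>+x. ennreal (exp (tilted_info a \<sigma> \<theta> n c (x(0 := y)))) \<partial>PiM {1..<n} (\<lambda>_. ?N)) \<le> ennreal (G0 y)"
      unfolding 1 2 using mult_left_mono[OF 3, of "ennreal (G0 y)"] by (simp only: mult_1_right zero_le)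
  qed
  also have "\<dots> = 1" unfolding G0_def by (rule nn_integral_normal_tilt_large[OF last_scale s t])
  finally show ?thesis .
qed

lemma Zmeas_lin_mode_basis:
  assumes a: "a > 1" and s: "\<sigma> > 0"
  shows "lin {..<n} (mode_basis a n) \<in> measurable (Zmeas \<sigma> n) (Zmeas \<sigma> n)"
    and "distr (Zmeas \<sigma> n) (Zmeas \<sigma> n) (lin {..<n} (mode_basis a n)) = Zmeas \<sigma> n"
  unfolding Zmeas_def
  using mode_basis_orthonormal[OF a] orthonormal_columns_imp_rows[OF mode_basis_orthonormal[OF a]]
  by (intro distr_lin_normal s; simp)+

lemma converse_bound:
  assumes a: "a > 1" and s: "\<sigma> > 0" and t: "\<theta> > 0" and n: "n > 0"
    and code: "has_code a \<sigma> n M d \<epsilon>"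
  defines "A \<equiv> (\<Sum>k=1..<n. mode_rate a \<sigma> \<theta> n k) + ln (sqrt (\<sigma>^2 * (last_scale a n)^2 / \<theta>)) + (\<Sum>k=1..<n. mode_weight a \<sigma> \<theta> n k) / 2 - real n * d / (2*\<theta>)"
  shows "M \<ge> 1" and "measure (Zmeas \<sigma> n) {\<zeta> \<in> space (Zmeas \<sigma> n). (\<Sum>k=1..<n. mode_weight a \<sigma> \<theta> n k * ((\<zeta> k)^2 / \<sigma>^2 - 1) / 2) \<ge> ln (real M) + \<gamma> - A} \<le> \<epsilon> + exp (- \<gamma>)"
proof -
  let ?Z = "Zmeas \<sigma> n" and ?T = "lin {..<n} (mode_basis a n)"
  interpret Z: prob_space ?Z using s by (rule Zmeas_prob_space)
  obtain f g where fg: "\<And>x. f x \<in> {1..M}" and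
    E1: "{z \<in> space ?Z. distortion n (Uvec a z) (g (f (Uvec a z))) > d} \<in> sets ?Z"
       "measure ?Z {z \<in> space ?Z. distortion n (Uvec a z) (g (f (Uvec a z))) > d} \<le> \<epsilon>"
    using code unfolding has_code_def Let_def by blast
  define E where "E = {z \<in> space ?Z. distortion n (Uvec a z) (g (f (Uvec a z))) > d}"
  show M: "M \<ge> 1" using fg[of undefined] by simp
  let ?K = "{\<zeta> \<in> space ?Z. (\<Sum>k=1..<n. mode_weight a \<sigma> \<theta> n k * ((\<zeta> k)^2 / \<sigma>^2 - 1) / 2) \<ge> ln (real M) + \<gamma> - A}"
  let ?E = "?T -` E \<inter> space ?Z"
  let ?B = "\<lambda>m. {\<zeta> \<in> space ?Z. ln (real M) + \<gamma> \<le> tilted_info a \<sigma> \<theta> n (g m) \<zeta>}"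
  have Bm: "?B m \<in> sets ?Z" for m
    using measurable_tilted_info[OF n, of a \<sigma> \<theta> "g m"] by measurable
  \<comment> \<open>The orthogonal map preserves the law of the noise, so the failure event of the
    code can be measured in mode coordinates.\<close>
  have Em: "?E \<in> sets ?Z" using measurable_sets[OF Zmeas_lin_mode_basis(1)[OF a s] E1(1)] unfolding E_def .
  have PE: "measure ?Z ?E \<le> \<epsilon>"
    using measure_distr[OF Zmeas_lin_mode_basis(1)[OF a s] E1(1)] E1(2) unfolding Zmeas_lin_mode_basis(2)[OF a s] E_def by (simp only:)
  have PB: "measure ?Z (?B m) \<le> exp (- \<gamma>) / real M" for m
  proof -
    define q where "q = ennreal (exp (- (ln (real M) + \<gamma>)))"
    have *: "?B m = {\<zeta> \<in> space ?Z. 1 \<le> q * ennreal (exp (tilted_info a \<sigma> \<theta> n (g m) \<zeta>))}"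
      unfolding q_def ennreal_mult'[symmetric, OF exp_ge_zero] exp_add[symmetric] by (auto simp: algebra_simps)
    have "emeasure ?Z (?B m) \<le> q * (\<integral>\<^sup>+\<zeta>. ennreal (exp (tilted_info a \<sigma> \<theta> n (g m) \<zeta>)) * indicator (space ?Z) \<zeta> \<partial>?Z)"
    proof -
      have [measurable]: "tilted_info a \<sigma> \<theta> n (g m) \<in> borel_measurable ?Z" by (rule measurable_tilted_info[OF n])
      have "emeasure ?Z {\<zeta> \<in> space ?Z. 1 \<le> q * ennreal (exp (tilted_info a \<sigma> \<theta> n (g m) \<zeta>))}
        \<le> q * (\<integral>\<^sup>+\<zeta>. ennreal (exp (tilted_info a \<sigma> \<theta> n (g m) \<zeta>)) * indicator (space ?Z) \<zeta> \<partial>?Z)"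
        by (rule nn_integral_Markov_inequality) (intro borel_measurable_times_ennreal borel_measurable_indicator sets.top, measurable)
      then show ?thesis using * by simp
    qed
    also have "(\<integral>\<^sup>+\<zeta>. ennreal (exp (tilted_info a \<sigma> \<theta> n (g m) \<zeta>)) * indicator (space ?Z) \<zeta> \<partial>?Z) = (\<integral>\<^sup>+\<zeta>. ennreal (exp (tilted_info a \<sigma> \<theta> n (g m) \<zeta>)) \<partial>?Z)"
      by (intro nn_integral_cong) simp
    also have "q * (\<integral>\<^sup>+\<zeta>. ennreal (exp (tilted_info a \<sigma> \<theta> n (g m) \<zeta>)) \<partial>?Z) \<le> q * 1" by (intro mult_left_mono nn_integral_exp_tilted_info[OF a s t n]) auto
    finally have "measure ?Z (?B m) \<le> exp (- (ln (real M) + \<gamma>))"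
      unfolding q_def Z.emeasure_eq_measure by simp
    also have "\<dots> = exp (- \<gamma>) / real M" using M by (simp add: exp_diff exp_minus exp_add field_simps)
    finally show ?thesis .
  qed
  have "?K \<subseteq> ?E \<union> (\<Union>m\<in>{1..M}. ?B m)"
  proof
    fix \<zeta> assume K: "\<zeta> \<in> ?K"
    show "\<zeta> \<in> ?E \<union> (\<Union>m\<in>{1..M}. ?B m)"
    proof (cases "\<zeta> \<in> ?E")
      case False
      let ?z = "?T \<zeta>"
      have zs: "?z \<in> space ?Z" using K measurable_space[OF Zmeas_lin_mode_basis(1)[OF a s]] by auto
      define m where "m = f (Uvec a ?z)"
      have m: "m \<in> {1..M}" unfolding m_def by (rule fg)
      have "distortion n (Uvec a ?z) (g m) \<le> d" using False K zs unfolding E_def m_def by auto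
      then have D: "(\<Sum>i<n. (Uvec a ?z i - g m i)^2) \<le> real n * d"
        using n by (simp add: distortion_def field_simps)
      let ?D = "(last_scale a n * \<zeta> 0 - g m (n - 1))^2
     + (\<Sum>k=1..<n. (\<zeta> k / sqrt (gfun_grid a n k) - (\<Sum>i<n-1. sine_mode n k (Suc i) * (g m i - last_coeff a n i * (last_scale a n * \<zeta> 0))))^2)"
      have "?D \<le> (\<Sum>i<n. (Uvec a ?z i - g m i)^2)"
        by (rule square_error_lower_bound[OF a n]) (simp add: lin_def)
      then have D': "?D / (2*\<theta>) \<le> real n * d / (2*\<theta>)" using D t by (intro divide_right_mono) auto
      have "tilted_info a \<sigma> \<theta> n (g m) \<zeta> = (\<Sum>k=1..<n. mode_rate a \<sigma> \<theta> n k) + ln (sqrt (\<sigma>^2 * (last_scale a n)^2 / \<theta>)) + (\<zeta> 0)^2 / (2*\<sigma>^2)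
         + (\<Sum>k=1..<n. mode_weight a \<sigma> \<theta> n k * (\<zeta> k)^2 / (2*\<sigma>^2)) - ?D / (2*\<theta>)"
        unfolding tilted_info_def by (simp add: sum.distrib sum_subtractf sum_divide_distrib add_divide_distrib)
      moreover have "(\<Sum>k=1..<n. mode_weight a \<sigma> \<theta> n k * (\<zeta> k)^2 / (2*\<sigma>^2)) = (\<Sum>k=1..<n. mode_weight a \<sigma> \<theta> n k * ((\<zeta> k)^2 / \<sigma>^2 - 1) / 2) + (\<Sum>k=1..<n. mode_weight a \<sigma> \<theta> n k) / 2"
        unfolding sum_divide_distrib sum.distrib[symmetric] by (intro sum.cong refl) (simp add: field_simps)
      \<comment> \<open>The square of mode 0 is just dropped: a single term is invisible on the
        scale sqrt n.\<close>
      moreover have "(\<zeta> 0)^2 / (2*\<sigma>^2) \<ge> 0" by simp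
      moreover have "ln (real M) + \<gamma> - A \<le> (\<Sum>k=1..<n. mode_weight a \<sigma> \<theta> n k * ((\<zeta> k)^2 / \<sigma>^2 - 1) / 2)" using K by blast
      ultimately have "ln (real M) + \<gamma> \<le> tilted_info a \<sigma> \<theta> n (g m) \<zeta>" using D' unfolding A_def by linarith
      then have "\<zeta> \<in> ?B m" using K by simp
      then show ?thesis using m by blast
    qed auto
  qed
  then have "measure ?Z ?K \<le> measure ?Z (?E \<union> (\<Union>m\<in>{1..M}. ?B m))"
    using Em Bm by (intro Z.finite_measure_mono) auto
  also have "\<dots> \<le> measure ?Z ?E + measure ?Z (\<Union>m\<in>{1..M}. ?B m)"
    using Em Bm by (intro measure_Un_le) auto
  also have "measure ?Z (\<Union>m\<in>{1..M}. ?B m) \<le> (\<Sum>m\<in>{1..M}. measure ?Z (?B m))"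
    using Bm by (intro measure_UNION_le) auto
  also have "\<dots> \<le> (\<Sum>m\<in>{1..M}. exp (- \<gamma>) / real M)" by (intro sum_mono PB)
  also have "\<dots> = exp (- \<gamma>)" using M by simp
  finally show "measure ?Z ?K \<le> \<epsilon> + exp (- \<gamma>)" using PE by simp
qed

section \<open>Covering by Gaussian codewords\<close>

text \<open>Let \<open>H\<close> be the part of \<open>G\<close> not covered yet. By Fubini, the
  mass of \<open>H\<close> covered by \<open>y\<close>, averaged over \<open>y\<close>, is at least
  \<open>p\<close> times the mass of \<open>H\<close>, so some \<open>y\<close> achieves this. Each
  such choice shrinks the uncovered mass by the factor \<open>1 - p\<close>, without a probability
  space of random codebooks.\<close>

lemma greedy_covering:
  assumes "prob_space P" "prob_space Q"
    and R: "R \<in> sets (P \<Otimes>\<^sub>M Q)" and G: "G \<in> sets P"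
    and p: "0 \<le> p" "p \<le> 1" "\<And>\<zeta>. \<zeta> \<in> G \<Longrightarrow> p \<le> measure Q {y \<in> space Q. (\<zeta>, y) \<in> R}"
  shows "\<exists>Y. finite Y \<and> card Y \<le> M \<and> Y \<subseteq> space Q \<and> {\<zeta> \<in> G. \<forall>y\<in>Y. (\<zeta>, y) \<notin> R} \<in> sets P
    \<and> measure P {\<zeta> \<in> G. \<forall>y\<in>Y. (\<zeta>, y) \<notin> R} \<le> (1 - p) ^ M"
proof -
  interpret P: prob_space P by fact
  interpret Q: prob_space Q by fact
  interpret PQ: pair_prob_space P Q ..
  show ?thesis
  proof (induction M)
    case 0
    show ?case using G by (intro exI[of _ "{}"]) simp
  next
    case (Suc M)
    then obtain Y where Y: "finite Y" "card Y \<le> M" "Y \<subseteq> space Q"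
      and H0: "{\<zeta> \<in> G. \<forall>y\<in>Y. (\<zeta>, y) \<notin> R} \<in> sets P" "measure P {\<zeta> \<in> G. \<forall>y\<in>Y. (\<zeta>, y) \<notin> R} \<le> (1 - p) ^ M"
      by blast
    define H where "H = {\<zeta> \<in> G. \<forall>y\<in>Y. (\<zeta>, y) \<notin> R}"
    have H: "H \<in> sets P" "H \<subseteq> G" "measure P H \<le> (1 - p) ^ M" using H0 by (auto simp: H_def)
    have HP: "H \<subseteq> space P" using sets.sets_into_space[OF H(1)] .
    define S where "S = R \<inter> (H \<times> space Q)"
    have S: "S \<in> sets (P \<Otimes>\<^sub>M Q)" unfolding S_def using R H by auto
    define f where "f y = measure P ((\<lambda>x. (x, y)) -` S)" for y
    have cut: "(\<lambda>x. (x, y)) -` S \<in> sets P" for y using S by (rule sets_Pair2)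
    have fm: "f \<in> borel_measurable Q" unfolding f_def using PQ.measurable_emeasure_Pair2[OF S] by (simp add: measure_def)
    have fi: "integrable Q f"
      by (rule Q.integrable_const_bound[of _ 1, OF _ fm]) (simp add: f_def)
    have "\<exists>y\<in>space Q. p * measure P H \<le> f y"
    proof (rule ccontr)
      assume "\<not> (\<exists>y\<in>space Q. p * measure P H \<le> f y)"
      then have "Q.expectation f < p * measure P H"
        by (intro Q.expectation_less fi AE_I2) (auto simp: not_le)
      moreover have "ennreal (p * measure P H) \<le> ennreal (Q.expectation f)"
      proof -
        have "ennreal (p * measure P H) = (\<integral>\<^sup>+\<zeta>. ennreal p * indicator H \<zeta> \<partial>P)"
          using H p by (simp add: nn_integral_cmult_indicator ennreal_mult' P.emeasure_eq_measure)
        also have "\<dots> \<le> (\<integral>\<^sup>+\<zeta>. emeasure Q (Pair \<zeta> -` S) \<partial>P)"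
        proof (rule nn_integral_mono)
          fix \<zeta> assume "\<zeta> \<in> space P"
          show "ennreal p * indicator H \<zeta> \<le> emeasure Q (Pair \<zeta> -` S)"
          proof (cases "\<zeta> \<in> H")
            case True
            then have "Pair \<zeta> -` S = {y \<in> space Q. (\<zeta>, y) \<in> R}" by (auto simp: S_def)
            then show ?thesis using True p(3)[of \<zeta>] H by (auto simp: Q.emeasure_eq_measure)
          qed simp
        qed
        also have "\<dots> = emeasure (P \<Otimes>\<^sub>M Q) S" by (rule Q.emeasure_pair_measure_alt[OF S, symmetric])
        also have "\<dots> = (\<integral>\<^sup>+y. emeasure P ((\<lambda>x. (x, y)) -` S) \<partial>Q)" by (rule PQ.emeasure_pair_measure_alt2[OF S])
        also have "\<dots> = (\<integral>\<^sup>+y. ennreal (f y) \<partial>Q)" by (simp add: f_def P.emeasure_eq_measure)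
        also have "\<dots> = ennreal (Q.expectation f)"
          by (intro nn_integral_eq_integral fi) (simp add: f_def)
        finally show ?thesis .
      qed
      then have "p * measure P H \<le> Q.expectation f"
        by (subst (asm) ennreal_le_iff) (auto simp: f_def intro!: Bochner_Integration.integral_nonneg)
      ultimately show False by simp
    qed
    then obtain y where y: "y \<in> space Q" "p * measure P H \<le> f y" by blast
    have e: "{\<zeta> \<in> G. \<forall>y'\<in>insert y Y. (\<zeta>, y') \<notin> R} = H - (\<lambda>x. (x, y)) -` S"
      using y HP by (auto simp: H_def S_def)
    have sub: "(\<lambda>x. (x, y)) -` S \<subseteq> H" by (auto simp: S_def)
    have "measure P (H - (\<lambda>x. (x, y)) -` S) = measure P H - f y"
      unfolding f_def using H cut sub by (intro P.finite_measure_Diff) auto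
    also have "\<dots> \<le> (1 - p) * measure P H" using y by (simp add: algebra_simps)
    also have "\<dots> \<le> (1 - p) * (1 - p) ^ M" using H p by (intro mult_left_mono) auto
    finally have "measure P (H - (\<lambda>x. (x, y)) -` S) \<le> (1 - p) ^ Suc M" by simp
    moreover have "H - (\<lambda>x. (x, y)) -` S \<in> sets P" using H cut by auto
    moreover have "card (insert y Y) \<le> Suc M" using Y by (simp add: card_insert_if le_SucI)
    ultimately show ?case using Y y unfolding e[symmetric] by (intro exI[of _ "insert y Y"]) simp
  qed
qed

section \<open>Gaussian test channel and change of measure\<close>

lemma normal_density_tilt:
  fixes \<tau> \<theta> u x :: real
  assumes "0 < \<theta>" "\<theta> \<le> \<tau>"
  shows "normal_density (sqrt (\<tau> - \<theta>) * u / \<tau>) (sqrt (\<theta> / \<tau>)) x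
    = normal_density 0 1 x * exp ((1/2) * ln (\<tau> / \<theta>) + u^2 / (2 * \<tau>) - (u - sqrt (\<tau> - \<theta>) * x)^2 / (2 * \<theta>))"
proof -
  have t: "\<tau> > 0" using assms by simp
  define r where "r = sqrt (\<tau> - \<theta>)"
  have r: "r^2 = \<tau> - \<theta>" using assms by (simp add: r_def)
  have 1: "- ((x - r * u / \<tau>)^2 / (2 * (\<theta> / \<tau>))) = - (x^2 / 2) + (u^2 / (2 * \<tau>) - (u - r * x)^2 / (2 * \<theta>))"
  proof -
    have "(x - r * u / \<tau>)^2 / (2 * (\<theta> / \<tau>)) = (\<tau> * x^2 - 2 * r * u * x + r^2 * u^2 / \<tau>) / (2 * \<theta>)"
      using t assms by (simp add: field_simps power2_eq_square)
    also have "\<dots> = ((u - r * x)^2 + \<theta> * x^2 - \<theta> * u^2 / \<tau>) / (2 * \<theta>)"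
    proof -
      have "r^2 * u^2 / \<tau> = u^2 - \<theta> * u^2 / \<tau>" unfolding r using t by (simp add: field_simps)
      moreover have "(u - r * x)^2 = u^2 - 2 * r * u * x + (\<tau> - \<theta>) * x^2"
        unfolding r[symmetric] by (simp add: power2_eq_square algebra_simps)
      ultimately show ?thesis by (simp add: algebra_simps)
    qed
    also have "\<dots> = x^2 / 2 - (u^2 / (2 * \<tau>) - (u - r * x)^2 / (2 * \<theta>))"
      using t assms by (simp add: field_simps)
    finally show ?thesis by simp
  qed
  have 2: "1 / sqrt (2 * pi * (\<theta> / \<tau>)) = 1 / sqrt (2 * pi) * exp ((1/2) * ln (\<tau> / \<theta>))"
  proof -
    have "exp ((1/2) * ln (\<tau> / \<theta>)) = sqrt (\<tau> / \<theta>)"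
      using t assms by (simp add: ln_sqrt[symmetric])
    then show ?thesis using t assms by (simp add: real_sqrt_mult real_sqrt_divide)
  qed
  have "normal_density (r * u / \<tau>) (sqrt (\<theta> / \<tau>)) x = 1 / sqrt (2 * pi * (\<theta> / \<tau>)) * exp (- ((x - r * u / \<tau>)^2 / (2 * (\<theta> / \<tau>))))"
    unfolding normal_density_def using t assms by simp
  also have "\<dots> = (1 / sqrt (2 * pi) * exp (- (x^2 / 2))) * exp ((1/2) * ln (\<tau> / \<theta>) + (u^2 / (2 * \<tau>) - (u - r * x)^2 / (2 * \<theta>)))"
    unfolding 1 2 exp_add by simp
  also have "1 / sqrt (2 * pi) * exp (- (x^2 / 2)) = normal_density 0 1 x"
    unfolding normal_density_def by simp
  finally show ?thesis unfolding r_def by simp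
qed

text \<open>By Bayes' rule the conditional density of the codeword given \<open>u\<close> is its
  standard normal density times the exponential of the information density, which is the sum in the
  hypothesis. On \<open>S\<close> this density ratio is at most \<open>exp C\<close>.\<close>

lemma measure_change_lower_bound:
  fixes \<tau> \<theta> u :: "'i \<Rightarrow> real"
  assumes I: "finite I" and t: "\<And>k. 0 < \<theta> k" "\<And>k. \<theta> k \<le> \<tau> k"
  defines "\<gamma> \<equiv> PiM I (\<lambda>_. density lborel (normal_density 0 1))"
    and "\<nu> \<equiv> PiM I (\<lambda>k. density lborel (normal_density (sqrt (\<tau> k - \<theta> k) * u k / \<tau> k) (sqrt (\<theta> k / \<tau> k))))"
  assumes S: "S \<in> sets \<gamma>"
    and C: "\<And>x. x \<in> S \<Longrightarrow> (\<Sum>k\<in>I. (1/2) * ln (\<tau> k / \<theta> k) + (u k)^2 / (2 * \<tau> k) - (u k - sqrt (\<tau> k - \<theta> k) * x k)^2 / (2 * \<theta> k)) \<le> C"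
  shows "exp (- C) * measure \<nu> S \<le> measure \<gamma> S"
proof -
  let ?L = "PiM I (\<lambda>_. lborel :: real measure)"
  let ?m = "\<lambda>k. sqrt (\<tau> k - \<theta> k) * u k / \<tau> k" and ?s = "\<lambda>k. sqrt (\<theta> k / \<tau> k)"
  have s: "0 < ?s k" for k using t[of k] less_le_trans[OF t] by simp
  interpret G: prob_space \<gamma> unfolding \<gamma>_def by (rule prob_space_PiM_normal) simp
  interpret N: prob_space \<nu> unfolding \<nu>_def by (rule prob_space_PiM_normal[OF s])
  have SL: "S \<in> sets ?L" using S unfolding \<gamma>_def by (simp cong: sets_PiM_cong)
  have "sets ?L = sets (PiM I (\<lambda>_. borel))" by (intro sets_PiM_cong) auto
  with SL have SLb[measurable]: "S \<in> sets (PiM I (\<lambda>_. borel))" by simp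
  have g: "\<gamma> = density ?L (\<lambda>x. \<Prod>k\<in>I. ennreal (normal_density 0 1 (x k)))"
    unfolding \<gamma>_def by (intro PiM_density I product_sigma_finite_lborel product_sigma_finite_normal) auto
  have n: "\<nu> = density ?L (\<lambda>x. \<Prod>k\<in>I. ennreal (normal_density (?m k) (?s k) (x k)))"
    unfolding \<nu>_def by (intro PiM_density I product_sigma_finite_lborel product_sigma_finite_normal s) auto
  have "emeasure \<nu> S = (\<integral>\<^sup>+x. (\<Prod>k\<in>I. ennreal (normal_density (?m k) (?s k) (x k))) * indicator S x \<partial>?L)"
    unfolding n by (rule emeasure_density[OF _ SL]) measurable
  also have "\<dots> \<le> (\<integral>\<^sup>+x. ennreal (exp C) * ((\<Prod>k\<in>I. ennreal (normal_density 0 1 (x k))) * indicator S x) \<partial>?L)"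
  proof (rule nn_integral_mono)
    fix x
    show "(\<Prod>k\<in>I. ennreal (normal_density (?m k) (?s k) (x k))) * indicator S x
      \<le> ennreal (exp C) * ((\<Prod>k\<in>I. ennreal (normal_density 0 1 (x k))) * indicator S x)"
    proof (cases "x \<in> S")
      case True
      have "(\<Prod>k\<in>I. normal_density (?m k) (?s k) (x k)) = (\<Prod>k\<in>I. normal_density 0 1 (x k))
         * exp (\<Sum>k\<in>I. (1/2) * ln (\<tau> k / \<theta> k) + (u k)^2 / (2 * \<tau> k) - (u k - sqrt (\<tau> k - \<theta> k) * x k)^2 / (2 * \<theta> k))"
        unfolding normal_density_tilt[OF t] prod.distrib exp_sum[OF I] ..
      also have "\<dots> \<le> (\<Prod>k\<in>I. normal_density 0 1 (x k)) * exp C"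
        using C[OF True] by (intro mult_left_mono prod_nonneg) auto
      finally have "(\<Prod>k\<in>I. normal_density (?m k) (?s k) (x k)) \<le> exp C * (\<Prod>k\<in>I. normal_density 0 1 (x k))"
        by (simp add: mult.commute)
      then show ?thesis using True
        by (simp add: prod_ennreal ennreal_mult'[symmetric] prod_nonneg ennreal_leI)
    qed simp
  qed
  also have "\<dots> = ennreal (exp C) * (\<integral>\<^sup>+x. (\<Prod>k\<in>I. ennreal (normal_density 0 1 (x k))) * indicator S x \<partial>?L)"
    using SLb by (intro nn_integral_cmult) measurable
  also have "(\<integral>\<^sup>+x. (\<Prod>k\<in>I. ennreal (normal_density 0 1 (x k))) * indicator S x \<partial>?L) = emeasure \<gamma> S"
    unfolding g by (rule emeasure_density[OF _ SL, symmetric]) measurable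
  finally have "measure \<nu> S \<le> exp C * measure \<gamma> S"
    unfolding N.emeasure_eq_measure G.emeasure_eq_measure by (simp add: ennreal_mult'[symmetric])
  then show ?thesis by (simp add: exp_minus field_simps)
qed

lemma measure_PiM_marginal:
  assumes M: "product_prob_space M" and I: "finite I" "A \<subseteq> I" and S: "S \<in> sets (PiM A M)"
  shows "measure (PiM I M) {x \<in> space (PiM I M). restrict x A \<in> S} = measure (PiM A M) S"
proof -
  interpret product_prob_space M by fact
  have m: "(\<lambda>x. restrict x A) \<in> measurable (PiM I M) (PiM A M)"
    using I by (intro measurable_restrict_subset)
  have "measure (PiM A M) S = measure (distr (PiM I M) (PiM A M) (\<lambda>x. restrict x A)) S"
    using distr_restrict[OF I(2,1)] by simp
  also have "\<dots> = measure (PiM I M) ((\<lambda>x. restrict x A) -` S \<inter> space (PiM I M))"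
    using m S by (rule measure_distr)
  also have "(\<lambda>x. restrict x A) -` S \<inter> space (PiM I M) = {x \<in> space (PiM I M). restrict x A \<in> S}"
    by auto
  finally show ?thesis by simp
qed

text \<open>The Gaussian test channel for \<open>u\<close>: with a codeword \<open>y\<^sub>k = sqrt (\<tau>\<^sub>k - \<theta>\<^sub>k) x\<^sub>k\<close>, the law of the standard
  normal \<open>x\<close> conditioned on \<open>u = y + noise\<close> with noise variances \<open>\<theta>\<^sub>k\<close>. For \<open>\<theta>\<^sub>k = \<tau>\<^sub>k\<close> it is standard normal.\<close>

definition tilted :: "'i set \<Rightarrow> ('i \<Rightarrow> real) \<Rightarrow> ('i \<Rightarrow> real) \<Rightarrow> ('i \<Rightarrow> real) \<Rightarrow> ('i \<Rightarrow> real) measure" where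
  "tilted I \<tau> \<theta> u = PiM I (\<lambda>k. density lborel (normal_density (sqrt (\<tau> k - \<theta> k) * u k / \<tau> k) (sqrt (\<theta> k / \<tau> k))))"

definition sqerr :: "'i set \<Rightarrow> ('i \<Rightarrow> real) \<Rightarrow> ('i \<Rightarrow> real) \<Rightarrow> ('i \<Rightarrow> real) \<Rightarrow> ('i \<Rightarrow> real) \<Rightarrow> real" where
  "sqerr S \<tau> \<theta> u x = (\<Sum>k\<in>S. (u k - sqrt (\<tau> k - \<theta> k) * x k)^2)"

lemma prob_space_tilted:
  assumes "\<And>k. 0 < \<theta> k" "\<And>k. \<theta> k \<le> \<tau> k"
  shows "prob_space (tilted I \<tau> \<theta> u)"
proof -
  have "0 < sqrt (\<theta> k / \<tau> k)" for k using assms(1)[of k] less_le_trans[OF assms] by simp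
  then show ?thesis unfolding tilted_def by (rule prob_space_PiM_normal)
qed

lemma sets_tilted: "sets (tilted I \<tau> \<theta> u) = sets (PiM I (\<lambda>_. borel))"
  unfolding tilted_def by (intro sets_PiM_cong) auto

lemma measurable_sqerr:
  assumes "S \<subseteq> I" "sets N = sets (PiM I (\<lambda>_. borel))"
  shows "sqerr S \<tau> \<theta> u \<in> borel_measurable N"
proof -
  have "sqerr S \<tau> \<theta> u \<in> borel_measurable (PiM I (\<lambda>_. borel))"
    unfolding sqerr_def using assms(1)
    by (intro borel_measurable_sum borel_measurable_power borel_measurable_diff borel_measurable_times borel_measurable_const measurable_component_singleton) auto
  then show ?thesis by (simp add: measurable_cong_sets[OF assms(2) refl])
qed

text \<open>Given \<open>u\<close>, the residual in coordinate \<open>k\<close> has mean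
  \<open>\<theta> k / \<tau> k * u k\<close> and variance
  \<open>\<theta> k - (\<theta> k)^2 / \<tau> k\<close>. With \<open>u\<close> expressed by its
  standardization \<open>z\<close>, this gives the stated centre;
  \<open>(\<theta> k)^2 / \<tau> k \<le> \<theta> k \<le> \<Theta>\<close> gives the variance
  bound.\<close>

lemma tilted_Chebyshev:
  fixes \<tau> \<theta> z :: "'i \<Rightarrow> real"
  assumes I: "finite I" "S \<subseteq> I" and t: "\<And>k. 0 < \<theta> k" "\<And>k. \<theta> k \<le> \<tau> k" "\<And>k. k \<in> S \<Longrightarrow> \<theta> k \<le> \<Theta>" and e: "e > 0"
  defines "u \<equiv> \<lambda>k. sqrt (\<tau> k) * z k"
  shows "measure (tilted I \<tau> \<theta> u) {x \<in> space (tilted I \<tau> \<theta> u). \<bar>sqerr S \<tau> \<theta> u x - (\<Sum>k\<in>S. \<theta> k + (\<theta> k)^2 / \<tau> k * ((z k)^2 - 1))\<bar> \<ge> e}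
    \<le> (\<Sum>k\<in>S. 4 * \<Theta>^2 * (z k)^2 + 2 * \<Theta>^2) / e^2"
proof -
  let ?m = "\<lambda>k. sqrt (\<tau> k - \<theta> k) * u k / \<tau> k" and ?s = "\<lambda>k. sqrt (\<theta> k / \<tau> k)" and ?r = "\<lambda>k. sqrt (\<tau> k - \<theta> k)"
  have T: "0 < \<tau> k" for k using t less_le_trans by blast
  have s: "0 < ?s k" for k using t(1)[of k] T[of k] by simp
  have A: "(u k - ?r k * ?m k)^2 = (\<theta> k)^2 / \<tau> k * (z k)^2" for k
  proof -
    have "u k - ?r k * ?m k = u k - (?r k)^2 * u k / \<tau> k" by (simp add: power2_eq_square)
    also have "(?r k)^2 = \<tau> k - \<theta> k" using t(2)[of k] by simp
    also have "u k - (\<tau> k - \<theta> k) * u k / \<tau> k = \<theta> k / \<tau> k * u k" using T[of k] by (simp add: field_simps)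
    finally have "(u k - ?r k * ?m k)^2 = (\<theta> k / \<tau> k * u k)^2" by (rule arg_cong)
    also have "\<dots> = (\<theta> k / \<tau> k)^2 * ((sqrt (\<tau> k))^2 * (z k)^2)" by (simp only: u_def power_mult_distrib)
    also have "(sqrt (\<tau> k))^2 = \<tau> k" using T[of k] by simp
    finally show ?thesis using T[of k] by (simp add: power_divide power2_eq_square)
  qed
  have B: "(?r k * ?s k)^2 = \<theta> k - (\<theta> k)^2 / \<tau> k" for k
    using t(1)[of k] t(2)[of k] T[of k] by (simp add: power_mult_distrib field_simps power2_eq_square)
  have E: "(\<Sum>k\<in>S. (u k - ?r k * ?m k)^2 + (?r k * ?s k)^2) = (\<Sum>k\<in>S. \<theta> k + (\<theta> k)^2 / \<tau> k * ((z k)^2 - 1))"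
    unfolding A B by (intro sum.cong refl) (simp add: algebra_simps diff_divide_distrib)
  have V: "4 * (u k - ?r k * ?m k)^2 * (?r k * ?s k)^2 + 2 * (?r k * ?s k)^4 \<le> 4 * \<Theta>^2 * (z k)^2 + 2 * \<Theta>^2" if k: "k \<in> S" for k
  proof -
    have q: "(\<theta> k)^2 / \<tau> k \<le> \<theta> k" "0 \<le> (\<theta> k)^2 / \<tau> k"
      using t(1)[of k] t(2)[of k] T[of k] by (simp_all add: divide_le_eq power2_eq_square mult_left_mono)
    have b: "0 \<le> (?r k * ?s k)^2" "(?r k * ?s k)^2 \<le> \<Theta>" unfolding B using q t(3)[OF k] by auto
    have T0: "0 \<le> \<Theta>" using t(1)[of k] t(3)[OF k] by linarith
    have a: "(u k - ?r k * ?m k)^2 \<le> \<Theta> * (z k)^2" unfolding A using q t(3)[OF k] by (intro mult_right_mono) auto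
    have "4 * (u k - ?r k * ?m k)^2 * (?r k * ?s k)^2 \<le> 4 * (\<Theta> * (z k)^2) * \<Theta>"
      using a b T0 by (intro mult_mono) auto
    moreover have "2 * (?r k * ?s k)^4 \<le> 2 * \<Theta>^2"
    proof -
      have "(?r k * ?s k)^4 = ((?r k * ?s k)^2)^2" by simp
      also have "\<dots> \<le> \<Theta>^2" using b by (intro power_mono)
      finally show ?thesis by simp
    qed
    moreover have "4 * (\<Theta> * (z k)^2) * \<Theta> = 4 * \<Theta>^2 * (z k)^2" by (simp add: power2_eq_square)
    ultimately show ?thesis by linarith
  qed
  have "measure (tilted I \<tau> \<theta> u) {x \<in> space (tilted I \<tau> \<theta> u). \<bar>sqerr S \<tau> \<theta> u x - (\<Sum>k\<in>S. (u k - ?r k * ?m k)^2 + (?r k * ?s k)^2)\<bar> \<ge> e}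
    \<le> (\<Sum>k\<in>S. 4 * (u k - ?r k * ?m k)^2 * (?r k * ?s k)^2 + 2 * (?r k * ?s k)^4) / e^2"
    unfolding tilted_def sqerr_def by (rule normal_quadratic_Chebyshev[OF I s e])
  also have "\<dots> \<le> (\<Sum>k\<in>S. 4 * \<Theta>^2 * (z k)^2 + 2 * \<Theta>^2) / e^2"
    by (intro divide_right_mono sum_mono V) auto
  finally show ?thesis unfolding E .
qed

text \<open>The distortion on \<open>A\<close> sees only the coordinates in \<open>A\<close>. Hence
  a distortion window on \<open>A\<close> can be selected before the levels off \<open>A\<close>,
  which will depend on that window, are fixed.\<close>

lemma tilted_marginal:
  assumes I: "finite I" "A \<subseteq> I" and t: "\<And>k. 0 < \<theta> k" "\<And>k. \<theta> k \<le> \<tau> k" "\<And>k. 0 < \<theta>' k" "\<And>k. \<theta>' k \<le> \<tau> k"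
    and eq: "\<And>k. k \<in> A \<Longrightarrow> \<theta> k = \<theta>' k" and V: "V \<in> sets borel"
  shows "measure (tilted I \<tau> \<theta> u) {x \<in> space (tilted I \<tau> \<theta> u). sqerr A \<tau> \<theta> u x \<in> V}
    = measure (tilted I \<tau> \<theta>' u) {x \<in> space (tilted I \<tau> \<theta>' u). sqerr A \<tau> \<theta>' u x \<in> V}"
proof -
  have *: "measure (tilted I \<tau> \<theta> u) {x \<in> space (tilted I \<tau> \<theta> u). sqerr A \<tau> \<theta> u x \<in> V} = measure (tilted A \<tau> \<theta> u) {x \<in> space (tilted A \<tau> \<theta> u). sqerr A \<tau> \<theta> u x \<in> V}"
    if t: "\<And>k. 0 < \<theta> k" "\<And>k. \<theta> k \<le> \<tau> k" for \<theta>
  proof -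
    let ?M = "\<lambda>k. density lborel (normal_density (sqrt (\<tau> k - \<theta> k) * u k / \<tau> k) (sqrt (\<theta> k / \<tau> k)))"
    have "0 < sqrt (\<theta> k / \<tau> k)" for k using t(1)[of k] less_le_trans[OF t] by simp
    then have P: "product_prob_space ?M" by (rule product_prob_space_normal)
    let ?S = "{x \<in> space (PiM A ?M). sqerr A \<tau> \<theta> u x \<in> V}"
    have S: "?S \<in> sets (PiM A ?M)"
      using measurable_sets[OF measurable_sqerr[OF order_refl sets_tilted, of A \<tau> \<theta> u] V] unfolding tilted_def
      by (simp add: vimage_def Int_def conj_commute)
    have r: "restrict x A \<in> space (PiM A ?M)" if "x \<in> space (PiM I ?M)" for x
      using that I by (auto simp: space_PiM)
    have "{x \<in> space (PiM I ?M). sqerr A \<tau> \<theta> u x \<in> V} = {x \<in> space (PiM I ?M). restrict x A \<in> ?S}"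
      using r by (auto simp: sqerr_def)
    then show ?thesis using measure_PiM_marginal[OF P I S] unfolding tilted_def by simp
  qed
  have "tilted A \<tau> \<theta> u = tilted A \<tau> \<theta>' u" unfolding tilted_def using eq by (intro PiM_cong) auto
  moreover have "sqerr A \<tau> \<theta> u = sqerr A \<tau> \<theta>' u" unfolding sqerr_def using eq by (auto intro!: sum.cong)
  ultimately show ?thesis unfolding *[OF t(1,2)] *[OF t(3,4)] by simp
qed

text \<open>By \<open>ln (1 / x) \<le> 1 / x - 1\<close> the left side is at most
  \<open>(x - 1)^2 / x\<close>. With \<open>x\<close> the ratio of the modified to the original
  level, this is the second order cost per band mode.\<close>

lemma ln_ge_quadratic:
  fixes x :: real
  assumes "x \<ge> 1/2"
  shows "x - 1 - ln x \<le> 2 * (x - 1)^2"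
proof -
  have "ln (1 / x) \<le> 1 / x - 1" using assms by (intro ln_le_minus_one) auto
  then have "x - 1 - ln x \<le> x - 2 + 1 / x" using assms by (simp add: ln_div)
  also have "\<dots> = (x - 1)^2 / x" using assms by (simp add: field_simps power2_eq_square)
  also have "\<dots> \<le> (x - 1)^2 / (1/2)" using assms by (intro divide_left_mono) auto
  finally show ?thesis by simp
qed

text \<open>Pigeonhole: \<open>J\<close> windows of width \<open>e\<close> cover an interval of
  length \<open>2 * L\<close> that carries half of the mass.\<close>

lemma exists_large_window:
  fixes f :: "'a \<Rightarrow> real"
  assumes "prob_space \<nu>" and f: "f \<in> borel_measurable \<nu>" and e: "e > 0" and J: "real J * e > 2 * L" "L \<ge> 0"
    and half: "1/2 \<le> measure \<nu> {x \<in> space \<nu>. \<bar>f x - c\<bar> \<le> L}"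
  shows "\<exists>j<J. 1 / (2 * real J) \<le> measure \<nu> {x \<in> space \<nu>. f x \<in> {c - L + real j * e .. c - L + (real j + 1) * e}}"
proof (rule ccontr)
  interpret prob_space \<nu> by fact
  let ?w = "\<lambda>j. {x \<in> space \<nu>. f x \<in> {c - L + real j * e .. c - L + (real j + 1) * e}}"
  assume "\<not> ?thesis"
  then have small: "measure \<nu> (?w j) < 1 / (2 * real J)" if "j < J" for j using that by (auto simp: not_le)
  have J0: "J > 0" using J e by (cases J) auto
  have wm: "?w j \<in> sets \<nu>" for j using f by measurable
  have "{x \<in> space \<nu>. \<bar>f x - c\<bar> \<le> L} \<subseteq> (\<Union>j<J. ?w j)"
  proof
    fix x assume x: "x \<in> {x \<in> space \<nu>. \<bar>f x - c\<bar> \<le> L}"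
    define y where "y = (f x - (c - L)) / e"
    have y: "0 \<le> y" "y < real J" using x e J by (auto simp: y_def divide_less_eq)
    define j where "j = nat \<lfloor>y\<rfloor>"
    have j: "real j \<le> y" "y \<le> real j + 1" using y by (auto simp: j_def) 
    then have "j < J" using y by linarith
    moreover have "f x = c - L + y * e" using e by (simp add: y_def)
    then have "x \<in> ?w j" using x j e by (simp add: mult_right_mono)
    ultimately show "x \<in> (\<Union>j<J. ?w j)" by blast
  qed
  then have "measure \<nu> {x \<in> space \<nu>. \<bar>f x - c\<bar> \<le> L} \<le> measure \<nu> (\<Union>j<J. ?w j)"
    using wm by (intro finite_measure_mono) auto
  also have "\<dots> \<le> (\<Sum>j<J. measure \<nu> (?w j))" using wm by (intro measure_UNION_le) auto
  also have "\<dots> < (\<Sum>j<J. 1 / (2 * real J))" using small J0 by (intro sum_strict_mono) auto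
  also have "\<dots> = 1/2" using J0 by simp
  finally show False using half by simp
qed

text \<open>Every mode outside \<open>B\<close> can be charged for its error at the common slope
  \<open>1 / (2 * \<theta>)\<close>. This includes inactive modes: for
  \<open>th k = \<tau> k\<close> the codeword is zero, the left side vanishes, and
  \<open>th0 k / \<theta> * (z k)^2 / 2\<close> cancels the error term.\<close>

lemma tilt_exponent_eq:
  fixes \<tau> z x :: "'i \<Rightarrow> real"
  assumes I: "finite I" and B: "B \<subseteq> I" and t: "\<theta> > 0" "\<theta>' > 0" and T: "\<And>k. 0 < \<tau> k" "\<And>k. k \<in> B \<Longrightarrow> \<theta> \<le> \<tau> k"
  defines "th0 \<equiv> \<lambda>k. min \<theta> (\<tau> k)" and "u \<equiv> \<lambda>k. sqrt (\<tau> k) * z k"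
  defines "th \<equiv> \<lambda>k. if k \<in> B then \<theta>' else th0 k"
  shows "(\<Sum>k\<in>I. (1/2) * ln (\<tau> k / th k) + (u k)^2 / (2 * \<tau> k) - (u k - sqrt (\<tau> k - th k) * x k)^2 / (2 * th k))
    = (\<Sum>k\<in>I. (1/2) * ln (\<tau> k / th0 k)) + (\<Sum>k\<in>I. th0 k / \<theta> * (z k)^2 / 2) + real (card B) / 2 * ln (\<theta> / \<theta>')
      - sqerr (I - B) \<tau> th u x / (2 * \<theta>) - sqerr B \<tau> th u x / (2 * \<theta>')"
proof -
  have uz: "(u k)^2 = \<tau> k * (z k)^2" for k using T(1)[of k] by (simp add: u_def power_mult_distrib)
  have A: "(1/2) * ln (\<tau> k / th k) + (u k)^2 / (2 * \<tau> k) - (u k - sqrt (\<tau> k - th k) * x k)^2 / (2 * th k)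
    = (1/2) * ln (\<tau> k / th0 k) + th0 k / \<theta> * (z k)^2 / 2 - (u k - sqrt (\<tau> k - th k) * x k)^2 / (2 * \<theta>)" if "k \<in> I - B" for k
  proof (cases "\<theta> \<le> \<tau> k")
    case True
    then show ?thesis using that T(1)[of k] t by (simp add: th_def th0_def uz min_absorb1)
  next
    case False
    then show ?thesis using that T(1)[of k] t by (simp add: th_def th0_def uz min_absorb2)
  qed
  have Bq: "(1/2) * ln (\<tau> k / th k) + (u k)^2 / (2 * \<tau> k) - (u k - sqrt (\<tau> k - th k) * x k)^2 / (2 * th k)
    = (1/2) * ln (\<tau> k / th0 k) + th0 k / \<theta> * (z k)^2 / 2 + ln (\<theta> / \<theta>') / 2 - (u k - sqrt (\<tau> k - th k) * x k)^2 / (2 * \<theta>')" if "k \<in> B" for k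
  proof -
    have "ln (\<tau> k / \<theta>') = ln (\<tau> k / \<theta>) + ln (\<theta> / \<theta>')"
      using T(1)[of k] t by (simp add: ln_div)
    then show ?thesis using that T[of k] t by (simp add: th_def th0_def uz min_absorb1)
  qed
  have split: "(\<Sum>k\<in>I. f k) = (\<Sum>k\<in>I - B. f k) + (\<Sum>k\<in>B. f k)" for f :: "'i \<Rightarrow> real"
    using sum.subset_diff[OF B I] by simp
  have "(\<Sum>k\<in>I. (1/2) * ln (\<tau> k / th k) + (u k)^2 / (2 * \<tau> k) - (u k - sqrt (\<tau> k - th k) * x k)^2 / (2 * th k))
    = (\<Sum>k\<in>I - B. (1/2) * ln (\<tau> k / th0 k) + th0 k / \<theta> * (z k)^2 / 2 - (u k - sqrt (\<tau> k - th k) * x k)^2 / (2 * \<theta>))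
    + (\<Sum>k\<in>B. (1/2) * ln (\<tau> k / th0 k) + th0 k / \<theta> * (z k)^2 / 2 + ln (\<theta> / \<theta>') / 2 - (u k - sqrt (\<tau> k - th k) * x k)^2 / (2 * \<theta>'))"
    unfolding split[of "\<lambda>k. (1/2) * ln (\<tau> k / th k) + (u k)^2 / (2 * \<tau> k) - (u k - sqrt (\<tau> k - th k) * x k)^2 / (2 * th k)"]
    using A Bq by (intro arg_cong2[where f="(+)"] sum.cong refl)
  also have "\<dots> = (\<Sum>k\<in>I. (1/2) * ln (\<tau> k / th0 k)) + (\<Sum>k\<in>I. th0 k / \<theta> * (z k)^2 / 2) + real (card B) / 2 * ln (\<theta> / \<theta>')
      - sqerr (I - B) \<tau> th u x / (2 * \<theta>) - sqerr B \<tau> th u x / (2 * \<theta>')"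
    unfolding split[of "\<lambda>k. (1/2) * ln (\<tau> k / th0 k)"] split[of "\<lambda>k. th0 k / \<theta> * (z k)^2 / 2"] sqerr_def sum_divide_distrib
    by (simp add: sum.distrib sum_subtractf)
  finally show ?thesis .
qed

text \<open>Under the test channel the distortion has standard deviation of order \<open>sqrt n\<close>, too large to be
  controlled directly, since a deficit \<open>t\<close> costs a factor \<open>exp (- t / (2\<theta>))\<close>. So the distortion on \<open>I - B\<close>
  is pinned to the most likely window (number \<open>j\<close>) of width \<open>\<delta> sqrt n\<close>, and a small band \<open>B\<close> of active
  modes gets the modified water level \<open>\<theta>' j\<close> that brings the total distortion to \<open>D\<close>. As
  \<open>\<theta>' j - \<theta> = O(1 / sqrt n)\<close>, the first order effects cancel and only a bounded cost remains.\<close>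

lemma typical_ball_probability:
  fixes \<tau> z :: "'i \<Rightarrow> real"
  assumes I: "finite I" and B: "B \<subseteq> I" and \<theta>: "\<theta> > 0" and \<delta>: "\<delta> > 0" and \<rho>: "\<rho> > 0" and T: "\<And>k. 0 < \<tau> k"
    and TB: "\<And>k. k \<in> B \<Longrightarrow> \<theta> + \<rho> \<le> \<tau> k"
    and sq: "sq \<ge> 1" "real (card I) \<le> sq^2"
  defines "th0 \<equiv> \<lambda>k. min \<theta> (\<tau> k)" and "u \<equiv> \<lambda>k. sqrt (\<tau> k) * z k" and "m \<equiv> real (card B)"
  assumes D: "\<bar>D - (\<Sum>k\<in>I. th0 k)\<bar> \<le> C0"
    and G1: "\<bar>\<Sum>k\<in>I - B. (th0 k)^2 / (\<tau> k * \<theta>) * ((z k)^2 - 1)\<bar> \<le> K1 * sq"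
    and G2: "\<bar>\<Sum>k\<in>B. \<theta> / \<tau> k * ((z k)^2 - 1)\<bar> \<le> \<delta> / (8 * \<theta>) * sq"
    and G3: "(\<Sum>k\<in>I. (z k)^2) \<le> 2 * sq^2"
    and G4: "(\<Sum>k\<in>B. (z k)^2) \<le> 2 * m"
    and K: "K = (5 + K1) * \<theta>" "K1 \<ge> 0"
    and J: "real J * \<delta> > 2 * K" and K4: "K4 = C0 + K + (real J + 1) * \<delta>"
    and m: "m > 0" "640 * \<theta>^2 * real J * m \<le> \<delta>^2 * sq^2" "K4 * sq \<le> m * min (\<theta>/2) \<rho>"
  defines "\<theta>' \<equiv> \<lambda>j. (D - ((\<Sum>k\<in>I - B. th0 k) - K * sq + (real j + 1) * (\<delta> * sq)) - \<delta> * sq) / m"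
  defines "th \<equiv> \<lambda>j k. if k \<in> B then \<theta>' j else th0 k"
    and "\<gamma> \<equiv> PiM I (\<lambda>_. density lborel (normal_density 0 1))"
  shows "\<exists>j<J. (\<forall>k. 0 < th j k \<and> th j k \<le> \<tau> k) \<and>
    1 / (4 * real J) * exp (- ((\<Sum>k\<in>I. (1/2) * ln (\<tau> k / th0 k)) + (\<Sum>k\<in>I. th0 k / \<theta> * ((z k)^2 - 1) / 2)
        + C0 / (2 * \<theta>) + K4^2 * sq^2 / (m * \<theta>^2) + 2 * (\<delta> * sq) / \<theta>))
      \<le> measure \<gamma> {x \<in> space \<gamma>. sqerr I \<tau> (th j) u x \<le> D}"
proof -
  let ?A = "I - B"
  define e where "e = \<delta> * sq"
  have e: "e > 0" using \<delta> sq by (simp add: e_def)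
  have K0: "K > 0" using K \<theta> by simp
  have C0: "C0 \<ge> 0" using D by linarith
  have J0: "J > 0" using J K0 \<delta> by (cases J) auto
  have K40: "K4 > 0" using K4 C0 K0 \<delta> by (simp add: add_nonneg_pos add_pos_nonneg)
  have fA: "finite ?A" "finite B" using I B finite_subset by auto
  have th0: "0 < th0 k" "th0 k \<le> \<tau> k" "th0 k \<le> \<theta>" for k using \<theta> T[of k] by (auto simp: th0_def)
  have th0B: "th0 k = \<theta>" if "k \<in> B" for k using TB[OF that] \<rho> by (simp add: th0_def)
  \<comment> \<open>\<open>w j\<close> is the upper end of window \<open>j\<close>. The level
    \<open>\<theta>' j\<close> is defined such that \<open>w j\<close>, the nominal band distortion
    \<open>m * \<theta>' j\<close> and a slack \<open>e\<close> add up to exactly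
    \<open>D\<close>.\<close>
  define w where "w j = (\<Sum>k\<in>?A. th0 k) - K * sq + (real j + 1) * e" for j
  have m\<theta>': "m * \<theta>' j = D - w j - e" for j using m by (simp add: \<theta>'_def w_def e_def)
  have sumI: "(\<Sum>k\<in>I. th0 k) = (\<Sum>k\<in>?A. th0 k) + m * \<theta>"
    using sum.subset_diff[OF B I, of th0] th0B by (simp add: m_def)
  have dev: "\<bar>m * \<theta>' j - m * \<theta>\<bar> \<le> K4 * sq" if j: "j < J" for j
  proof -
    have eq: "m * \<theta>' j - m * \<theta> = (D - (\<Sum>k\<in>I. th0 k)) + K * sq - (real j + 2) * e"
      unfolding m\<theta>' w_def sumI by (simp add: algebra_simps)
    have "(real j + 2) * e \<le> (real J + 1) * e" using j e by (intro mult_right_mono) auto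
    moreover have "0 \<le> (real j + 2) * e" "0 \<le> (real J + 1) * e" using e by auto
    moreover have "C0 \<le> C0 * sq" using C0 sq by (simp add: mult_le_cancel_left1)
    moreover have "0 \<le> K * sq" using K0 sq by simp
    moreover have "K4 * sq = C0 * sq + K * sq + (real J + 1) * e" unfolding K4 e_def by (simp add: algebra_simps)
    ultimately show ?thesis unfolding eq using D by (simp only: abs_le_iff) linarith
  qed
  have \<theta>'b: "\<theta> / 2 \<le> \<theta>' j" "\<theta>' j \<le> \<theta> + \<rho>" "\<theta>' j \<le> 2 * \<theta>" "0 < \<theta>' j" if j: "j < J" for j
  proof -
    have "m * \<bar>\<theta>' j - \<theta>\<bar> = \<bar>m * \<theta>' j - m * \<theta>\<bar>" using m(1) by (simp add: abs_mult right_diff_distrib[symmetric])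
    also have "\<dots> \<le> m * min (\<theta>/2) \<rho>" using dev[OF j] m(3) by linarith
    finally have "\<bar>\<theta>' j - \<theta>\<bar> \<le> min (\<theta>/2) \<rho>" using m(1) by simp
    then have "\<bar>\<theta>' j - \<theta>\<bar> \<le> \<theta> / 2" "\<bar>\<theta>' j - \<theta>\<bar> \<le> \<rho>" by simp_all
    then show "\<theta> / 2 \<le> \<theta>' j" "\<theta>' j \<le> \<theta> + \<rho>" "\<theta>' j \<le> 2 * \<theta>" "0 < \<theta>' j" using \<theta> by linarith+
  qed
  have th: "0 < th j k" "th j k \<le> \<tau> k" if "j < J" for j k
    using \<theta>'b[OF that] th0[of k] TB[of k] by (auto simp: th_def)
  define N where "N = tilted I \<tau> th0 u"
  interpret N: prob_space N unfolding N_def by (rule prob_space_tilted[OF th0(1,2)])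
  define EA where "EA = (\<Sum>k\<in>?A. th0 k + (th0 k)^2 / \<tau> k * ((z k)^2 - 1))"
  have EA: "\<bar>EA - (\<Sum>k\<in>?A. th0 k)\<bar> \<le> \<theta> * (K1 * sq)"
  proof -
    have "EA - (\<Sum>k\<in>?A. th0 k) = \<theta> * (\<Sum>k\<in>?A. (th0 k)^2 / (\<tau> k * \<theta>) * ((z k)^2 - 1))"
      unfolding EA_def sum.distrib sum_distrib_left using \<theta> by simp
    then show ?thesis using G1 \<theta> by (simp add: abs_mult)
  qed
  \<comment> \<open>The variance is at most \<open>10 * \<theta>^2 * sq^2\<close>, so five units of
    \<open>\<theta> * sq\<close> leave probability at most 10/25.\<close>
  have NA: "measure N {x \<in> space N. \<bar>sqerr ?A \<tau> th0 u x - EA\<bar> \<ge> 5 * \<theta> * sq} \<le> 1/2"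
  proof -
    have "measure N {x \<in> space N. \<bar>sqerr ?A \<tau> th0 u x - EA\<bar> \<ge> 5 * \<theta> * sq}
      \<le> (\<Sum>k\<in>?A. 4 * \<theta>^2 * (z k)^2 + 2 * \<theta>^2) / (5 * \<theta> * sq)^2"
      unfolding N_def EA_def u_def using \<theta> sq th0 by (intro tilted_Chebyshev I) auto
    also have "(\<Sum>k\<in>?A. 4 * \<theta>^2 * (z k)^2 + 2 * \<theta>^2) \<le> (\<Sum>k\<in>I. 4 * \<theta>^2 * (z k)^2 + 2 * \<theta>^2)"
      by (intro sum_mono2 I) auto
    also have "\<dots> = 4 * \<theta>^2 * (\<Sum>k\<in>I. (z k)^2) + 2 * \<theta>^2 * real (card I)"
      by (simp add: sum.distrib sum_distrib_left)
    also have "\<dots> \<le> 4 * \<theta>^2 * (2 * sq^2) + 2 * \<theta>^2 * sq^2"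
      using G3 sq by (intro add_mono mult_left_mono) auto
    also have "(4 * \<theta>^2 * (2 * sq^2) + 2 * \<theta>^2 * sq^2) / (5 * \<theta> * sq)^2 = 10 / 25"
      using \<theta> sq by (simp add: power_mult_distrib field_simps)
    finally show ?thesis by (simp add: divide_right_mono)
  qed
  have sm: "sqerr S \<tau> th0 u \<in> borel_measurable N" if "S \<subseteq> I" for S
    unfolding N_def by (rule measurable_sqerr[OF that sets_tilted])
  have half: "1/2 \<le> measure N {x \<in> space N. \<bar>sqerr ?A \<tau> th0 u x - (\<Sum>k\<in>?A. th0 k)\<bar> \<le> K * sq}"
  proof -
    let ?b = "{x \<in> space N. \<bar>sqerr ?A \<tau> th0 u x - EA\<bar> \<ge> 5 * \<theta> * sq}"
    have smA: "sqerr ?A \<tau> th0 u \<in> borel_measurable N" by (rule sm) auto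
    have bm: "?b \<in> sets N" using smA by measurable
    have "1/2 \<le> measure N (space N - ?b)" using N.prob_compl[OF bm] NA by simp
    also have "\<dots> \<le> measure N {x \<in> space N. \<bar>sqerr ?A \<tau> th0 u x - (\<Sum>k\<in>?A. th0 k)\<bar> \<le> K * sq}"
    proof (rule N.finite_measure_mono)
      \<comment> \<open>The two parts of \<open>K\<close>: five units for the test channel, and
        \<open>K1\<close> for the source-dependent shift of the conditional mean.\<close>
      have Ks: "K * sq = 5 * \<theta> * sq + \<theta> * (K1 * sq)" unfolding K by (simp add: algebra_simps)
      show "space N - ?b \<subseteq> {x \<in> space N. \<bar>sqerr ?A \<tau> th0 u x - (\<Sum>k\<in>?A. th0 k)\<bar> \<le> K * sq}"
        unfolding Ks using EA by (auto simp: not_le)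
      show "{x \<in> space N. \<bar>sqerr ?A \<tau> th0 u x - (\<Sum>k\<in>?A. th0 k)\<bar> \<le> K * sq} \<in> sets N" using smA by measurable
    qed
    finally show ?thesis .
  qed
  have "real J * e > 2 * (K * sq)" using J sq unfolding e_def by (simp add: mult.assoc[symmetric])
  then obtain j where j: "j < J" and win: "1 / (2 * real J) \<le> measure N {x \<in> space N. sqerr ?A \<tau> th0 u x \<in> {(\<Sum>k\<in>?A. th0 k) - K * sq + real j * e .. (\<Sum>k\<in>?A. th0 k) - K * sq + (real j + 1) * e}}"
    using exists_large_window[OF N.prob_space_axioms sm _ _ _ half] e K0 sq by auto
  define W where "W = {w j - e .. w j}"
  have W: "{(\<Sum>k\<in>?A. th0 k) - K * sq + real j * e .. (\<Sum>k\<in>?A. th0 k) - K * sq + (real j + 1) * e} = W"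
    by (simp add: W_def w_def algebra_simps)
  define V where "V = tilted I \<tau> (th j) u"
  interpret V: prob_space V unfolding V_def by (rule prob_space_tilted[OF th[OF j]])
  have smV: "sqerr S \<tau> (th j) u \<in> borel_measurable V" if "S \<subseteq> I" for S
    unfolding V_def by (rule measurable_sqerr[OF that sets_tilted])
  have winV: "1 / (2 * real J) \<le> measure V {x \<in> space V. sqerr ?A \<tau> (th j) u x \<in> W}"
    using win unfolding W V_def N_def
    by (subst tilted_marginal[OF I _ th[OF j] th0(1,2)]) (auto simp: th_def W_def)
  define EB where "EB = (\<Sum>k\<in>B. th j k + (th j k)^2 / \<tau> k * ((z k)^2 - 1))"
  have EB: "\<bar>EB - m * \<theta>' j\<bar> \<le> e / 2"
  proof -
    have "EB - m * \<theta>' j = (\<theta>' j)^2 / \<theta> * (\<Sum>k\<in>B. \<theta> / \<tau> k * ((z k)^2 - 1))"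
      unfolding EB_def sum.distrib sum_distrib_left m_def using \<theta> by (simp add: th_def)
    then have "\<bar>EB - m * \<theta>' j\<bar> = (\<theta>' j)^2 / \<theta> * \<bar>\<Sum>k\<in>B. \<theta> / \<tau> k * ((z k)^2 - 1)\<bar>" using \<theta> by (simp add: abs_mult)
    also have "\<dots> \<le> (2 * \<theta>)^2 / \<theta> * (\<delta> / (8 * \<theta>) * sq)"
      using G2 \<theta> \<theta>'b[OF j] by (intro mult_mono divide_right_mono power_mono) auto
    also have "\<dots> = e / 2" using \<theta> by (simp add: e_def power2_eq_square)
    finally show ?thesis .
  qed
  \<comment> \<open>The variance on the band is at most \<open>40 * \<theta>^2 * m\<close>. The
    constant 640 makes the Chebyshev bound half of the window probability
    \<open>1 / (2 * real J)\<close>, so the other half survives.\<close>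
  have VB: "measure V {x \<in> space V. \<bar>sqerr B \<tau> (th j) u x - EB\<bar> \<ge> e / 2} \<le> 1 / (4 * real J)"
  proof -
    have "measure V {x \<in> space V. \<bar>sqerr B \<tau> (th j) u x - EB\<bar> \<ge> e / 2}
      \<le> (\<Sum>k\<in>B. 4 * (2 * \<theta>)^2 * (z k)^2 + 2 * (2 * \<theta>)^2) / (e / 2)^2"
      unfolding V_def EB_def u_def using e th[OF j] \<theta>'b[OF j] B by (intro tilted_Chebyshev I) (auto simp: th_def)
    also have "(\<Sum>k\<in>B. 4 * (2 * \<theta>)^2 * (z k)^2 + 2 * (2 * \<theta>)^2) = 4 * (2 * \<theta>)^2 * (\<Sum>k\<in>B. (z k)^2) + 2 * (2 * \<theta>)^2 * m"
      by (simp add: sum.distrib sum_distrib_left m_def)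
    also have "\<dots> \<le> 4 * (2 * \<theta>)^2 * (2 * m) + 2 * (2 * \<theta>)^2 * m"
      using G4 by (intro add_right_mono mult_left_mono) auto
    also have "\<dots> = 40 * \<theta>^2 * m" by (simp add: power2_eq_square)
    also have "40 * \<theta>^2 * m / (e / 2)^2 \<le> 1 / (4 * real J)"
    proof -
      have "40 * \<theta>^2 * m / (e / 2)^2 = 160 * \<theta>^2 * m / e^2" by (simp add: power_divide)
      moreover have "640 * \<theta>^2 * real J * m \<le> e^2" using m(2) unfolding e_def by (simp add: power_mult_distrib)
      ultimately show ?thesis using e J0 by (simp add: field_simps)
    qed
    finally show ?thesis by (simp add: divide_right_mono)
  qed
  define S where "S = {x \<in> space \<gamma>. sqerr ?A \<tau> (th j) u x \<in> W \<and> \<bar>sqerr B \<tau> (th j) u x - EB\<bar> < e / 2}"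
  have sg: "sets \<gamma> = sets (PiM I (\<lambda>_. borel))" unfolding \<gamma>_def by (intro sets_PiM_cong) auto
  interpret G: prob_space \<gamma> unfolding \<gamma>_def by (rule prob_space_PiM_normal) simp
  have smG: "sqerr S \<tau> (th j) u \<in> borel_measurable \<gamma>" if "S \<subseteq> I" for S
    by (rule measurable_sqerr[OF that sg])
  have sGV: "sets \<gamma> = sets V" unfolding sg V_def sets_tilted ..
  have SA: "{x \<in> space V. sqerr ?A \<tau> (th j) u x \<in> W} \<in> sets V"
    using smV[of ?A] unfolding W_def by measurable
  have SB: "{x \<in> space V. \<bar>sqerr B \<tau> (th j) u x - EB\<bar> \<ge> e / 2} \<in> sets V"
    using smV[OF B] by measurable
  have Seq: "S = {x \<in> space V. sqerr ?A \<tau> (th j) u x \<in> W} - {x \<in> space V. \<bar>sqerr B \<tau> (th j) u x - EB\<bar> \<ge> e / 2}"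
    unfolding S_def sets_eq_imp_space_eq[OF sGV] by auto
  have Sm: "S \<in> sets \<gamma>" unfolding sGV Seq using SA SB by auto
  have "1 / (2 * real J) - 1 / (4 * real J) \<le> measure V S"
  proof -
    have "measure V {x \<in> space V. sqerr ?A \<tau> (th j) u x \<in> W} \<le> measure V (S \<union> {x \<in> space V. \<bar>sqerr B \<tau> (th j) u x - EB\<bar> \<ge> e / 2})"
      unfolding Seq using SA SB by (intro V.finite_measure_mono) auto
    also have "\<dots> \<le> measure V S + measure V {x \<in> space V. \<bar>sqerr B \<tau> (th j) u x - EB\<bar> \<ge> e / 2}"
      using Sm SB sGV by (intro measure_Un_le) auto
    finally show ?thesis using winV VB by linarith
  qed
  then have PS: "1 / (4 * real J) \<le> measure V S" by (simp add: field_simps)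
  define C where "C = (\<Sum>k\<in>I. (1/2) * ln (\<tau> k / th0 k)) + (\<Sum>k\<in>I. th0 k / \<theta> * ((z k)^2 - 1) / 2)
        + C0 / (2 * \<theta>) + K4^2 * sq^2 / (m * \<theta>^2) + 2 * (\<delta> * sq) / \<theta>"
  have errs: "w j - e \<le> sqerr ?A \<tau> (th j) u x" "sqerr ?A \<tau> (th j) u x \<le> w j" "m * \<theta>' j - e \<le> sqerr B \<tau> (th j) u x" "sqerr B \<tau> (th j) u x \<le> m * \<theta>' j + e"
    if "x \<in> S" for x
  proof -
    have "\<bar>sqerr B \<tau> (th j) u x - EB\<bar> < e / 2" "sqerr ?A \<tau> (th j) u x \<in> W" using that by (auto simp: S_def)
    then show "w j - e \<le> sqerr ?A \<tau> (th j) u x" "sqerr ?A \<tau> (th j) u x \<le> w j" "m * \<theta>' j - e \<le> sqerr B \<tau> (th j) u x" "sqerr B \<tau> (th j) u x \<le> m * \<theta>' j + e"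
      using EB unfolding W_def abs_less_iff abs_le_iff atLeastAtMost_iff by linarith+
  qed
  have exponent: "(\<Sum>k\<in>I. (1/2) * ln (\<tau> k / th j k) + (u k)^2 / (2 * \<tau> k) - (u k - sqrt (\<tau> k - th j k) * x k)^2 / (2 * th j k)) \<le> C"
    if x: "x \<in> S" for x
  proof -
    define y where "y = \<theta>' j / \<theta>"
    have y: "y \<ge> 1/2" "y > 0" using \<theta>'b[OF j] \<theta> by (auto simp: y_def field_simps)
    have eq: "(\<Sum>k\<in>I. (1/2) * ln (\<tau> k / th j k) + (u k)^2 / (2 * \<tau> k) - (u k - sqrt (\<tau> k - th j k) * x k)^2 / (2 * th j k))
      = (\<Sum>k\<in>I. (1/2) * ln (\<tau> k / th0 k)) + (\<Sum>k\<in>I. th0 k / \<theta> * (z k)^2 / 2) + m / 2 * ln (\<theta> / \<theta>' j)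
      - sqerr ?A \<tau> (th j) u x / (2 * \<theta>) - sqerr B \<tau> (th j) u x / (2 * \<theta>' j)"
    proof -
      have TB': "\<theta> \<le> \<tau> k" if "k \<in> B" for k using TB[OF that] \<rho> by linarith
      show ?thesis
        unfolding th_def th0_def u_def m_def by (rule tilt_exponent_eq[OF I B \<theta> \<theta>'b(4)[OF j] T TB'])
    qed
    have 1: "(\<Sum>k\<in>I. th0 k / \<theta> * (z k)^2 / 2) = (\<Sum>k\<in>I. th0 k / \<theta> * ((z k)^2 - 1) / 2) + (\<Sum>k\<in>I. th0 k) / (2 * \<theta>)"
      unfolding sum_divide_distrib sum.distrib[symmetric] by (intro sum.cong refl) (simp add: field_simps diff_divide_distrib)
    have 2: "- (sqerr ?A \<tau> (th j) u x / (2 * \<theta>)) \<le> - ((D - m * \<theta>' j - 2 * e) / (2 * \<theta>))"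
      using errs(1)[OF x] \<theta> unfolding m\<theta>' by (simp add: divide_right_mono)
    have 3: "- (sqerr B \<tau> (th j) u x / (2 * \<theta>' j)) \<le> - m / 2 + e / \<theta>"
    proof -
      have "(m * \<theta>' j - e) / (2 * \<theta>' j) \<le> sqerr B \<tau> (th j) u x / (2 * \<theta>' j)"
        using errs(3)[OF x] \<theta>'b[OF j] by (intro divide_right_mono) auto
      moreover have "(m * \<theta>' j - e) / (2 * \<theta>' j) = m / 2 - e / (2 * \<theta>' j)" using \<theta>'b[OF j] by (simp add: diff_divide_distrib)
      moreover have "e / (2 * \<theta>' j) \<le> e / \<theta>" using \<theta>'b[OF j] \<theta> e by (intro divide_left_mono) auto
      ultimately show ?thesis by simp
    qed
    have "ln (\<theta> / \<theta>' j) = - ln y" using \<theta> \<theta>'b(4)[OF j] by (simp add: y_def ln_div)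
    then have 4: "m / 2 * ln (\<theta> / \<theta>' j) = - (m / 2 * ln y)" by simp
    \<comment> \<open>Changing the level on the band contributes \<open>m / 2 * y\<close> through
      the distortion left to the band, \<open>- m / 2\<close> through its own error, and
      \<open>- m / 2 * ln y\<close> through its rate. The linear parts cancel at
      \<open>y = 1\<close>.\<close>
    have 5: "m / 2 * (y - 1 - ln y) \<le> K4^2 * sq^2 / (m * \<theta>^2)"
    proof -
      have "m / 2 * (y - 1 - ln y) \<le> m / 2 * (2 * (y - 1)^2)"
        using m(1) by (intro mult_left_mono ln_ge_quadratic y) auto
      also have "\<dots> = (m * \<theta>' j - m * \<theta>)^2 / (m * \<theta>^2)"
        using m(1) \<theta> unfolding y_def by (simp add: field_simps power2_eq_square)
      also have "(m * \<theta>' j - m * \<theta>)^2 \<le> (K4 * sq)^2"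
        using dev[OF j] K40 sq by (subst abs_le_square_iff[symmetric]) auto
      finally show ?thesis using m(1) \<theta> by (simp add: power_mult_distrib divide_right_mono)
    qed
    have 6: "m * \<theta>' j / (2 * \<theta>) = m / 2 * y" by (simp add: y_def)
    have 7: "(\<Sum>k\<in>I. th0 k) / (2 * \<theta>) - D / (2 * \<theta>) \<le> C0 / (2 * \<theta>)"
      using D \<theta> by (simp add: diff_divide_distrib[symmetric] divide_right_mono abs_le_iff)
    have 8: "- ((D - m * \<theta>' j - 2 * e) / (2 * \<theta>)) = - (D / (2 * \<theta>)) + m / 2 * y + e / \<theta>"
      unfolding 6[symmetric] using \<theta> by (simp add: field_simps)
    have 9: "2 * (\<delta> * sq) / \<theta> = e / \<theta> + e / \<theta>" by (simp add: e_def)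
    have 10: "m / 2 * (y - 1 - ln y) = m / 2 * y - m / 2 - m / 2 * ln y" by (simp add: algebra_simps)
    show ?thesis unfolding eq C_def using 1 2 3 4 5 7 8 9 10 by linarith
  qed
  have "exp (- C) * measure V S \<le> measure \<gamma> S"
    unfolding V_def tilted_def \<gamma>_def
    by (rule measure_change_lower_bound[OF I th[OF j] Sm[unfolded \<gamma>_def] exponent])
  moreover have "measure \<gamma> S \<le> measure \<gamma> {x \<in> space \<gamma>. sqerr I \<tau> (th j) u x \<le> D}"
  proof (rule G.finite_measure_mono)
    show "S \<subseteq> {x \<in> space \<gamma>. sqerr I \<tau> (th j) u x \<le> D}"
    proof
      fix x assume x: "x \<in> S"
      have "sqerr I \<tau> (th j) u x = sqerr ?A \<tau> (th j) u x + sqerr B \<tau> (th j) u x"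
        unfolding sqerr_def by (rule sum.subset_diff[OF B I])
      also have "\<dots> \<le> D" using errs(2,4)[OF x] m\<theta>'[of j] by linarith
      finally show "x \<in> {x \<in> space \<gamma>. sqerr I \<tau> (th j) u x \<le> D}" using x by (simp add: S_def)
    qed
    show "{x \<in> space \<gamma>. sqerr I \<tau> (th j) u x \<le> D} \<in> sets \<gamma>" using smG[OF order_refl] by measurable
  qed
  moreover have "exp (- C) * (1 / (4 * real J)) \<le> exp (- C) * measure V S" using PS by (intro mult_left_mono) auto
  ultimately have "1 / (4 * real J) * exp (- C) \<le> measure \<gamma> {x \<in> space \<gamma>. sqerr I \<tau> (th j) u x \<le> D}"
    by (simp only: mult.commute)
  then show ?thesis using j th[OF j] unfolding C_def by blast
qed

section \<open>From coverings to codes\<close>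

lemma measurable_Uvec:
  assumes "i < n"
  shows "(\<lambda>z. Uvec a z i) \<in> borel_measurable (Zmeas \<sigma> n)"
  unfolding Uvec_def using assms
  by (intro borel_measurable_sum borel_measurable_times borel_measurable_const measurable_Zmeas_component) auto

lemma measurable_distortion_Uvec:
  "(\<lambda>z. distortion n (Uvec a z) c) \<in> borel_measurable (Zmeas \<sigma> n)"
  unfolding distortion_def
  by (intro borel_measurable_sum borel_measurable_times borel_measurable_power borel_measurable_diff borel_measurable_const measurable_Uvec) auto

text \<open>The encoder chooses any codeword within distortion \<open>d\<close> and falls back to
  index 1, so it fails exactly when all codewords fail. Measurability of this event follows from
  finiteness of \<open>C\<close>, although the choice made by \<open>f\<close> is arbitrary.\<close>

lemma has_code_codebook:
  assumes C: "finite C" "C \<noteq> {}"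
    and P: "measure (Zmeas \<sigma> n) {z \<in> space (Zmeas \<sigma> n). \<forall>c\<in>C. distortion n (Uvec a z) c > d} \<le> \<epsilon>"
  shows "has_code a \<sigma> n (card C) d \<epsilon>"
proof -
  obtain g where g: "bij_betw g {1..card C} C" using ex_bij_betw_nat_finite_1[OF C(1)] by blast
  define f where "f x = (if \<exists>m\<in>{1..card C}. distortion n x (g m) \<le> d then SOME m. m \<in> {1..card C} \<and> distortion n x (g m) \<le> d else 1)" for x
  have c1: "card C \<ge> 1" using C by (simp add: Suc_le_eq card_gt_0_iff)
  have f: "f x \<in> {1..card C} \<and> (distortion n x (g (f x)) > d \<longleftrightarrow> (\<forall>m\<in>{1..card C}. distortion n x (g m) > d))" for x
  proof (cases "\<exists>m\<in>{1..card C}. distortion n x (g m) \<le> d")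
    case True
    then have "\<exists>m. m \<in> {1..card C} \<and> distortion n x (g m) \<le> d" by blast
    from someI_ex[OF this] have "f x \<in> {1..card C} \<and> distortion n x (g (f x)) \<le> d" using True by (simp add: f_def)
    then show ?thesis by force
  next
    case False
    then have "f x = 1" unfolding f_def by (rule if_not_P)
    then show ?thesis using False c1 by (auto simp: not_le)
  qed
  have img: "(\<forall>m\<in>{1..card C}. distortion n x (g m) > d) \<longleftrightarrow> (\<forall>c\<in>C. distortion n x c > d)" for x
  proof -
    have "(\<forall>m\<in>{1..card C}. distortion n x (g m) > d) \<longleftrightarrow> (\<forall>c\<in>g ` {1..card C}. distortion n x c > d)" by simp
    then show ?thesis unfolding bij_betw_imp_surj_on[OF g] .
  qed
  have E: "{z \<in> space (Zmeas \<sigma> n). distortion n (Uvec a z) (g (f (Uvec a z))) > d} = {z \<in> space (Zmeas \<sigma> n). \<forall>c\<in>C. distortion n (Uvec a z) c > d}"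
    using f img by auto
  have "{z \<in> space (Zmeas \<sigma> n). \<forall>c\<in>C. distortion n (Uvec a z) c > d} \<in> sets (Zmeas \<sigma> n)"
  proof (intro sets.sets_Collect_finite_All C)
    fix c show "{z \<in> space (Zmeas \<sigma> n). distortion n (Uvec a z) c > d} \<in> sets (Zmeas \<sigma> n)"
      using measurable_distortion_Uvec[of n a c \<sigma>] by measurable
  qed
  then show ?thesis unfolding has_code_def Let_def using f P E by (intro exI[of _ f] exI[of _ g]) simp
qed

lemma square_sum_weighted:
  fixes x y t :: real
  assumes "t > 0"
  shows "(x + y)^2 \<le> (1 + 1 / t) * x^2 + (1 + t) * y^2"
proof -
  have "0 \<le> (x - t * y)^2 / t" using assms by simp
  also have "\<dots> = x^2 / t - 2 * x * y + t * y^2" using assms by (simp add: field_simps power2_eq_square)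
  finally show ?thesis by (simp add: power2_eq_square algebra_simps)
qed

text \<open>Splitting the square with weight \<open>n\<close> multiplies the mode error by
  \<open>1 + 1 / n\<close> and the quantization error, in total at most \<open>1 / n\<close>, by
  \<open>1 + n\<close>. The first costs at most \<open>d\<close> and the second at most 2, whence
  the reserve \<open>d + 2\<close>.\<close>

lemma square_error_upper_bound:
  assumes a: "a > 1" and n: "n > 0" and d: "d > 0"
    and z: "\<And>i. i < n \<Longrightarrow> z i = (\<Sum>k<n. mode_basis a n i k * \<zeta> k)"
    and D: "(\<Sum>k=1..<n. (\<zeta> k / sqrt (gfun_grid a n k) - y k)^2) \<le> real n * d - (d + 2)"
    and q: "\<bar>last_scale a n * \<zeta> 0 - q\<bar> \<le> 1 / real n"
  shows "distortion n (Uvec a z) (\<lambda>i. (\<Sum>k=1..<n. sine_mode n k (Suc i) * y k) + last_coeff a n i * q) \<le> d"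
proof -
  define \<alpha> where "\<alpha> i = (\<Sum>k=1..<n. sine_mode n k (Suc i) * (\<zeta> k / sqrt (gfun_grid a n k) - y k))" for i
  define \<beta> where "\<beta> i = last_coeff a n i * (last_scale a n * \<zeta> 0 - q)" for i
  have U: "Uvec a z i - ((\<Sum>k=1..<n. sine_mode n k (Suc i) * y k) + last_coeff a n i * q) = \<alpha> i + \<beta> i" if "i < n" for i
  proof -
    have "Uvec a z i = (\<Sum>k=1..<n. sine_mode n k (Suc i) * (\<zeta> k / sqrt (gfun_grid a n k))) + last_coeff a n i * (last_scale a n * \<zeta> 0)"
      by (rule Uvec_mode_basis[OF a that z])
    then show ?thesis unfolding \<alpha>_def \<beta>_def right_diff_distrib sum_subtractf by linarith
  qed
  have A: "(\<Sum>i<n. (\<alpha> i)^2) \<le> real n * d - (d + 2)"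
    unfolding \<alpha>_def using D by (subst orthonormal_sum_square[OF _ sine_mode_orthonormal_Suc]) auto
  have b: "(\<beta> i)^2 \<le> (1 / real n)^2" if "i < n" for i
  proof -
    have "\<bar>\<beta> i\<bar> \<le> 1 * (1 / real n)" unfolding \<beta>_def abs_mult
      using last_coeff_bounds[OF a that] q by (intro mult_mono) auto
    then show ?thesis by (metis abs_ge_zero mult_1 power2_abs power_mono)
  qed
  have Bs: "(\<Sum>i<n. (\<beta> i)^2) \<le> 1 / real n"
  proof -
    have "(\<Sum>i<n. (\<beta> i)^2) \<le> (\<Sum>i<n. (1 / real n)^2)" using b by (intro sum_mono) auto
    also have "\<dots> = 1 / real n" using n by (simp add: power2_eq_square)
    finally show ?thesis .
  qed
  have "(\<Sum>i<n. (\<alpha> i + \<beta> i)^2) \<le> (\<Sum>i<n. (1 + 1 / real n) * (\<alpha> i)^2 + (1 + real n) * (\<beta> i)^2)"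
    using n by (intro sum_mono square_sum_weighted) auto
  also have "\<dots> = (1 + 1 / real n) * (\<Sum>i<n. (\<alpha> i)^2) + (1 + real n) * (\<Sum>i<n. (\<beta> i)^2)"
    by (simp add: sum.distrib sum_distrib_left)
  also have "\<dots> \<le> (1 + 1 / real n) * (real n * d - (d + 2)) + (1 + real n) * (1 / real n)"
    using A Bs by (intro add_mono mult_left_mono) auto
  also have "\<dots> = real n * d - 2 - (d + 2) / real n + 1 / real n + 1"
    using n by (simp add: field_simps)
  also have "\<dots> \<le> real n * d"
  proof -
    have "1 / real n \<le> (d + 2) / real n" using d by (intro divide_right_mono) auto
    then show ?thesis by simp
  qed
  finally have "(\<Sum>i<n. (\<alpha> i + \<beta> i)^2) \<le> real n * d" .
  moreover have "(\<Sum>i<n. (Uvec a z i - ((\<Sum>k=1..<n. sine_mode n k (Suc i) * y k) + last_coeff a n i * q))^2) = (\<Sum>i<n. (\<alpha> i + \<beta> i)^2)"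
    using U by (intro sum.cong) auto
  ultimately show ?thesis unfolding distortion_def using n by (simp add: field_simps)
qed

lemma exists_grid:
  assumes R: "R \<ge> 0" and n: "n > 0"
  shows "\<exists>Q :: real set. finite Q \<and> Q \<noteq> {} \<and> real (card Q) \<le> 2 * R * real n + 3 \<and> (\<forall>v. \<bar>v\<bar> \<le> R \<longrightarrow> (\<exists>q\<in>Q. \<bar>v - q\<bar> \<le> 1 / real n))"
proof -
  define L where "L = \<lceil>R * real n\<rceil>"
  have Rn: "0 \<le> R * real n" using R by simp
  have L: "0 \<le> L" "real_of_int L \<le> R * real n + 1" unfolding L_def using Rn by linarith+
  define Q where "Q = (\<lambda>j::int. real_of_int j / real n) ` {-L..L}"
  have "card Q \<le> nat (2 * L + 1)" unfolding Q_def using card_image_le[of "{-L..L}" "\<lambda>j::int. real_of_int j / real n"] by simp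
  then have "real (card Q) \<le> real (nat (2 * L + 1))" by (simp only: of_nat_le_iff)
  also have "\<dots> = 2 * real_of_int L + 1" using L by simp
  also have "\<dots> \<le> 2 * R * real n + 3" using L by simp
  finally have c: "real (card Q) \<le> 2 * R * real n + 3" .
  have "\<exists>q\<in>Q. \<bar>v - q\<bar> \<le> 1 / real n" if v: "\<bar>v\<bar> \<le> R" for v
  proof -
    define j where "j = \<lfloor>v * real n\<rfloor>"
    have "\<bar>v * real n\<bar> \<le> R * real n" using v n by (simp add: abs_mult mult_right_mono)
    then have "j \<in> {-L..L}" unfolding j_def L_def by (auto simp: le_floor_iff floor_le_iff) linarith+
    moreover have "\<bar>v - real_of_int j / real n\<bar> \<le> 1 / real n"
    proof -
      have "v - real_of_int j / real n = (v * real n - real_of_int j) / real n" using n by (simp add: field_simps)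
      moreover have "\<bar>v * real n - real_of_int j\<bar> \<le> 1" unfolding j_def by linarith
      ultimately show ?thesis using n by (simp add: divide_right_mono)
    qed
    ultimately show ?thesis unfolding Q_def by blast
  qed
  moreover have "finite Q" "Q \<noteq> {}" using L by (auto simp: Q_def)
  ultimately show ?thesis using c by blast
qed

text \<open>The window \<open>j\<close> provided by \<open>typical_ball_probability\<close> depends
  on the source vector, and with it the codeword scaling. So \<open>G\<close> is split by
  \<open>j\<close> and each part gets its own greedy codebook; having \<open>J\<close> of them costs
  a constant factor only. On \<open>G\<close> the tilted information is capped by \<open>x\<close>,
  which makes the covering probability \<open>p\<close> uniform.\<close>

lemma mode_codebook:
  fixes \<tau> :: "nat \<Rightarrow> real" and I B :: "nat set"
  assumes P: "prob_space P" and zm: "\<And>k. k \<in> I \<Longrightarrow> (\<lambda>\<zeta>. z \<zeta> k) \<in> borel_measurable P"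
    and I: "finite I" and B: "B \<subseteq> I" and \<theta>: "\<theta> > 0" and \<delta>: "\<delta> > 0" and \<rho>: "\<rho> > 0" and T: "\<And>k. 0 < \<tau> k"
    and TB: "\<And>k. k \<in> B \<Longrightarrow> \<theta> + \<rho> \<le> \<tau> k"
    and sq: "sq \<ge> 1" "real (card I) \<le> sq^2"
    and D: "\<bar>D - (\<Sum>k\<in>I. min \<theta> (\<tau> k))\<bar> \<le> C0"
    and G: "G \<in> sets P"
    and G1: "\<And>\<zeta>. \<zeta> \<in> G \<Longrightarrow> \<bar>\<Sum>k\<in>I - B. (min \<theta> (\<tau> k))^2 / (\<tau> k * \<theta>) * ((z \<zeta> k)^2 - 1)\<bar> \<le> K1 * sq"
    and G2: "\<And>\<zeta>. \<zeta> \<in> G \<Longrightarrow> \<bar>\<Sum>k\<in>B. \<theta> / \<tau> k * ((z \<zeta> k)^2 - 1)\<bar> \<le> \<delta> / (8 * \<theta>) * sq"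
    and G3: "\<And>\<zeta>. \<zeta> \<in> G \<Longrightarrow> (\<Sum>k\<in>I. (z \<zeta> k)^2) \<le> 2 * sq^2"
    and G4: "\<And>\<zeta>. \<zeta> \<in> G \<Longrightarrow> (\<Sum>k\<in>B. (z \<zeta> k)^2) \<le> 2 * real (card B)"
    and G5: "\<And>\<zeta>. \<zeta> \<in> G \<Longrightarrow> (\<Sum>k\<in>I. min \<theta> (\<tau> k) / \<theta> * ((z \<zeta> k)^2 - 1) / 2) \<le> x * sq"
    and K: "K = (5 + K1) * \<theta>" "K1 \<ge> 0"
    and J: "real J * \<delta> > 2 * K" and K4: "K4 = C0 + K + (real J + 1) * \<delta>"
    and m: "real (card B) > 0" "640 * \<theta>^2 * real J * real (card B) \<le> \<delta>^2 * sq^2" "K4 * sq \<le> real (card B) * min (\<theta>/2) \<rho>"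
    and p: "p = 1 / (4 * real J) * exp (- ((\<Sum>k\<in>I. (1/2) * ln (\<tau> k / min \<theta> (\<tau> k))) + x * sq
        + C0 / (2 * \<theta>) + K4^2 * sq^2 / (real (card B) * \<theta>^2) + 2 * (\<delta> * sq) / \<theta>))"
  shows "\<exists>Y :: (nat \<Rightarrow> real) set. finite Y \<and> card Y \<le> J * M \<and>
    (\<exists>Bad\<in>sets P. measure P Bad \<le> real J * exp (- p * real M) \<and>
      (\<forall>\<zeta>\<in>G - Bad. \<exists>y\<in>Y. (\<Sum>k\<in>I. (sqrt (\<tau> k) * z \<zeta> k - y k)^2) \<le> D))"
\<comment> \<open>The bound \<open>p \<le> 1\<close> comes from a ball around a point of
  \<open>G\<close>, so the empty set is treated apart.\<close>
proof (cases "G = {}")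
  case True
  then show ?thesis by (intro exI[of _ "{}"] conjI bexI[of _ "{}"]) auto
next
  case False
  let ?m = "real (card B)"
  interpret P: prob_space P by fact
  define th0 where "th0 k = min \<theta> (\<tau> k)" for k
  define \<theta>' where "\<theta>' j = (D - ((\<Sum>k\<in>I - B. th0 k) - K * sq + (real j + 1) * (\<delta> * sq)) - \<delta> * sq) / ?m" for j
  define th where "th j k = (if k \<in> B then \<theta>' j else th0 k)" for j k
  define \<gamma> where "\<gamma> = PiM I (\<lambda>_. density lborel (normal_density 0 1))"
  define u where "u \<zeta> k = sqrt (\<tau> k) * z \<zeta> k" for \<zeta> k
  interpret \<gamma>: prob_space \<gamma> unfolding \<gamma>_def by (rule prob_space_PiM_normal) simp
  have K0: "K > 0" using K \<theta> by simp
  have C0: "C0 \<ge> 0" using D by linarith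
  have J0: "J > 0" using J K0 \<delta> by (cases J) auto
  have K40: "K4 > 0" using K4 C0 K0 \<delta> by (simp add: add_nonneg_pos add_pos_nonneg)
  have p0: "0 < p" unfolding p using J0 by simp
  have ball: "\<exists>j<J. p \<le> measure \<gamma> {x \<in> space \<gamma>. sqerr I \<tau> (th j) (u \<zeta>) x \<le> D}" if \<zeta>: "\<zeta> \<in> G" for \<zeta>
  proof -
    obtain j where j: "j < J" and bd: "1 / (4 * real J) * exp (- ((\<Sum>k\<in>I. (1/2) * ln (\<tau> k / min \<theta> (\<tau> k))) + (\<Sum>k\<in>I. min \<theta> (\<tau> k) / \<theta> * ((z \<zeta> k)^2 - 1) / 2)
        + C0 / (2 * \<theta>) + K4^2 * sq^2 / (?m * \<theta>^2) + 2 * (\<delta> * sq) / \<theta>))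
      \<le> measure \<gamma> {x \<in> space \<gamma>. sqerr I \<tau> (th j) (u \<zeta>) x \<le> D}"
      using typical_ball_probability[OF I B \<theta> \<delta> \<rho> T TB sq D G1[OF \<zeta>] G2[OF \<zeta>] G3[OF \<zeta>] G4[OF \<zeta>] K J K4 m]
      unfolding \<gamma>_def[symmetric] u_def[symmetric] th0_def[symmetric] \<theta>'_def[symmetric] th_def[symmetric]
      unfolding th0_def[symmetric] by blast
    have "p \<le> 1 / (4 * real J) * exp (- ((\<Sum>k\<in>I. (1/2) * ln (\<tau> k / min \<theta> (\<tau> k))) + (\<Sum>k\<in>I. min \<theta> (\<tau> k) / \<theta> * ((z \<zeta> k)^2 - 1) / 2)
        + C0 / (2 * \<theta>) + K4^2 * sq^2 / (?m * \<theta>^2) + 2 * (\<delta> * sq) / \<theta>))"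
      unfolding p using G5[OF \<zeta>] J0 by (intro mult_left_mono) auto
    then show ?thesis using j bd order_trans by blast
  qed
  define R where "R j = {(\<zeta>, N) \<in> space (P \<Otimes>\<^sub>M \<gamma>). sqerr I \<tau> (th j) (u \<zeta>) N \<le> D}" for j
  have Rm: "R j \<in> sets (P \<Otimes>\<^sub>M \<gamma>)" for j
  proof -
    have c: "(\<lambda>w. snd w k) \<in> borel_measurable (P \<Otimes>\<^sub>M \<gamma>)" if "k \<in> I" for k
    proof -
      have "sets \<gamma> = sets (PiM I (\<lambda>_. borel))" unfolding \<gamma>_def by (intro sets_PiM_cong) auto
      then have "(\<lambda>N. N k) \<in> borel_measurable \<gamma>"
        by (subst measurable_cong_sets[OF _ refl]) (auto intro: measurable_component_singleton[OF that])
      then show ?thesis by (rule measurable_compose[OF measurable_snd])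
    qed
    have "(\<lambda>w. sqerr I \<tau> (th j) (u (fst w)) (snd w)) \<in> borel_measurable (P \<Otimes>\<^sub>M \<gamma>)"
      unfolding sqerr_def u_def
      by (intro borel_measurable_sum borel_measurable_power borel_measurable_diff borel_measurable_times borel_measurable_const c measurable_compose[OF measurable_fst zm])
    then have "{w \<in> space (P \<Otimes>\<^sub>M \<gamma>). sqerr I \<tau> (th j) (u (fst w)) (snd w) \<le> D} \<in> sets (P \<Otimes>\<^sub>M \<gamma>)" by measurable
    also have "{w \<in> space (P \<Otimes>\<^sub>M \<gamma>). sqerr I \<tau> (th j) (u (fst w)) (snd w) \<le> D} = R j" by (auto simp: R_def)
    finally show ?thesis .
  qed
  have cut: "{N \<in> space \<gamma>. (\<zeta>, N) \<in> R j} = {x \<in> space \<gamma>. sqerr I \<tau> (th j) (u \<zeta>) x \<le> D}" if "\<zeta> \<in> space P" for \<zeta> j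
    using that by (auto simp: R_def space_pair_measure)
  have Gs: "G \<subseteq> space P" using sets.sets_into_space[OF G] .
  define Gj where "Gj j = {\<zeta> \<in> G. p \<le> measure \<gamma> {N \<in> space \<gamma>. (\<zeta>, N) \<in> R j}}" for j
  have Gjm: "Gj j \<in> sets P" for j
  proof -
    have "(\<lambda>\<zeta>. measure \<gamma> (Pair \<zeta> -` R j)) \<in> borel_measurable P"
      using \<gamma>.measurable_emeasure_Pair[OF Rm] by (simp add: measure_def)
    then have "{\<zeta> \<in> space P. p \<le> measure \<gamma> (Pair \<zeta> -` R j)} \<in> sets P" by measurable
    then have "G \<inter> {\<zeta> \<in> space P. p \<le> measure \<gamma> (Pair \<zeta> -` R j)} \<in> sets P" using G by auto
    also have "G \<inter> {\<zeta> \<in> space P. p \<le> measure \<gamma> (Pair \<zeta> -` R j)} = Gj j"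
    proof -
      have "Pair \<zeta> -` R j = {N \<in> space \<gamma>. (\<zeta>, N) \<in> R j}" for \<zeta> by (auto simp: R_def space_pair_measure)
      then show ?thesis using Gs by (auto simp: Gj_def)
    qed
    finally show ?thesis .
  qed
  have p1: "p \<le> 1"
  proof -
    obtain \<zeta> where "\<zeta> \<in> G" using False by blast
    from ball[OF this] obtain j where "p \<le> measure \<gamma> {x \<in> space \<gamma>. sqerr I \<tau> (th j) (u \<zeta>) x \<le> D}" by blast
    then show ?thesis using \<gamma>.prob_le_1 by (rule order_trans)
  qed
  have p2: "(1 - p) ^ M \<le> exp (- p * real M)"
  proof -
    have "1 - p \<le> exp (- p)" using exp_ge_add_one_self[of "- p"] by simp
    then have "(1 - p) ^ M \<le> exp (- p) ^ M" using p1 by (intro power_mono) simp_all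
    also have "\<dots> = exp (real M * - p)" by (rule exp_of_nat_mult[symmetric])
    also have "real M * - p = - p * real M" by simp
    finally show ?thesis .
  qed
  define good where "good j Y \<longleftrightarrow> finite Y \<and> card Y \<le> M \<and> Y \<subseteq> space \<gamma> \<and> {\<zeta> \<in> Gj j. \<forall>y\<in>Y. (\<zeta>, y) \<notin> R j} \<in> sets P
    \<and> measure P {\<zeta> \<in> Gj j. \<forall>y\<in>Y. (\<zeta>, y) \<notin> R j} \<le> (1 - p) ^ M" for j Y
  have "\<exists>Y. good j Y" for j
    unfolding good_def using p0 p1 by (intro greedy_covering P \<gamma>.prob_space_axioms Rm Gjm) (auto simp: Gj_def)
  then obtain Y where "good j (Y j)" for j by metis
  then have Y: "\<And>j. finite (Y j)" "\<And>j. card (Y j) \<le> M"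
    "\<And>j. {\<zeta> \<in> Gj j. \<forall>y\<in>Y j. (\<zeta>, y) \<notin> R j} \<in> sets P"
    "\<And>j. measure P {\<zeta> \<in> Gj j. \<forall>y\<in>Y j. (\<zeta>, y) \<notin> R j} \<le> (1 - p) ^ M"
    unfolding good_def by simp_all
  define YY where "YY = (\<Union>j<J. (\<lambda>N k. sqrt (\<tau> k - th j k) * N k) ` Y j)"
  define Bad where "Bad = (\<Union>j<J. {\<zeta> \<in> Gj j. \<forall>y\<in>Y j. (\<zeta>, y) \<notin> R j})"
  have "card YY \<le> (\<Sum>j<J. card ((\<lambda>N k. sqrt (\<tau> k - th j k) * N k) ` Y j))"
    unfolding YY_def by (rule card_UN_le) simp
  also have "\<dots> \<le> (\<Sum>j<J. M)" by (intro sum_mono order_trans[OF card_image_le Y(2)] Y(1))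
  finally have 1: "card YY \<le> J * M" by simp
  have "measure P Bad \<le> (\<Sum>j<J. measure P {\<zeta> \<in> Gj j. \<forall>y\<in>Y j. (\<zeta>, y) \<notin> R j})"
    unfolding Bad_def using Y(3) by (intro measure_UNION_le) auto
  also have "\<dots> \<le> (\<Sum>j<J. (1 - p) ^ M)" by (intro sum_mono Y(4))
  also have "\<dots> \<le> real J * exp (- p * real M)" using p2 by (simp add: mult_left_mono)
  finally have 2: "measure P Bad \<le> real J * exp (- p * real M)" .
  have 3: "\<exists>y\<in>YY. (\<Sum>k\<in>I. (sqrt (\<tau> k) * z \<zeta> k - y k)^2) \<le> D" if \<zeta>: "\<zeta> \<in> G - Bad" for \<zeta>
  proof -
    have \<zeta>P: "\<zeta> \<in> space P" using \<zeta> Gs by auto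
    obtain j where j: "j < J" "p \<le> measure \<gamma> {x \<in> space \<gamma>. sqerr I \<tau> (th j) (u \<zeta>) x \<le> D}" using ball \<zeta> by blast
    then have "\<zeta> \<in> Gj j" using \<zeta> by (simp add: Gj_def cut[OF \<zeta>P])
    then obtain N where N: "N \<in> Y j" "(\<zeta>, N) \<in> R j" using \<zeta> j unfolding Bad_def by blast
    then have "sqerr I \<tau> (th j) (u \<zeta>) N \<le> D" by (simp add: R_def)
    then show ?thesis using N j unfolding YY_def sqerr_def u_def by (intro bexI[of _ "\<lambda>k. sqrt (\<tau> k - th j k) * N k"]) auto
  qed
  have "finite YY" unfolding YY_def using Y(1) by auto
  moreover have "Bad \<in> sets P" unfolding Bad_def using Y(3) by auto
  ultimately show ?thesis using 1 2 3 by blast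
qed

section \<open>Second-order asymptotics\<close>

lemma sum_mode_rate_add_ln_last_scale:
  assumes a: "a > 1" and s: "\<sigma> > 0" and t: "\<theta> > 0" and n: "n > 0"
  shows "(\<Sum>k=1..<n. mode_rate a \<sigma> \<theta> n k) + ln (last_scale a n) = (\<Sum>k=1..<n. (1/2) * ln (max (gfun_grid a n k) (\<sigma>^2 / \<theta>)))"
proof -
  have last_scale: "last_scale a n > 0" using last_scale_ge_1[OF a n] by simp
  have "(last_scale a n)^2 = (\<Prod>k=1..<n. gfun_grid a n k)" using prod_gfun_grid[OF a n] last_scale_sq[OF a, of n] by simp
  then have "ln ((last_scale a n)^2) = (\<Sum>k=1..<n. ln (gfun_grid a n k))"
    by (simp only:) (rule ln_prod, simp_all add: gfun_grid_pos[OF a] gfun_grid_pos[OF a, THEN less_imp_neq, THEN not_sym])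
  then have l: "ln (last_scale a n) = (\<Sum>k=1..<n. (1/2) * ln (gfun_grid a n k))"
    unfolding sum_distrib_left[symmetric] using last_scale by (simp add: ln_realpow)
  have "mode_rate a \<sigma> \<theta> n k + (1/2) * ln (gfun_grid a n k) = (1/2) * ln (max (gfun_grid a n k) (\<sigma>^2 / \<theta>))" for k
  proof -
    have g: "gfun_grid a n k > 0" by (rule gfun_grid_pos[OF a])
    have e: "max (\<sigma>^2 / gfun_grid a n k) \<theta> / \<theta> = max (gfun_grid a n k) (\<sigma>^2 / \<theta>) / gfun_grid a n k"
      using g t by (auto simp: max_def field_simps)
    show ?thesis unfolding mode_rate_def e using g by (simp add: ln_div less_max_iff_disj)
  qed
  then show ?thesis unfolding l sum.distrib[symmetric] by (intro sum.cong) auto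
qed

lemma Zmeas_weighted_Chebyshev:
  assumes s: "\<sigma> > 0" and S: "S \<subseteq> {..<n}" and v: "\<And>k. k \<in> S \<Longrightarrow> 0 \<le> v k" "\<And>k. k \<in> S \<Longrightarrow> v k \<le> 1" and t: "t > 0"
  shows "measure (Zmeas \<sigma> n) {\<zeta> \<in> space (Zmeas \<sigma> n). \<bar>\<Sum>k\<in>S. v k * ((\<zeta> k / \<sigma>)^2 - 1)\<bar> \<ge> t} \<le> 2 * real (card S) / t^2"
proof -
  \<comment> \<open>Extended by zero so that the square roots below have nonnegative arguments for
    every index.\<close>
  define v' where "v' k = (if k \<in> S then v k else 0)" for k
  have v': "0 \<le> v' k" "v' k \<le> 1" for k using v by (auto simp: v'_def)
  have "measure (Zmeas \<sigma> n) {\<zeta> \<in> space (Zmeas \<sigma> n). \<bar>(\<Sum>k\<in>S. (0 - sqrt (v' k) / \<sigma> * \<zeta> k)^2) - (\<Sum>k\<in>S. (0 - sqrt (v' k) / \<sigma> * 0)^2 + (sqrt (v' k) / \<sigma> * \<sigma>)^2)\<bar> \<ge> t}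
    \<le> (\<Sum>k\<in>S. 4 * (0 - sqrt (v' k) / \<sigma> * 0)^2 * (sqrt (v' k) / \<sigma> * \<sigma>)^2 + 2 * (sqrt (v' k) / \<sigma> * \<sigma>)^4) / t^2"
    unfolding Zmeas_def by (rule normal_quadratic_Chebyshev[OF _ S s t]) simp
  also have "(\<Sum>k\<in>S. 4 * (0 - sqrt (v' k) / \<sigma> * 0)^2 * (sqrt (v' k) / \<sigma> * \<sigma>)^2 + 2 * (sqrt (v' k) / \<sigma> * \<sigma>)^4) \<le> (\<Sum>k\<in>S. 2)"
  proof (rule sum_mono)
    fix k
    have "(sqrt (v' k))^4 = (v' k)^2" using v'(1)[of k] power2_eq_square[of "(sqrt (v' k))^2"] by (simp add: power4_eq_xxxx power2_eq_square)
    also have "\<dots> \<le> 1" using v'[of k] by (simp add: power_le_one)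
    finally show "4 * (0 - sqrt (v' k) / \<sigma> * 0)^2 * (sqrt (v' k) / \<sigma> * \<sigma>)^2 + 2 * (sqrt (v' k) / \<sigma> * \<sigma>)^4 \<le> 2"
      using s by simp
  qed
  also have "(\<Sum>k\<in>S. (2::real)) = 2 * real (card S)" by simp
  also have "(\<lambda>\<zeta>. (\<Sum>k\<in>S. (0 - sqrt (v' k) / \<sigma> * \<zeta> k)^2) - (\<Sum>k\<in>S. (0 - sqrt (v' k) / \<sigma> * 0)^2 + (sqrt (v' k) / \<sigma> * \<sigma>)^2))
    = (\<lambda>\<zeta>. \<Sum>k\<in>S. v k * ((\<zeta> k / \<sigma>)^2 - 1))"
    unfolding sum_subtractf[symmetric]
  proof (intro ext sum.cong refl)
    fix \<zeta> k assume k: "k \<in> S"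
    have "(sqrt (v k))^2 = v k" using v(1)[OF k] by simp
    then show "(0 - sqrt (v' k) / \<sigma> * \<zeta> k)^2 - ((0 - sqrt (v' k) / \<sigma> * 0)^2 + (sqrt (v' k) / \<sigma> * \<sigma>)^2) = v k * ((\<zeta> k / \<sigma>)^2 - 1)"
      using s k by (simp add: v'_def power_divide power_mult_distrib right_diff_distrib)
  qed
  finally show ?thesis by (simp add: divide_right_mono)
qed

text \<open>The mode variance is largest at frequency 0, where it exceeds \<theta> by hypothesis,
  and it depends continuously on the frequency. These modes can bear a water level somewhat above
  \<theta>.\<close>

lemma exists_strictly_active_band:
  assumes a: "a > 1" and s: "\<sigma> > 0" and t: "\<theta> > 0" "\<theta> < \<sigma>^2 / (a - 1)^2"
  shows "\<exists>\<rho>>0. \<exists>\<eta>>0. \<forall>n k. n > 0 \<longrightarrow> real k \<le> \<eta> * real n \<longrightarrow> \<theta> + \<rho> \<le> \<sigma>^2 / gfun_grid a n k"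
proof -
  define \<rho> where "\<rho> = (\<sigma>^2 / (a - 1)^2 - \<theta>) / 2"
  have \<rho>: "\<rho> > 0" using t by (simp add: \<rho>_def)
  have g0: "gfun a 0 = (a - 1)^2" by (simp add: gfun_def power2_eq_square algebra_simps)
  have "isCont (\<lambda>w. \<sigma>^2 / gfun a w) 0"
    unfolding gfun_def using gfun_pos[OF a, of 0] unfolding gfun_def by (intro continuous_intros) auto
  then have "((\<lambda>w. \<sigma>^2 / gfun a w) \<longlongrightarrow> \<sigma>^2 / gfun a 0) (at 0)" by (simp add: isCont_def)
  moreover have "\<theta> + \<rho> < \<sigma>^2 / gfun a 0" unfolding g0 using t by (simp add: \<rho>_def field_simps)
  ultimately have "eventually (\<lambda>w. \<theta> + \<rho> < \<sigma>^2 / gfun a w) (at 0)" by (rule order_tendstoD)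
  then obtain e where e: "e > 0" "\<And>w. w \<noteq> 0 \<Longrightarrow> dist w 0 < e \<Longrightarrow> \<theta> + \<rho> < \<sigma>^2 / gfun a w"
    unfolding eventually_at by auto
  have e': "\<theta> + \<rho> \<le> \<sigma>^2 / gfun a w" if "\<bar>w\<bar> < e" for w
    using e(2)[of w] that \<open>\<theta> + \<rho> < \<sigma>^2 / gfun a 0\<close> by (cases "w = 0") (auto simp: less_imp_le)
  show ?thesis
  proof (rule exI[of _ \<rho>], rule conjI[OF \<rho>], rule exI[of _ "e / (2 * pi)"], intro conjI allI impI)
    show "e / (2 * pi) > 0" using e by simp
    fix n k :: nat assume n: "n > 0" and k: "real k \<le> e / (2 * pi) * real n"
    define w where "w = real k * pi / real n"
    have "w \<le> e / 2" "0 \<le> w" using k n by (simp_all add: w_def field_simps)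
    then have "\<bar>w\<bar> < e" using e(1) by linarith
    then show "\<theta> + \<rho> \<le> \<sigma>^2 / gfun_grid a n k" unfolding gfun_grid_def w_def by (rule e')
  qed
qed

lemma achievability:
  assumes a: "a > 1" and s: "\<sigma> > 0" and d: "d > 0" and t: "\<theta> > 0" "\<theta> < \<sigma>^2 / (a - 1)^2"
    and D: "d = (1 / (2 * pi)) * integral {-pi..pi} (\<lambda>w. min \<theta> (\<sigma>^2 / gfun a w))"
    and x: "x \<ge> 0" and \<epsilon>: "Qfun (x / sqrt (VU a \<sigma> \<theta>)) < \<epsilon>" and \<kappa>: "\<kappa> > 0"
  shows "eventually (\<lambda>n. \<exists>M. has_code a \<sigma> n M d \<epsilon> \<and> M > 0 \<and> ln (real M) \<le> real n * RU a \<sigma> \<theta> + (x + \<kappa>) * sqrt (real n)) sequentially"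
proof -
  define V where "V = VU a \<sigma> \<theta>"
  have V: "V > 0" unfolding V_def by (rule VU_pos[OF a s t(1)])
  \<comment> \<open>Seven shares are spent: five exceptional source events, the uncovered set
    \<open>Bad\<close>, and the error in the limit of the tail probability.\<close>
  define \<epsilon>0 where "\<epsilon>0 = (\<epsilon> - Qfun (x / sqrt V)) / 8"
  have \<epsilon>0: "\<epsilon>0 > 0" using \<epsilon> by (simp add: \<epsilon>0_def V_def)
  obtain C1 where C1: "\<And>n. n > 0 \<Longrightarrow> \<bar>(\<Sum>k=1..<n. min \<theta> (\<sigma>^2 / gfun_grid a n k)) - real n * d\<bar> \<le> C1"
    using Riemann_distortion[OF a s t(1) D] by blast
  obtain CR where CR: "\<And>n. n > 0 \<Longrightarrow> \<bar>(\<Sum>k=1..<n. (1/2) * ln (max (gfun_grid a n k) (\<sigma>^2 / \<theta>))) - real n * RU a \<sigma> \<theta>\<bar> \<le> CR"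
    using Riemann_RU[OF a s t(1)] by blast
  \<comment> \<open>\<open>C1\<close> is the Riemann error; \<open>d + 2\<close> is the distortion
    reserved for quantizing the last sample.\<close>
  define C0 where "C0 = C1 + d + 2"
  have C0: "C0 \<ge> 0" using C1[of 1] d unfolding C0_def by linarith
  obtain \<rho> \<eta>1 where \<rho>: "\<rho> > 0" and \<eta>1: "\<eta>1 > 0"
    and band: "\<And>n k. n > 0 \<Longrightarrow> real k \<le> \<eta>1 * real n \<Longrightarrow> \<theta> + \<rho> \<le> \<sigma>^2 / gfun_grid a n k"
    using exists_strictly_active_band[OF a s t] by blast
  \<comment> \<open>Makes the window cost \<open>2 * (\<delta> * sqrt n) / \<theta>\<close> equal to
    a quarter of the slack \<open>\<kappa> * sqrt n\<close>.\<close>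
  define \<delta> where "\<delta> = \<kappa> * \<theta> / 8"
  have \<delta>: "\<delta> > 0" using \<kappa> t by (simp add: \<delta>_def)
  define K1 where "K1 = sqrt (2 / \<epsilon>0)"
  have K1: "K1 > 0" "K1^2 = 2 / \<epsilon>0" using \<epsilon>0 by (auto simp: K1_def)
  define K where "K = (5 + K1) * \<theta>"
  have K0: "K > 0" using K1 t by (simp add: K_def)
  obtain J :: nat where J: "2 * K < real J * \<delta>" using reals_Archimedean3[OF \<delta>] by blast
  have J0: "J > 0" using J K0 \<delta> by (cases J) auto
  define K4 where "K4 = C0 + K + (real J + 1) * \<delta>"
  have K40: "K4 > 0" unfolding K4_def using C0 K0 \<delta> by (simp add: add_nonneg_pos add_pos_nonneg)
  \<comment> \<open>In order: the band stays below \<open>n\<close>; its modes are strictly active;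
    its test channel fluctuation fits the window; its source fluctuation \<open>E2\<close> is
    unlikely.\<close>
  define \<eta> where "\<eta> = min (1/2) (min \<eta>1 (min (\<delta>^2 / (640 * \<theta>^2 * real J)) (\<epsilon>0 * \<delta>^2 / (128 * \<theta>^2))))"
  have \<eta>: "\<eta> > 0" using \<eta>1 \<delta> t J0 \<epsilon>0 by (simp add: \<eta>_def)
  have \<eta>le: "\<eta> \<le> 1/2" "\<eta> \<le> \<eta>1" "\<eta> \<le> \<delta>^2 / (640 * \<theta>^2 * real J)" "\<eta> \<le> \<epsilon>0 * \<delta>^2 / (128 * \<theta>^2)"
    unfolding \<eta>_def by (simp_all add: min.coboundedI2)
  have \<eta>J: "640 * \<theta>^2 * real J * \<eta> \<le> \<delta>^2" using \<eta>le(3) t J0 by (simp add: pos_le_divide_eq mult.commute)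
  have \<eta>\<epsilon>: "128 * \<theta>^2 * \<eta> \<le> \<epsilon>0 * \<delta>^2" using \<eta>le(4) t by (simp add: pos_le_divide_eq mult.commute)
  define m where "m n = nat \<lfloor>\<eta> * real n\<rfloor>" for n :: nat
  define B where "B n = {1..m n}" for n
  have m_le: "real (m n) \<le> \<eta> * real n" for n using \<eta> by (simp add: m_def)
  have m_ge: "\<eta> * real n - 1 \<le> real (m n)" for n unfolding m_def using \<eta> by linarith
  \<comment> \<open>As the band has at least \<open>\<eta> * n / 2\<close> modes, the second order
    cost of the modified level stays below this constant.\<close>
  define C2 where "C2 = 2 * K4^2 / (\<eta> * \<theta>^2)"
  \<comment> \<open>With \<open>p * M0 \<ge> C3\<close> the bound \<open>J * exp (- p * M0)\<close>
    is at most \<epsilon>0. The summand 1 ensures \<open>C3 / p \<ge> 1\<close>, so that rounding up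
    at most doubles it.\<close>
  define C3 where "C3 = \<bar>ln (real J / \<epsilon>0)\<bar> + 1"
  define C4 where "C4 = ln 2 + ln (2 * real J * C3) + ln (4 * real J) + C0 / (2 * \<theta>) + C2 + CR"
  define tail where "tail n = measure (Zmeas \<sigma> n) {z \<in> space (Zmeas \<sigma> n). (\<Sum>k=1..<n. mode_weight a \<sigma> \<theta> n k * ((z k)^2 / \<sigma>^2 - 1) / 2) > x * sqrt (real n)}" for n
  have tail: "tail \<longlonglongrightarrow> Qfun (x / sqrt V)"
    unfolding tail_def
  proof (rule Zmeas_tail_limit[OF s V])
    show "0 \<le> mode_weight a \<sigma> \<theta> n k" "mode_weight a \<sigma> \<theta> n k \<le> 1" for n k
      using gfun_grid_pos[OF a, of n k] t s by (auto simp: mode_weight_def)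
    show "(\<lambda>n. (\<Sum>k = 1..<n. (mode_weight a \<sigma> \<theta> n k)^2 / 2) / real n) \<longlonglongrightarrow> V"
      unfolding mode_weight_def V_def by (rule Riemann_VU[OF a s t(1)])
  qed
  have ev1: "eventually (\<lambda>n. tail n < Qfun (x / sqrt V) + \<epsilon>0) sequentially"
    using tail \<epsilon>0 by (intro order_tendstoD(2)) auto
  have ev2: "eventually (\<lambda>n. 1 \<le> \<eta> * real n / 2) sequentially" using \<eta> by real_asymp
  have ev3: "eventually (\<lambda>n. 2 / (\<eta> * real n / 2) \<le> \<epsilon>0) sequentially" using \<eta> \<epsilon>0 by real_asymp
  have ev4: "eventually (\<lambda>n. K4 * sqrt (real n) \<le> \<eta> * real n / 2 * min (\<theta>/2) \<rho>) sequentially"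
  proof -
    define c where "c = \<eta> / 2 * min (\<theta>/2) \<rho>"
    have "c > 0" using \<eta> t \<rho> by (simp add: c_def)
    then have "eventually (\<lambda>n. K4 * sqrt (real n) \<le> c * real n) sequentially" by real_asymp
    then show ?thesis by (simp add: c_def mult_ac)
  qed
  have ev5: "eventually (\<lambda>n. C4 + ln (2 * \<sigma> * (real n)^2 + 3) + (\<kappa> / 4) * sqrt (real n) \<le> \<kappa> * sqrt (real n)) sequentially"
    using \<kappa> s by real_asymp
  have ev6: "eventually (\<lambda>n. 2 / real n \<le> \<epsilon>0) sequentially" using \<epsilon>0 by real_asymp
  have ev7: "eventually (\<lambda>n. n \<ge> (2::nat)) sequentially" by (rule eventually_ge_at_top)
  from ev1 ev2 ev3 ev4 ev5 ev6 ev7 show ?thesis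
  proof eventually_elim
    case (elim n)
    note e1 = elim(1) and e2 = elim(2) and e3 = elim(3) and e4 = elim(4) and e5 = elim(5) and e6 = elim(6) and n2 = elim(7)
    have n: "n > 0" using n2 by simp
    let ?P = "Zmeas \<sigma> n" and ?I = "{1..<n}"
    let ?z = "\<lambda>\<zeta> k. \<zeta> k / \<sigma>" and ?\<tau> = "\<lambda>k. \<sigma>^2 / gfun_grid a n k"
    let ?sq = "sqrt (real n)" and ?m = "real (card (B n))"
    interpret P: prob_space ?P using s by (rule Zmeas_prob_space)
    have \<tau>: "0 < ?\<tau> k" for k using gfun_grid_pos[OF a, of n k] s by simp
    have sq2: "?sq^2 = real n" by simp
    have mm: "?m = real (m n)" by (simp add: B_def)
    have mlo: "\<eta> * real n / 2 \<le> ?m" using m_ge[of n] e2 unfolding mm by simp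
    have mpos: "?m > 0" using mlo e2 by linarith
    have mhi: "?m \<le> \<eta> * real n" using m_le[of n] unfolding mm .
    have BI: "B n \<subseteq> ?I"
    proof -
      have "\<eta> * real n \<le> 1/2 * real n" using \<eta>le(1) by (rule mult_right_mono) simp
      then have "real (m n) < real n" using m_le[of n] n by linarith
      then show ?thesis by (auto simp: B_def)
    qed
    have TB: "\<theta> + \<rho> \<le> ?\<tau> k" if "k \<in> B n" for k
    proof (rule band[OF n])
      have "real k \<le> real (m n)" using that by (simp add: B_def)
      also have "\<dots> \<le> \<eta>1 * real n" using m_le[of n] \<eta>le(2) by (meson mult_right_mono of_nat_0_le_iff order_trans)
      finally show "real k \<le> \<eta>1 * real n" .
    qed
    define v1 where "v1 k = (min \<theta> (?\<tau> k))^2 / (?\<tau> k * \<theta>)" for k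
    have v1: "0 \<le> v1 k" "v1 k \<le> 1" for k
    proof -
      have "(min \<theta> (?\<tau> k))^2 \<le> ?\<tau> k * \<theta>" using \<tau>[of k] t unfolding power2_eq_square by (intro mult_mono) auto
      moreover have pos: "?\<tau> k * \<theta> > 0" using \<tau>[of k] t by (intro mult_pos_pos)
      ultimately show "v1 k \<le> 1" unfolding v1_def by (subst divide_le_eq_1_pos[OF pos])
      show "0 \<le> v1 k" unfolding v1_def by (intro divide_nonneg_pos zero_le_power2 pos)
    qed
    have v2: "0 \<le> \<theta> / ?\<tau> k" "\<theta> / ?\<tau> k \<le> 1" if "k \<in> B n" for k
    proof -
      show "0 \<le> \<theta> / ?\<tau> k" using t \<tau>[of k] by (intro divide_nonneg_pos) auto
      have "\<theta> \<le> ?\<tau> k" using TB[OF that] \<rho> by linarith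
      then show "\<theta> / ?\<tau> k \<le> 1" by (subst divide_le_eq_1_pos[OF \<tau>])
    qed
    let ?E = "\<lambda>S v t. {\<zeta> \<in> space ?P. \<bar>\<Sum>k\<in>S. v k * ((\<zeta> k / \<sigma>)^2 - 1)\<bar> \<ge> t}"
    have Em: "?E S v c \<in> sets ?P" if "S \<subseteq> {..<n}" for S v and c :: real
    proof -
      have "(\<lambda>\<zeta>. \<Sum>k\<in>S. v k * ((\<zeta> k / \<sigma>)^2 - 1)) \<in> borel_measurable ?P"
        using that by (intro borel_measurable_sum borel_measurable_times borel_measurable_diff borel_measurable_power borel_measurable_divide borel_measurable_const measurable_Zmeas_component) auto
      then show ?thesis by measurable
    qed
    have sub: "?I - B n \<subseteq> {..<n}" "B n \<subseteq> {..<n}" "?I \<subseteq> {..<n}" "{0} \<subseteq> {..<n}" using BI n by auto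
    define E1 where "E1 = ?E (?I - B n) v1 (K1 * ?sq)"
    define E2 where "E2 = ?E (B n) (\<lambda>k. \<theta> / ?\<tau> k) (\<delta> / (8 * \<theta>) * ?sq)"
    define E3 where "E3 = ?E ?I (\<lambda>_. 1) (real n)"
    define E4 where "E4 = ?E (B n) (\<lambda>_. 1) ?m"
    \<comment> \<open>Off this event the modulus of \<open>\<zeta> 0\<close> is at most
      \<open>\<sigma> * n\<close>, so the quantizer needs only polynomially many points per unit of
      \<open>last_scale a n\<close>.\<close>
    define E6 where "E6 = ?E {0} (\<lambda>_. 1) (real n)"
    define E5 where "E5 = {z \<in> space ?P. (\<Sum>k=1..<n. mode_weight a \<sigma> \<theta> n k * ((z k)^2 / \<sigma>^2 - 1) / 2) > x * sqrt (real n)}"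
    have E5m: "E5 \<in> sets ?P"
    proof -
      have "(\<lambda>z. \<Sum>k=1..<n. mode_weight a \<sigma> \<theta> n k * ((z k)^2 / \<sigma>^2 - 1) / 2) \<in> borel_measurable ?P"
        by (intro borel_measurable_sum borel_measurable_times borel_measurable_diff borel_measurable_power borel_measurable_divide borel_measurable_const measurable_Zmeas_component) auto
      then show ?thesis unfolding E5_def by measurable
    qed
    have Esets: "E1 \<in> sets ?P" "E2 \<in> sets ?P" "E3 \<in> sets ?P" "E4 \<in> sets ?P" "E5 \<in> sets ?P" "E6 \<in> sets ?P"
      unfolding E1_def E2_def E3_def E4_def E6_def by (rule Em[OF sub(1)] Em[OF sub(2)] Em[OF sub(3)] Em[OF sub(4)] E5m)+
    have sqp: "?sq > 0" using n by simp
    have P1: "measure ?P E1 \<le> \<epsilon>0"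
    proof -
      have "measure ?P E1 \<le> 2 * real (card (?I - B n)) / (K1 * ?sq)^2"
        unfolding E1_def using v1 K1 sqp by (intro Zmeas_weighted_Chebyshev s sub) auto
      also have "\<dots> \<le> 2 * real n / (K1 * ?sq)^2"
      proof -
        have "card (?I - B n) \<le> n" using card_mono[OF _ sub(1)] by simp
        then show ?thesis by (intro divide_right_mono) auto
      qed
      also have "\<dots> = \<epsilon>0" using n \<epsilon>0 unfolding power_mult_distrib K1 sq2 by simp
      finally show ?thesis .
    qed
    have P2: "measure ?P E2 \<le> \<epsilon>0"
    proof -
      have "measure ?P E2 \<le> 2 * ?m / (\<delta> / (8 * \<theta>) * ?sq)^2"
        unfolding E2_def using v2 \<delta> t sqp by (intro Zmeas_weighted_Chebyshev s sub) auto
      also have "\<dots> = 128 * \<theta>^2 * ?m / (\<delta>^2 * real n)"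
        unfolding power_mult_distrib power_divide sq2 by simp
      also have "\<dots> \<le> 128 * \<theta>^2 * (\<eta> * real n) / (\<delta>^2 * real n)"
        using mhi by (intro divide_right_mono mult_left_mono) auto
      also have "\<dots> = 128 * \<theta>^2 * \<eta> / \<delta>^2" using n by simp
      also have "\<dots> \<le> \<epsilon>0" using \<eta>\<epsilon> \<delta> by (simp add: divide_le_eq)
      finally show ?thesis .
    qed
    have P3: "measure ?P E3 \<le> \<epsilon>0"
    proof -
      have "measure ?P E3 \<le> 2 * real (card ?I) / (real n)^2"
        unfolding E3_def using n by (intro Zmeas_weighted_Chebyshev s sub) auto
      also have "\<dots> \<le> 2 * real n / (real n)^2" by (intro divide_right_mono) auto
      also have "\<dots> = 2 / real n" by (simp add: power2_eq_square)
      finally show ?thesis using e6 by linarith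
    qed
    have P4: "measure ?P E4 \<le> \<epsilon>0"
    proof -
      have "measure ?P E4 \<le> 2 * ?m / ?m^2"
        unfolding E4_def using mpos by (intro Zmeas_weighted_Chebyshev s sub) auto
      also have "\<dots> = 2 / ?m" using mpos by (simp add: power2_eq_square)
      also have "\<dots> \<le> 2 / (\<eta> * real n / 2)" using mlo e2 by (intro divide_left_mono mult_pos_pos) linarith+
      finally show ?thesis using e3 by linarith
    qed
    have P6: "measure ?P E6 \<le> \<epsilon>0"
    proof -
      have "measure ?P E6 \<le> 2 * real (card {0::nat}) / (real n)^2"
        unfolding E6_def using n by (intro Zmeas_weighted_Chebyshev s sub) auto
      also have "\<dots> \<le> 2 * real n / (real n)^2" using n by (intro divide_right_mono) auto
      also have "\<dots> = 2 / real n" by (simp add: power2_eq_square)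
      finally show ?thesis using e6 by linarith
    qed
    have P5: "measure ?P E5 \<le> Qfun (x / sqrt V) + \<epsilon>0" using e1 unfolding tail_def E5_def by simp
    define G where "G = space ?P - (E1 \<union> E2 \<union> E3 \<union> E4 \<union> E5)"
    have Gm: "G \<in> sets ?P" unfolding G_def using Esets by auto
    have wtm: "min \<theta> (?\<tau> k) / \<theta> = mode_weight a \<sigma> \<theta> n k" for k
      using t gfun_grid_pos[OF a, of n k] unfolding mode_weight_def by (auto simp: min_def field_simps)
    have lgm: "(1/2) * ln (?\<tau> k / min \<theta> (?\<tau> k)) = mode_rate a \<sigma> \<theta> n k" for k
    proof -
      have "?\<tau> k / min \<theta> (?\<tau> k) = max (?\<tau> k) \<theta> / \<theta>" using t \<tau>[of k] by (auto simp: min_def max_def)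
      then show ?thesis unfolding mode_rate_def by simp
    qed
    define L where "L = (\<Sum>k\<in>?I. (1/2) * ln (?\<tau> k / min \<theta> (?\<tau> k)))"
    have L: "L + ln (last_scale a n) \<le> real n * RU a \<sigma> \<theta> + CR"
      unfolding L_def lgm sum_mode_rate_add_ln_last_scale[OF a s t(1) n] using CR[OF n] by linarith
    have L0: "0 \<le> L" unfolding L_def
    proof (intro sum_nonneg)
      fix k
      have "min \<theta> (?\<tau> k) > 0" using \<tau>[of k] t(1) by (simp only: min_less_iff_conj)
      then have "1 \<le> ?\<tau> k / min \<theta> (?\<tau> k)" by (subst le_divide_eq_1_pos) auto
      then show "0 \<le> (1/2) * ln (?\<tau> k / min \<theta> (?\<tau> k))" by simp
    qed
    define X where "X = L + x * ?sq + C0 / (2 * \<theta>) + K4^2 * ?sq^2 / (?m * \<theta>^2) + 2 * (\<delta> * ?sq) / \<theta>"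
    define p where "p = 1 / (4 * real J) * exp (- X)"
    have p0: "p > 0" using J0 by (simp add: p_def)
    have X0: "X \<ge> 0" unfolding X_def using L0 x C0 t \<delta> mpos by (intro add_nonneg_nonneg mult_nonneg_nonneg divide_nonneg_nonneg) auto
    have p1: "p \<le> 1"
    proof -
      have "p \<le> 1 * 1" unfolding p_def using J0 X0 by (intro mult_mono) auto
      then show ?thesis by simp
    qed
    define M0 where "M0 = nat \<lceil>C3 / p\<rceil>"
    have C3: "C3 \<ge> 1" "ln (real J / \<epsilon>0) \<le> C3" by (auto simp: C3_def)
    have M0: "C3 / p \<le> real M0" "real M0 \<le> 2 * C3 / p"
    proof -
      show "C3 / p \<le> real M0" unfolding M0_def by linarith
      have "1 \<le> C3 / p" using C3(1) p0 p1 by (simp add: le_divide_eq)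
      moreover have "real M0 \<le> C3 / p + 1" unfolding M0_def using calculation by linarith
      ultimately have "real M0 \<le> C3 / p + C3 / p" by linarith
      then show "real M0 \<le> 2 * C3 / p" by simp
    qed
    have "\<exists>Y :: (nat \<Rightarrow> real) set. finite Y \<and> card Y \<le> J * M0 \<and>
      (\<exists>Bad\<in>sets ?P. measure ?P Bad \<le> real J * exp (- p * real M0) \<and>
      (\<forall>\<zeta>\<in>G - Bad. \<exists>y\<in>Y. (\<Sum>k\<in>?I. (sqrt (?\<tau> k) * ?z \<zeta> k - y k)^2) \<le> real n * d - (d + 2)))"
    proof (rule mode_codebook[where B="B n" and \<theta>=\<theta> and \<delta>=\<delta> and \<rho>=\<rho> and sq="?sq" and ?C0.0=C0 and ?K1.0=K1 and x=x and K=K and ?K4.0=K4])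
      show "(\<lambda>\<zeta>. ?z \<zeta> k) \<in> borel_measurable ?P" if "k \<in> ?I" for k
        using that by (intro borel_measurable_divide borel_measurable_const measurable_Zmeas_component) auto
      show "1 \<le> ?sq" using n by simp
      show "real (card ?I) \<le> ?sq^2" by simp
      show "\<bar>real n * d - (d + 2) - (\<Sum>k\<in>?I. min \<theta> (?\<tau> k))\<bar> \<le> C0"
        using C1[OF n] d unfolding C0_def abs_le_iff by linarith
      fix \<zeta> assume \<zeta>: "\<zeta> \<in> G"
      have \<zeta>P: "\<zeta> \<in> space ?P" using \<zeta> by (simp add: G_def)
      show "\<bar>\<Sum>k\<in>?I - B n. (min \<theta> (?\<tau> k))^2 / (?\<tau> k * \<theta>) * ((?z \<zeta> k)^2 - 1)\<bar> \<le> K1 * ?sq"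
        using \<zeta> unfolding G_def E1_def v1_def by auto
      show "\<bar>\<Sum>k\<in>B n. \<theta> / ?\<tau> k * ((?z \<zeta> k)^2 - 1)\<bar> \<le> \<delta> / (8 * \<theta>) * ?sq"
        using \<zeta> unfolding G_def E2_def by auto
      have "\<bar>\<Sum>k\<in>?I. ((?z \<zeta> k)^2 - 1)\<bar> < real n" using \<zeta> \<zeta>P unfolding G_def E3_def by auto
      moreover have "(\<Sum>k\<in>?I. ((?z \<zeta> k)^2 - 1)) = (\<Sum>k\<in>?I. (?z \<zeta> k)^2) - real (card ?I)" by (simp add: sum_subtractf)
      moreover have "real (card ?I) \<le> real n" by simp
      ultimately show "(\<Sum>k\<in>?I. (?z \<zeta> k)^2) \<le> 2 * ?sq^2" unfolding sq2 by linarith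
      have "\<bar>\<Sum>k\<in>B n. ((?z \<zeta> k)^2 - 1)\<bar> < ?m" using \<zeta> \<zeta>P unfolding G_def E4_def by auto
      moreover have "(\<Sum>k\<in>B n. ((?z \<zeta> k)^2 - 1)) = (\<Sum>k\<in>B n. (?z \<zeta> k)^2) - ?m" by (simp add: sum_subtractf)
      ultimately show "(\<Sum>k\<in>B n. (?z \<zeta> k)^2) \<le> 2 * ?m" by linarith
      have "(\<Sum>k\<in>?I. mode_weight a \<sigma> \<theta> n k * ((\<zeta> k)^2 / \<sigma>^2 - 1) / 2) \<le> x * ?sq" using \<zeta> \<zeta>P unfolding G_def E5_def by auto
      then show "(\<Sum>k\<in>?I. min \<theta> (?\<tau> k) / \<theta> * ((?z \<zeta> k)^2 - 1) / 2) \<le> x * ?sq" unfolding wtm power_divide .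
    next
      show "640 * \<theta>^2 * real J * ?m \<le> \<delta>^2 * ?sq^2"
      proof -
        have "640 * \<theta>^2 * real J * ?m \<le> 640 * \<theta>^2 * real J * (\<eta> * real n)" using mhi by (intro mult_left_mono) auto
        also have "\<dots> \<le> \<delta>^2 * real n" using mult_right_mono[OF \<eta>J, of "real n"] by (simp add: mult.assoc)
        finally show ?thesis by simp
      qed
      show "K4 * ?sq \<le> ?m * min (\<theta>/2) \<rho>"
      proof -
        have "\<eta> * real n / 2 * min (\<theta>/2) \<rho> \<le> ?m * min (\<theta>/2) \<rho>" using mlo t \<rho> by (intro mult_right_mono) auto
        then show ?thesis using e4 by linarith
      qed
    qed (use P.prob_space_axioms BI t \<delta> \<rho> \<tau> TB Gm K1 J mpos in \<open>simp_all add: K_def K4_def p_def X_def L_def\<close>)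
    then obtain Y Bad where Y: "finite Y" "card Y \<le> J * M0" and Bad: "Bad \<in> sets ?P" "measure ?P Bad \<le> real J * exp (- p * real M0)"
      and cov: "\<And>\<zeta>. \<zeta> \<in> G - Bad \<Longrightarrow> \<exists>y\<in>Y. (\<Sum>k\<in>?I. (sqrt (?\<tau> k) * ?z \<zeta> k - y k)^2) \<le> real n * d - (d + 2)"
      by blast
    have PBad: "measure ?P Bad \<le> \<epsilon>0"
    proof -
      have "ln (real J / \<epsilon>0) \<le> p * real M0" using C3(2) M0(1) p0 by (simp add: divide_le_eq mult.commute)
      then have "exp (ln (real J / \<epsilon>0)) \<le> exp (p * real M0)" by simp
      then have "real J \<le> \<epsilon>0 * exp (p * real M0)" using J0 \<epsilon>0 by (simp add: divide_le_eq mult.commute)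
      then have "real J * exp (- p * real M0) \<le> \<epsilon>0" by (simp add: exp_minus divide_le_eq field_simps)
      then show ?thesis using Bad(2) by linarith
    qed
    have snp: "last_scale a n \<ge> 1" by (rule last_scale_ge_1[OF a n])
    obtain Q :: "real set" where Q: "finite Q" "Q \<noteq> {}" "real (card Q) \<le> 2 * (last_scale a n * \<sigma> * real n) * real n + 3"
      "\<And>v. \<bar>v\<bar> \<le> last_scale a n * \<sigma> * real n \<Longrightarrow> \<exists>q\<in>Q. \<bar>v - q\<bar> \<le> 1 / real n"
      using exists_grid[of "last_scale a n * \<sigma> * real n" n] snp s n by auto
    \<comment> \<open>The zero word keeps the codebook nonempty even when \<open>Y\<close> is
      empty.\<close>
    define Cb where "Cb = (\<lambda>(y, q) i. (\<Sum>k=1..<n. sine_mode n k (Suc i) * y k) + last_coeff a n i * q) ` (insert (\<lambda>_. 0) Y \<times> Q)"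
    have Cb: "finite Cb" "Cb \<noteq> {}" using Y Q by (auto simp: Cb_def)
    have cardCb: "real (card Cb) \<le> (2 * real J * C3 * (4 * real J) * exp X) * 2 * (last_scale a n * (2 * \<sigma> * (real n)^2 + 3))"
    proof -
      have "card Cb \<le> card (insert (\<lambda>_. 0) Y \<times> Q)" unfolding Cb_def using Y Q by (intro card_image_le) auto
      also have "\<dots> = card (insert (\<lambda>_. 0) Y) * card Q" by (rule card_cartesian_product)
      also have "\<dots> \<le> (J * M0 + 1) * card Q" using Y by (intro mult_right_mono) (auto simp: card_insert_if)
      finally have "real (card Cb) \<le> real ((J * M0 + 1) * card Q)" by (simp only: of_nat_le_iff)
      also have "\<dots> = (real J * real M0 + 1) * real (card Q)" by (simp only: of_nat_mult of_nat_add of_nat_1)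
      also have "\<dots> \<le> (2 * real J * C3 * (4 * real J) * exp X * 2) * (last_scale a n * (2 * \<sigma> * (real n)^2 + 3))"
      proof (intro mult_mono)
        have "1 \<le> C3 / p" using C3(1) p0 p1 by (simp add: le_divide_eq)
        then have "1 \<le> real M0" using M0(1) by linarith
        then have "1 * 1 \<le> real J * real M0" using J0 by (intro mult_mono) auto
        then have "real J * real M0 + 1 \<le> 2 * (real J * real M0)" by simp
        also have "\<dots> \<le> 2 * (real J * (2 * C3 / p))" using M0(2) by (intro mult_left_mono) auto
        also have "2 * C3 / p = 2 * C3 * (4 * real J) * exp X" 
        proof -
          have pe: "p = 1 / (4 * real J * exp X)"
            unfolding p_def exp_minus by (simp only: inverse_eq_divide times_divide_times_eq mult_1)
          show ?thesis unfolding pe by (simp only: divide_divide_eq_right div_by_1 mult.assoc)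
        qed
        finally show "real J * real M0 + 1 \<le> 2 * real J * C3 * (4 * real J) * exp X * 2" by (simp add: mult_ac)
        have "2 * (last_scale a n * \<sigma> * real n) * real n + 3 \<le> last_scale a n * (2 * \<sigma> * (real n)^2) + last_scale a n * 3"
          using snp by (simp add: power2_eq_square)
        then show "real (card Q) \<le> last_scale a n * (2 * \<sigma> * (real n)^2 + 3)" unfolding distrib_left using Q(3) by linarith
        show "0 \<le> 2 * real J * C3 * (4 * real J) * exp X * 2" using C3(1) by simp
      qed simp
      finally show ?thesis by simp
    qed
    let ?F = "{z \<in> space ?P. \<forall>c\<in>Cb. distortion n (Uvec a z) c > d}"
    have Fm: "?F \<in> sets ?P"
    proof (intro sets.sets_Collect_finite_All Cb)
      fix c show "{z \<in> space ?P. distortion n (Uvec a z) c > d} \<in> sets ?P"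
        using measurable_distortion_Uvec[of n a c \<sigma>] by measurable
    qed
    let ?T = "lin {..<n} (mode_basis a n)"
    have "measure ?P ?F = measure ?P (?T -` ?F \<inter> space ?P)"
      using measure_distr[OF Zmeas_lin_mode_basis(1)[OF a s] Fm] unfolding Zmeas_lin_mode_basis(2)[OF a s] .
    also have "\<dots> \<le> measure ?P (E1 \<union> (E2 \<union> (E3 \<union> (E4 \<union> (E5 \<union> (E6 \<union> Bad))))))"
    proof (rule P.finite_measure_mono)
      show "E1 \<union> (E2 \<union> (E3 \<union> (E4 \<union> (E5 \<union> (E6 \<union> Bad))))) \<in> sets ?P" using Esets Bad(1) by auto
      show "?T -` ?F \<inter> space ?P \<subseteq> E1 \<union> (E2 \<union> (E3 \<union> (E4 \<union> (E5 \<union> (E6 \<union> Bad)))))"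
      proof (rule subsetI, rule ccontr)
        fix \<zeta> assume F: "\<zeta> \<in> ?T -` ?F \<inter> space ?P" and nE: "\<zeta> \<notin> E1 \<union> (E2 \<union> (E3 \<union> (E4 \<union> (E5 \<union> (E6 \<union> Bad)))))"
        have \<zeta>P: "\<zeta> \<in> space ?P" using F by simp
        have "\<zeta> \<in> G - Bad" using nE \<zeta>P by (simp add: G_def)
        from cov[OF this] obtain y where y: "y \<in> Y" "(\<Sum>k\<in>?I. (sqrt (?\<tau> k) * ?z \<zeta> k - y k)^2) \<le> real n * d - (d + 2)" by blast
        have y2: "(\<Sum>k\<in>?I. (\<zeta> k / sqrt (gfun_grid a n k) - y k)^2) \<le> real n * d - (d + 2)"
        proof -
          have "sqrt (?\<tau> k) * ?z \<zeta> k = \<zeta> k / sqrt (gfun_grid a n k)" for k using s by (simp add: real_sqrt_divide)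
          then show ?thesis using y(2) by simp
        qed
        have "\<bar>(\<zeta> 0 / \<sigma>)^2 - 1\<bar> < real n" using nE \<zeta>P by (simp add: E6_def)
        then have "(\<zeta> 0 / \<sigma>)^2 \<le> real n + 1" by linarith
        also have "\<dots> \<le> (real n)^2"
        proof -
          have "2 * real n \<le> real n * real n" using n2 by (intro mult_right_mono) auto
          moreover have "real n + 1 \<le> 2 * real n" using n2 by simp
          ultimately show ?thesis unfolding power2_eq_square by linarith
        qed
        finally have "\<bar>\<zeta> 0 / \<sigma>\<bar> \<le> real n" using abs_le_square_iff[of "\<zeta> 0 / \<sigma>" "real n"] by simp
        then have "\<bar>\<zeta> 0\<bar> \<le> \<sigma> * real n" using s by (simp add: divide_le_eq mult.commute)
        then have "\<bar>last_scale a n * \<zeta> 0\<bar> \<le> last_scale a n * \<sigma> * real n" using snp by (simp add: abs_mult mult.assoc)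
        from Q(4)[OF this] obtain q where q: "q \<in> Q" "\<bar>last_scale a n * \<zeta> 0 - q\<bar> \<le> 1 / real n" by blast
        have "distortion n (Uvec a (?T \<zeta>)) (\<lambda>i. (\<Sum>k=1..<n. sine_mode n k (Suc i) * y k) + last_coeff a n i * q) \<le> d"
          by (rule square_error_upper_bound[OF a n d _ y2 q(2)]) (simp add: lin_def)
        moreover have "(\<lambda>i. (\<Sum>k=1..<n. sine_mode n k (Suc i) * y k) + last_coeff a n i * q) \<in> Cb"
          unfolding Cb_def by (rule image_eqI[of _ _ "(y, q)"]) (use y(1) q(1) in auto)
        ultimately show False using F by force
      qed
    qed
    also have "\<dots> \<le> measure ?P E1 + (measure ?P E2 + (measure ?P E3 + (measure ?P E4 + (measure ?P E5 + (measure ?P E6 + measure ?P Bad)))))"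
      using Esets Bad(1) by (intro order_trans[OF measure_Un_le] add_left_mono sets.Un) auto
    also have "\<dots> \<le> \<epsilon>"
    proof -
      have "8 * \<epsilon>0 = \<epsilon> - Qfun (x / sqrt V)" by (simp only: \<epsilon>0_def times_divide_eq_right nonzero_mult_div_cancel_left zero_neq_numeral not_False_eq_True)
      then have "measure ?P E5 \<le> \<epsilon> - 7 * \<epsilon>0" using P5 by linarith
      then have "measure ?P E1 + (measure ?P E2 + (measure ?P E3 + (measure ?P E4 + (measure ?P E5 + (measure ?P E6 + measure ?P Bad)))))
        \<le> \<epsilon>0 + (\<epsilon>0 + (\<epsilon>0 + (\<epsilon>0 + ((\<epsilon> - 7 * \<epsilon>0) + (\<epsilon>0 + \<epsilon>0)))))"
        using P1 P2 P3 P4 P6 PBad by (intro add_mono)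
      then show ?thesis using \<epsilon>0 by linarith
    qed
    finally have "measure ?P ?F \<le> \<epsilon>" .
    then have code: "has_code a \<sigma> n (card Cb) d \<epsilon>" by (rule has_code_codebook[OF Cb])
    have "ln (real (card Cb)) \<le> real n * RU a \<sigma> \<theta> + (x + \<kappa>) * ?sq"
    proof -
      define W where "W = 2 * \<sigma> * (real n)^2 + 3"
      have W: "W > 0" unfolding W_def using s by (simp add: add_nonneg_pos)
      have c0: "real (card Cb) > 0" using Cb by (simp add: card_gt_0_iff)
      have "ln (real (card Cb)) \<le> ln ((2 * real J * C3 * (4 * real J) * exp X) * 2 * (last_scale a n * W))"
        using cardCb c0 unfolding W_def by (intro ln_mono) auto
      also have "\<dots> = ln (2 * real J * C3) + ln (4 * real J) + X + ln 2 + (ln (last_scale a n) + ln W)"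
      proof -
        have pos: "2 * real J * C3 > 0" "4 * real J > 0" "exp X > 0" "last_scale a n > 0" "C3 > 0" using J0 C3(1) snp by auto
        have "ln ((2 * real J * C3 * (4 * real J) * exp X) * 2 * (last_scale a n * W))
          = ln (2 * real J * C3 * (4 * real J) * exp X * 2) + ln (last_scale a n * W)" using pos W by (intro ln_mult_pos mult_pos_pos) auto
        also have "ln (last_scale a n * W) = ln (last_scale a n) + ln W" using pos W by (intro ln_mult_pos)
        also have "ln (2 * real J * C3 * (4 * real J) * exp X * 2) = ln (2 * real J * C3 * (4 * real J) * exp X) + ln 2"
          using pos by (intro ln_mult_pos mult_pos_pos) auto
        also have "ln (2 * real J * C3 * (4 * real J) * exp X) = ln (2 * real J * C3 * (4 * real J)) + ln (exp X)"
          using pos by (intro ln_mult_pos mult_pos_pos) auto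
        also have "ln (2 * real J * C3 * (4 * real J)) = ln (2 * real J * C3) + ln (4 * real J)"
          using pos by (intro ln_mult_pos)
        finally show ?thesis by simp
      qed
      finally have 1: "ln (real (card Cb)) \<le> ln (2 * real J * C3) + ln (4 * real J) + X + ln 2 + (ln (last_scale a n) + ln W)" .
      have 2: "K4^2 * ?sq^2 / (?m * \<theta>^2) \<le> C2"
      proof -
        have "K4^2 * real n / (?m * \<theta>^2) \<le> K4^2 * real n / ((\<eta> * real n / 2) * \<theta>^2)"
          using mlo mpos e2 t n by (intro divide_left_mono mult_right_mono mult_pos_pos) auto
        also have "\<dots> = C2" unfolding C2_def using n by simp
        finally show ?thesis by simp
      qed
      have 3: "2 * (\<delta> * ?sq) / \<theta> = \<kappa> / 4 * ?sq" unfolding \<delta>_def using t by simp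
      have 4: "(x + \<kappa>) * ?sq = x * ?sq + \<kappa> * ?sq" by (simp add: distrib_right)
      show ?thesis using 1 2 3 4 L e5 unfolding X_def C4_def W_def[symmetric] by linarith
    qed
    then show ?case using code Cb by (intro exI[of _ "card Cb"]) (simp add: card_gt_0_iff)
  qed
qed

section \<open>The Gaussian tail function and its inverse\<close>

lemma Qfun_strict_antimono:
  assumes "x < y"
  shows "Qfun y < Qfun x"
proof -
  interpret G: real_distribution std_normal_distribution by (rule real_dist_normal_dist)
  have "0 < measure std_normal_distribution {x<..y}"
  proof (rule ccontr)
    assume "\<not> 0 < measure std_normal_distribution {x<..y}"
    then have "emeasure std_normal_distribution {x<..y} = 0"
      by (simp add: G.emeasure_eq_measure measure_le_0_iff not_less)
    then have "AE z in lborel. z \<in> {x<..y} \<longrightarrow> std_normal_density z \<le> 0"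
      by (subst (asm) emeasure_density, simp, simp, subst (asm) nn_integral_0_iff_AE) (auto simp: indicator_def elim: eventually_mono)
    then have "AE z in lborel. z \<notin> {x<..y}"
    proof eventually_elim
      case (elim z)
      have "0 < std_normal_density z" by (rule normal_density_pos) simp
      then show ?case using elim by linarith
    qed
    then have "{x<..y} \<in> null_sets lborel" by (subst AE_iff_null_sets) auto
    then have "emeasure lborel {x<..y} = 0" by (rule null_setsD1)
    then show False using assms by simp
  qed
  moreover have "Qfun x = Qfun y + measure std_normal_distribution {x<..y}"
  proof -
    have "{x<..} = {x<..y} \<union> {y<..}" using assms by auto
    moreover have "measure std_normal_distribution ({x<..y} \<union> {y<..}) = measure std_normal_distribution {x<..y} + measure std_normal_distribution {y<..}"
      by (rule G.finite_measure_Union) auto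
    ultimately show ?thesis unfolding Qfun_def by (simp only: add.commute)
  qed
  ultimately show ?thesis by simp
qed

text \<open>Continuity and the limits 1 and 0 give a solution, strict monotonicity makes it unique,
  so the description in \<open>Qinv\<close> denotes it.\<close>

lemma Qfun_Qinv:
  assumes "0 < \<epsilon>" "\<epsilon> < 1"
  shows "Qfun (Qinv \<epsilon>) = \<epsilon>"
proof -
  interpret G: real_distribution std_normal_distribution by (rule real_dist_normal_dist)
  have cont: "isCont Qfun x" for x
  proof -
    have "isCont (cdf std_normal_distribution) x" by (simp only: G.isCont_cdf measure_std_normal_singleton)
    then have "isCont (\<lambda>x. 1 - cdf std_normal_distribution x) x" by (intro continuous_intros)
    then show ?thesis unfolding Qfun_eq_cdf[abs_def] .
  qed
  have "(Qfun \<longlongrightarrow> 1 - 1) at_top" unfolding Qfun_eq_cdf[abs_def] by (intro tendsto_intros G.cdf_lim_at_top_prob)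
  then have "eventually (\<lambda>x. Qfun x < \<epsilon>) at_top" using assms by (intro order_tendstoD(2)) auto
  then obtain b where b: "Qfun b < \<epsilon>" by (auto simp: eventually_at_top_linorder)
  have "(Qfun \<longlongrightarrow> 1 - 0) at_bot" unfolding Qfun_eq_cdf[abs_def] by (intro tendsto_intros G.cdf_lim_at_bot)
  then have "eventually (\<lambda>x. \<epsilon> < Qfun x) at_bot" using assms by (intro order_tendstoD(1)) auto
  then obtain a where a: "\<epsilon> < Qfun a" by (auto simp: eventually_at_bot_linorder)
  have "a \<le> b" using Qfun_strict_antimono[of b a] a b by (cases "a \<le> b") auto
  then obtain x where x: "Qfun x = \<epsilon>"
    using IVT2[of Qfun b \<epsilon> a] a b cont by auto
  have "\<exists>!x. Qfun x = \<epsilon>"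
    using x Qfun_strict_antimono by (intro ex1I[of _ x]) (auto, metis less_irrefl linorder_neqE_linordered_idom)
  then show ?thesis unfolding Qinv_def by (rule theI')
qed

lemma Qfun_less_iff: "Qfun x < Qfun y \<longleftrightarrow> y < x"
  using Qfun_strict_antimono[of y x] Qfun_strict_antimono[of x y] by (cases x y rule: linorder_cases) auto

lemma Qfun_pos: "0 < Qfun x"
  using Qfun_strict_antimono[of x "x + 1"] by (simp add: Qfun_def le_less_trans[OF measure_nonneg])

section \<open>Converse asymptotics and the limit of the rate\<close>

lemma converse:
  assumes a: "a > 1" and s: "\<sigma> > 0" and t: "\<theta> > 0"
    and D: "d = (1 / (2 * pi)) * integral {-pi..pi} (\<lambda>w. min \<theta> (\<sigma>^2 / gfun a w))"
    and \<epsilon>: "\<epsilon> < Qfun (x / sqrt (VU a \<sigma> \<theta>))" and \<kappa>: "\<kappa> > 0"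
  shows "eventually (\<lambda>n. \<forall>M. has_code a \<sigma> n M d \<epsilon> \<longrightarrow> M \<ge> 1 \<and> real n * RU a \<sigma> \<theta> + (x - \<kappa>) * sqrt (real n) \<le> ln (real M)) sequentially"
proof -
  define V where "V = VU a \<sigma> \<theta>"
  have V: "V > 0" unfolding V_def by (rule VU_pos[OF a s t])
  obtain C1 where C1: "\<And>n. n > 0 \<Longrightarrow> \<bar>(\<Sum>k=1..<n. min \<theta> (\<sigma>^2 / gfun_grid a n k)) - real n * d\<bar> \<le> C1"
    using Riemann_distortion[OF a s t D] by blast
  obtain CR where CR: "\<And>n. n > 0 \<Longrightarrow> \<bar>(\<Sum>k=1..<n. (1/2) * ln (max (gfun_grid a n k) (\<sigma>^2 / \<theta>))) - real n * RU a \<sigma> \<theta>\<bar> \<le> CR"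
    using Riemann_RU[OF a s t] by blast
  define tail where "tail n = measure (Zmeas \<sigma> n) {z \<in> space (Zmeas \<sigma> n). (\<Sum>k=1..<n. mode_weight a \<sigma> \<theta> n k * ((z k)^2 / \<sigma>^2 - 1) / 2) > x * sqrt (real n)}" for n
  have tail: "tail \<longlonglongrightarrow> Qfun (x / sqrt V)"
    unfolding tail_def
  proof (rule Zmeas_tail_limit[OF s V])
    show "0 \<le> mode_weight a \<sigma> \<theta> n k" "mode_weight a \<sigma> \<theta> n k \<le> 1" for n k
      using gfun_grid_pos[OF a, of n k] t s by (auto simp: mode_weight_def)
    show "(\<lambda>n. (\<Sum>k = 1..<n. (mode_weight a \<sigma> \<theta> n k)^2 / 2) / real n) \<longlonglongrightarrow> V"
      unfolding mode_weight_def V_def by (rule Riemann_VU[OF a s t])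
  qed
  \<comment> \<open>The slack is split in two: one half is the exponent \<gamma> of the union bound,
    whose penalty vanishes, and the other absorbs the constant \<open>C\<close>.\<close>
  have "(\<lambda>n. exp (- (\<kappa> / 2 * sqrt (real n)))) \<longlonglongrightarrow> 0" using \<kappa> by real_asymp
  then have "(\<lambda>n. tail n - exp (- (\<kappa> / 2 * sqrt (real n)))) \<longlonglongrightarrow> Qfun (x / sqrt V) - 0"
    by (intro tendsto_diff tail)
  then have ev1: "eventually (\<lambda>n. \<epsilon> < tail n - exp (- (\<kappa> / 2 * sqrt (real n)))) sequentially"
    using \<epsilon> by (intro order_tendstoD(1)) (auto simp: V_def)
  define C where "C = CR + \<bar>ln (\<sigma>^2 / \<theta>)\<bar> / 2 + C1 / (2 * \<theta>)"
  have ev2: "eventually (\<lambda>n. C \<le> \<kappa> / 2 * sqrt (real n)) sequentially" using \<kappa> by real_asymp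
  have ev3: "eventually (\<lambda>n. n > (0::nat)) sequentially" by (rule eventually_gt_at_top)
  from ev1 ev2 ev3 show ?thesis
  proof eventually_elim
    case (elim n)
    note e1 = elim(1) and e2 = elim(2) and n = elim(3)
    show ?case
    proof (intro allI impI)
      fix M assume code: "has_code a \<sigma> n M d \<epsilon>"
      let ?P = "Zmeas \<sigma> n"
      let ?S = "\<lambda>\<zeta>. \<Sum>k=1..<n. mode_weight a \<sigma> \<theta> n k * ((\<zeta> k)^2 / \<sigma>^2 - 1) / 2"
      interpret P: prob_space ?P using s by (rule Zmeas_prob_space)
      define \<gamma> where "\<gamma> = \<kappa> / 2 * sqrt (real n)"
      define A where "A = (\<Sum>k=1..<n. mode_rate a \<sigma> \<theta> n k) + ln (sqrt (\<sigma>^2 * (last_scale a n)^2 / \<theta>)) + (\<Sum>k=1..<n. mode_weight a \<sigma> \<theta> n k) / 2 - real n * d / (2*\<theta>)"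
      note cb = converse_bound[OF a s t n code, folded A_def]
      have snp: "last_scale a n > 0" using last_scale_ge_1[OF a n] by simp
      have l: "ln (sqrt (\<sigma>^2 * (last_scale a n)^2 / \<theta>)) = ln (last_scale a n) + ln (\<sigma>^2 / \<theta>) / 2"
      proof -
        have "ln (\<sigma>^2 * (last_scale a n)^2 / \<theta>) = ln ((\<sigma>^2 / \<theta>) * (last_scale a n)^2)" by simp
        also have "\<dots> = ln (\<sigma>^2 / \<theta>) + ln ((last_scale a n)^2)" using s t snp by (intro ln_mult_pos) auto
        also have "ln ((last_scale a n)^2) = 2 * ln (last_scale a n)" using snp by (simp add: ln_realpow)
        finally show ?thesis using s t snp by (simp add: ln_sqrt)
      qed
      have w: "(\<Sum>k=1..<n. mode_weight a \<sigma> \<theta> n k) / 2 - real n * d / (2*\<theta>) = ((\<Sum>k=1..<n. min \<theta> (\<sigma>^2 / gfun_grid a n k)) - real n * d) / (2 * \<theta>)"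
      proof -
        have "mode_weight a \<sigma> \<theta> n k = min \<theta> (\<sigma>^2 / gfun_grid a n k) / \<theta>" for k
          using t gfun_grid_pos[OF a, of n k] unfolding mode_weight_def by (auto simp: min_def field_simps)
        then show ?thesis by (simp add: sum_divide_distrib[symmetric] diff_divide_distrib)
      qed
      have w2: "- (C1 / (2 * \<theta>)) \<le> ((\<Sum>k=1..<n. min \<theta> (\<sigma>^2 / gfun_grid a n k)) - real n * d) / (2 * \<theta>)"
        using C1[OF n] t unfolding minus_divide_left by (intro divide_right_mono) (auto simp: abs_le_iff)
      have A: "real n * RU a \<sigma> \<theta> - C \<le> A"
        using sum_mode_rate_add_ln_last_scale[OF a s t n] CR[OF n] l w w2 unfolding A_def C_def by linarith
      show "M \<ge> 1 \<and> real n * RU a \<sigma> \<theta> + (x - \<kappa>) * sqrt (real n) \<le> ln (real M)"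
      proof (intro conjI cb(1), rule ccontr)
        assume "\<not> real n * RU a \<sigma> \<theta> + (x - \<kappa>) * sqrt (real n) \<le> ln (real M)"
        then have "ln (real M) < real n * RU a \<sigma> \<theta> + x * sqrt (real n) - \<kappa> * sqrt (real n)" by (simp add: algebra_simps)
        then have lo: "ln (real M) + \<gamma> - A \<le> x * sqrt (real n)" using A e2 unfolding \<gamma>_def by linarith
        have Sm: "?S \<in> borel_measurable ?P"
          by (intro borel_measurable_sum borel_measurable_times borel_measurable_diff borel_measurable_power borel_measurable_divide borel_measurable_const measurable_Zmeas_component) auto
        have "tail n \<le> measure ?P {\<zeta> \<in> space ?P. ?S \<zeta> \<ge> ln (real M) + \<gamma> - A}"
          unfolding tail_def using lo Sm by (intro P.finite_measure_mono) auto
        also have "\<dots> \<le> \<epsilon> + exp (- \<gamma>)" by (rule cb(2))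
        finally show False using e1 unfolding \<gamma>_def by linarith
      qed
    qed
  qed
qed

text \<open>Offsets above \<open>sqrt V * Qinv \<epsilon>\<close> are attained and those below are
  excluded. The bound on \<epsilon> makes \<open>Qinv \<epsilon>\<close> positive, since
  \<open>achievability\<close> wants a nonnegative offset. That lemma also supplies a code, so the
  \<open>LEAST\<close> is attained, and \<open>converse\<close> excludes size 0.\<close>

lemma Rn_limit:
  assumes a: "a > 1" and s: "\<sigma> > 0" and d: "d > 0" "d < \<sigma>^2 / (a^2 - 1)" and t: "\<theta> > 0"
    and D: "d = (1 / (2 * pi)) * integral {-pi..pi} (\<lambda>w. min \<theta> (\<sigma>^2 / gfun a w))"
    and \<epsilon>: "0 < \<epsilon>" "\<epsilon> < Qfun 0"
  shows "(\<lambda>n. sqrt (real n) * (Rn a \<sigma> n d \<epsilon> - RU a \<sigma> \<theta>)) \<longlonglongrightarrow> sqrt (VU a \<sigma> \<theta>) * Qinv \<epsilon>"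
proof -
  define V where "V = VU a \<sigma> \<theta>"
  have V: "V > 0" unfolding V_def by (rule VU_pos[OF a s t])
  have t2: "\<theta> < \<sigma>^2 / (a - 1)^2" by (rule water_level_less[OF a s d(2) D])
  interpret G: real_distribution std_normal_distribution by (rule real_dist_normal_dist)
  have "Qfun 0 \<le> 1" unfolding Qfun_def by simp
  then have Q: "Qfun (Qinv \<epsilon>) = \<epsilon>" using \<epsilon> by (intro Qfun_Qinv) auto
  have Q0: "Qinv \<epsilon> > 0" using Qfun_less_iff[of "Qinv \<epsilon>" 0] Q \<epsilon> by simp
  define y where "y = sqrt V * Qinv \<epsilon>"
  have y0: "y > 0" using V Q0 by (simp add: y_def)
  let ?r = "\<lambda>n. sqrt (real n) * (Rn a \<sigma> n d \<epsilon> - RU a \<sigma> \<theta>)"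
  have ev: "eventually (\<lambda>n. y - 2 * e \<le> ?r n \<and> ?r n \<le> y + 2 * e) sequentially" if e: "e > 0" for e
  proof -
    \<comment> \<open>The first \<open>e\<close> moves the offset off the quantile and gives a
      strict inequality for \<epsilon>; the second is the slack \<kappa>.\<close>
    have "Qfun ((y + e) / sqrt V) < Qfun (Qinv \<epsilon>)"
      unfolding Qfun_less_iff using V e by (simp add: y_def less_divide_eq mult.commute)
    then have up: "eventually (\<lambda>n. \<exists>M. has_code a \<sigma> n M d \<epsilon> \<and> M > 0 \<and> ln (real M) \<le> real n * RU a \<sigma> \<theta> + ((y + e) + e) * sqrt (real n)) sequentially"
      using y0 e unfolding Q V_def by (intro achievability[OF a s d(1) t t2 D]) auto
    have "Qfun (Qinv \<epsilon>) < Qfun ((y - e) / sqrt V)"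
      unfolding Qfun_less_iff using V e by (simp add: y_def divide_less_eq mult.commute)
    then have lo: "eventually (\<lambda>n. \<forall>M. has_code a \<sigma> n M d \<epsilon> \<longrightarrow> M \<ge> 1 \<and> real n * RU a \<sigma> \<theta> + ((y - e) - e) * sqrt (real n) \<le> ln (real M)) sequentially"
      using e unfolding Q V_def by (intro converse[OF a s t D]) auto
    have "eventually (\<lambda>n. n > (0::nat)) sequentially" by (rule eventually_gt_at_top)
    with up lo show ?thesis
    proof eventually_elim
      case (elim n)
      define L where "L = (LEAST M. has_code a \<sigma> n M d \<epsilon>)"
      obtain M where M: "has_code a \<sigma> n M d \<epsilon>" "M > 0" "ln (real M) \<le> real n * RU a \<sigma> \<theta> + ((y + e) + e) * sqrt (real n)"
        using elim(1) by blast
      have Lc: "has_code a \<sigma> n L d \<epsilon>" unfolding L_def using M(1) by (rule LeastI)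
      have LM: "L \<le> M" unfolding L_def using M(1) by (rule Least_le)
      have L1: "L \<ge> 1" and Llo: "real n * RU a \<sigma> \<theta> + ((y - e) - e) * sqrt (real n) \<le> ln (real L)" using elim(2) Lc by auto
      have Lhi: "ln (real L) \<le> real n * RU a \<sigma> \<theta> + ((y + e) + e) * sqrt (real n)"
      proof -
        have "ln (real L) \<le> ln (real M)" using LM L1 by (intro ln_mono) auto
        then show ?thesis using M(3) by linarith
      qed
      have n: "n > 0" using elim(3) .
      have sq: "sqrt (real n) > 0" using n by simp
      have r: "?r n = (ln (real L) - real n * RU a \<sigma> \<theta>) / sqrt (real n)"
      proof -
        have "Rn a \<sigma> n d \<epsilon> - RU a \<sigma> \<theta> = (ln (real L) - real n * RU a \<sigma> \<theta>) / real n"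
          unfolding Rn_def L_def[symmetric] using n by (simp add: field_simps)
        then have "?r n = sqrt (real n) * ((ln (real L) - real n * RU a \<sigma> \<theta>) / (sqrt (real n) * sqrt (real n)))" by simp
        then show ?thesis using sq by (simp only: times_divide_eq_right mult_divide_mult_cancel_left less_imp_neq[THEN not_sym] not_False_eq_True if_False)
      qed
      show ?case unfolding r using Llo Lhi sq by (simp add: le_divide_eq divide_le_eq algebra_simps)
    qed
  qed
  have "?r \<longlonglongrightarrow> y"
  proof (rule LIMSEQ_I)
    fix e :: real assume e: "e > 0"
    have "eventually (\<lambda>n. y - 2 * (e / 4) \<le> ?r n \<and> ?r n \<le> y + 2 * (e / 4)) sequentially" using e by (intro ev) auto
    then have "eventually (\<lambda>n. norm (?r n - y) < e) sequentially"
      by eventually_elim (use e in \<open>auto simp: abs_less_iff\<close>)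
    then show "\<exists>no. \<forall>n\<ge>no. norm (?r n - y) < e" by (simp add: eventually_sequentially)
  qed
  then show ?thesis unfolding y_def V_def .
qed

theorem theorem5:
  fixes a \<sigma> d \<theta> :: real
  assumes "a > 1" and "\<sigma> > 0"
    and "d > 0" and "d < \<sigma>^2 / (a^2 - 1)"
    and "\<theta> > 0"
    and "d = (1 / (2 * pi)) * integral {-pi..pi} (\<lambda>w. min \<theta> (\<sigma>^2 / gfun a w))"
  shows "((\<lambda>\<epsilon>. limsup (\<lambda>n. ereal (real n *
            ((Rn a \<sigma> n d \<epsilon> - RU a \<sigma> \<theta>) / Qinv \<epsilon>)^2)))
          \<longlongrightarrow> ereal (VU a \<sigma> \<theta>)) (at_right 0)"
proof (rule tendsto_eventually)
  interpret G: real_distribution std_normal_distribution by (rule real_dist_normal_dist)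
  have V: "VU a \<sigma> \<theta> > 0" by (rule VU_pos[OF assms(1,2,5)])
  have lim: "limsup (\<lambda>n. ereal (real n * ((Rn a \<sigma> n d \<epsilon> - RU a \<sigma> \<theta>) / Qinv \<epsilon>)^2)) = ereal (VU a \<sigma> \<theta>)"
    if \<epsilon>: "0 < \<epsilon>" "\<epsilon> < Qfun 0" for \<epsilon>
  proof -
    have "Qfun 0 \<le> 1" unfolding Qfun_def by simp
    then have "Qfun (Qinv \<epsilon>) = \<epsilon>" using \<epsilon> by (intro Qfun_Qinv) auto
    then have Q0: "Qinv \<epsilon> > 0" using Qfun_less_iff[of "Qinv \<epsilon>" 0] \<epsilon> by simp
    have "(\<lambda>n. (sqrt (real n) * (Rn a \<sigma> n d \<epsilon> - RU a \<sigma> \<theta>))^2 / (Qinv \<epsilon>)^2) \<longlonglongrightarrow> (sqrt (VU a \<sigma> \<theta>) * Qinv \<epsilon>)^2 / (Qinv \<epsilon>)^2"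
      using Q0 by (intro tendsto_intros Rn_limit assms \<epsilon>) auto
    also have "(sqrt (VU a \<sigma> \<theta>) * Qinv \<epsilon>)^2 / (Qinv \<epsilon>)^2 = VU a \<sigma> \<theta>"
      using V Q0 by (simp add: power_mult_distrib)
    also have "(\<lambda>n. (sqrt (real n) * (Rn a \<sigma> n d \<epsilon> - RU a \<sigma> \<theta>))^2 / (Qinv \<epsilon>)^2) = (\<lambda>n. real n * ((Rn a \<sigma> n d \<epsilon> - RU a \<sigma> \<theta>) / Qinv \<epsilon>)^2)"
      by (simp add: power_mult_distrib power_divide)
    finally have "(\<lambda>n. ereal (real n * ((Rn a \<sigma> n d \<epsilon> - RU a \<sigma> \<theta>) / Qinv \<epsilon>)^2)) \<longlonglongrightarrow> ereal (VU a \<sigma> \<theta>)"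
      by (rule tendsto_ereal)
    then show ?thesis by (intro lim_imp_Limsup) auto
  qed
  \<comment> \<open>The limit superior already equals the dispersion for each \<epsilon> in this
    interval, so the function of \<epsilon> is eventually constant.\<close>
  have "eventually (\<lambda>\<epsilon>. \<epsilon> \<in> {0<..<Qfun 0}) (at_right 0)"
    by (rule eventually_at_right_real[OF Qfun_pos])
  then show "eventually (\<lambda>\<epsilon>. limsup (\<lambda>n. ereal (real n * ((Rn a \<sigma> n d \<epsilon> - RU a \<sigma> \<theta>) / Qinv \<epsilon>)^2)) = ereal (VU a \<sigma> \<theta>)) (at_right 0)"
    by eventually_elim (auto intro: lim)
qed

end
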